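(* Let $(M,g)$ be a Lorentzian 4-manifold and let $k$ be a complete smooth null vector field on $M$ satisfying $\nabla_k k = 0$ and $\mathrm{Ric}(k,k) > 0$ everywhere on $M$. If there exists a smooth function $f : M \to \mathbb{R}$ such that $k(f)$ is nowhere vanishing, then, for such an $f$, the 2-form $\omega := d\big(g(e^f k,\cdot)\big)$ is a symplectic form on $M$ and $k/k(f)$ is a Liouville vector field for $\omega$, i.e. $\mathscr{L}_{k/k(f)}\,\omega = \omega$.
   Context: A Lorentzian metric on a smooth manifold is a smooth symmetric nondegenerate 2-tensor $g$ of signature $(-,+,\dots,+)$. A vector field $k$ is null if at every point $k$ is nonzero and $g(k,k)=0$; it is complete if its flow is defined for all time (all its integral curves are defined on all of $\mathbb{R}$). $\nabla$ is the Levi-Civita connection of $g$ and $\mathrm{Ric}$ its Ricci tensor, with the sign convention $\mathrm{Ric}(X,Y)=\mathrm{tr}(V\mapsto R(V,X)Y)$, $R(V,X)Y=\nabla_V\nabla_X Y-\nabla_X\nabla_V Y-\nabla_{[V,X]}Y$ (so round spheres have positive Ricci curvature). $g(e^f k,\cdot)$ is the 1-form metrically equivalent to $e^f k$, $d$ is the exterior derivative, $k(f)=df(k)$, and $\mathscr{L}$ is the Lie derivative. A symplectic form is a closed nondegenerate 2-form. *)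

theory Defs
  imports "HOL-Analysis.Analysis"
begin

text \<open>Functions of class \<open>C\<^sup>k\<close> and \<open>C\<^sup>\<infinity>\<close> on an open subset of a finite-dimensional space:
  all iterated directional derivatives exist, are differentiable and continuous.\<close>

primrec Ck_on :: "nat \<Rightarrow> 'b::real_normed_vector set \<Rightarrow> ('b \<Rightarrow> 'c::real_normed_vector) \<Rightarrow> bool" where
  "Ck_on 0 S f \<longleftrightarrow> continuous_on S f"
| "Ck_on (Suc k) S f \<longleftrightarrow> (\<forall>x\<in>S. f differentiable (at x)) \<and>
     (\<forall>v. Ck_on k S (\<lambda>x. frechet_derivative f (at x) v))"

definition smooth_on :: "'b::real_normed_vector set \<Rightarrow> ('b \<Rightarrow> 'c::real_normed_vector) \<Rightarrow> bool" where
  "smooth_on S f \<longleftrightarrow> open S \<and> (\<forall>k. Ck_on k S f)"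

text \<open>A manifold is a whole type of class \<open>{t2_space, second_countable_topology}\<close> together with a
  smooth atlas covering it. The atlas is not required to be maximal; nothing below changes when it
  is enlarged by compatible charts.\<close>

type_synonym ('a, 'n) chart = "'a set \<times> ('a \<Rightarrow> real ^ 'n)"

definition smooth_atlas :: "('a::{t2_space, second_countable_topology}, 'n::finite) chart set \<Rightarrow> bool" where
  "smooth_atlas A \<longleftrightarrow>
     (\<forall>(U, \<phi>)\<in>A. open U \<and> open (\<phi> ` U) \<and> homeomorphism U (\<phi> ` U) \<phi> (inv_into U \<phi>)) \<and>
     (\<Union>(U, \<phi>)\<in>A. U) = UNIV \<and>
     (\<forall>(U, \<phi>)\<in>A. \<forall>(V, \<psi>)\<in>A. smooth_on (\<phi> ` (U \<inter> V)) (\<psi> \<circ> inv_into U \<phi>))"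

definition smooth_fun_on ::
  "('a::topological_space, 'n::finite) chart set \<Rightarrow> 'a set \<Rightarrow> ('a \<Rightarrow> real) \<Rightarrow> bool" where
  "smooth_fun_on A W f \<longleftrightarrow> open W \<and> (\<forall>(U, \<phi>)\<in>A. smooth_on (\<phi> ` (U \<inter> W)) (f \<circ> inv_into U \<phi>))"

definition smooth_near ::
  "('a::topological_space, 'n::finite) chart set \<Rightarrow> 'a \<Rightarrow> ('a \<Rightarrow> real) \<Rightarrow> bool" where
  "smooth_near A p f \<longleftrightarrow> (\<exists>W. p \<in> W \<and> smooth_fun_on A W f)"

text \<open>Tangent vectors at \<open>p\<close> are derivations of the algebra of germs at \<open>p\<close> of smooth functions.
  A derivation is represented by a functional on all functions, which depends only on the germ at
  \<open>p\<close> and, by convention, vanishes on functions that are not smooth near \<open>p\<close>; with this convention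
  equality of functionals is equality of tangent vectors, and linear combinations are pointwise.\<close>

type_synonym 'a tangent = "('a \<Rightarrow> real) \<Rightarrow> real"

type_synonym 'a vfield = "'a \<Rightarrow> 'a tangent"

definition tangent_space ::
  "('a::topological_space, 'n::finite) chart set \<Rightarrow> 'a \<Rightarrow> 'a tangent set" where
  "tangent_space A p = {v.
     (\<forall>f. \<not> smooth_near A p f \<longrightarrow> v f = 0) \<and>
     (\<forall>f h. smooth_near A p f \<and> (\<forall>\<^sub>F q in nhds p. f q = h q) \<longrightarrow> v f = v h) \<and>
     (\<forall>f h a b. smooth_near A p f \<and> smooth_near A p h \<longrightarrow>
        v (\<lambda>q. a * f q + b * h q) = a * v f + b * v h) \<and>
     (\<forall>f h. smooth_near A p f \<and> smooth_near A p h \<longrightarrow>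
        v (\<lambda>q. f q * h q) = v f * h p + f p * v h)}"

definition vector_field_on ::
  "('a::topological_space, 'n::finite) chart set \<Rightarrow> 'a set \<Rightarrow> 'a vfield \<Rightarrow> bool" where
  "vector_field_on A U X \<longleftrightarrow> open U \<and> (\<forall>p\<in>U. X p \<in> tangent_space A p) \<and>
     (\<forall>W f. W \<subseteq> U \<and> smooth_fun_on A W f \<longrightarrow> smooth_fun_on A W (\<lambda>p. X p f))"

definition vector_field_near ::
  "('a::topological_space, 'n::finite) chart set \<Rightarrow> 'a \<Rightarrow> 'a vfield \<Rightarrow> bool" where
  "vector_field_near A p X \<longleftrightarrow> (\<exists>U. p \<in> U \<and> vector_field_on A U X)"

text \<open>The case distinction implements the convention for \<open>tangent_space\<close>.\<close>

definition lie_bracket ::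
  "('a::topological_space, 'n::finite) chart set \<Rightarrow> 'a vfield \<Rightarrow> 'a vfield \<Rightarrow> 'a vfield" where
  "lie_bracket A X Y = (\<lambda>p f. if smooth_near A p f
     then X p (\<lambda>q. Y q f) - Y p (\<lambda>q. X q f) else 0)"

text \<open>A local smooth extension of \<open>v \<in> T\<^sub>pM\<close>. It is used below to evaluate tensors that are defined
  by formulas on vector fields (exterior derivative, Lie derivative, curvature); their values at
  \<open>p\<close> do not depend on the choice of the extension.\<close>

definition local_ext ::
  "('a::topological_space, 'n::finite) chart set \<Rightarrow> 'a \<Rightarrow> 'a tangent \<Rightarrow> 'a vfield" where
  "local_ext A p v = (SOME X. vector_field_near A p X \<and> X p = v)"

definition tangent_basis ::
  "('a::topological_space, 'n::finite) chart set \<Rightarrow> 'a \<Rightarrow> ('n \<Rightarrow> 'a tangent) \<Rightarrow> bool" where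
  "tangent_basis A p e \<longleftrightarrow> (\<forall>i. e i \<in> tangent_space A p) \<and>
     (\<forall>v\<in>tangent_space A p. \<exists>!c :: 'n \<Rightarrow> real. v = (\<lambda>f. \<Sum>i\<in>UNIV. c i * e i f))"

definition tangent_trace ::
  "('a::topological_space, 'n::finite) chart set \<Rightarrow> 'a \<Rightarrow> ('a tangent \<Rightarrow> 'a tangent) \<Rightarrow> real" where
  "tangent_trace A p L = (THE t. \<exists>e (m :: real ^ 'n ^ 'n). tangent_basis A p e \<and>
     (\<forall>j. L (e j) = (\<lambda>f. \<Sum>i\<in>UNIV. m $ i $ j * e i f)) \<and> t = trace m)"

text \<open>The flow of \<open>X\<close> is defined for all time. The condition on \<open>\<gamma>\<close> says that its velocity
  at \<open>t\<close>, as a derivation, is \<open>X (\<gamma> t)\<close>.\<close>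

definition integral_curve ::
  "('a::topological_space, 'n::finite) chart set \<Rightarrow> 'a vfield \<Rightarrow> (real \<Rightarrow> 'a) \<Rightarrow> bool" where
  "integral_curve A X \<gamma> \<longleftrightarrow> continuous_on UNIV \<gamma> \<and>
     (\<forall>t f. smooth_near A (\<gamma> t) f \<longrightarrow> ((\<lambda>s. f (\<gamma> s)) has_real_derivative X (\<gamma> t) f) (at t))"

definition complete_field ::
  "('a::topological_space, 'n::finite) chart set \<Rightarrow> 'a vfield \<Rightarrow> bool" where
  "complete_field A X \<longleftrightarrow> (\<forall>p. \<exists>\<gamma>. \<gamma> 0 = p \<and> integral_curve A X \<gamma>)"

text \<open>Covariant tensor fields are families of multilinear forms on the tangent spaces; their values
  on arguments outside the tangent space are irrelevant.\<close>

type_synonym 'a tensor1 = "'a \<Rightarrow> 'a tangent \<Rightarrow> real"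

type_synonym 'a tensor2 = "'a \<Rightarrow> 'a tangent \<Rightarrow> 'a tangent \<Rightarrow> real"

definition tensor2_field ::
  "('a::topological_space, 'n::finite) chart set \<Rightarrow> 'a tensor2 \<Rightarrow> bool" where
  "tensor2_field A T \<longleftrightarrow>
     (\<forall>p. \<forall>u\<in>tangent_space A p. \<forall>v\<in>tangent_space A p. \<forall>w\<in>tangent_space A p. \<forall>a b.
        T p (\<lambda>f. a * u f + b * v f) w = a * T p u w + b * T p v w \<and>
        T p w (\<lambda>f. a * u f + b * v f) = a * T p w u + b * T p w v) \<and>
     (\<forall>U X Y. vector_field_on A U X \<and> vector_field_on A U Y \<longrightarrow>
        smooth_fun_on A U (\<lambda>p. T p (X p) (Y p)))"

definition nondegenerate ::
  "('a::topological_space, 'n::finite) chart set \<Rightarrow> 'a tensor2 \<Rightarrow> bool" where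
  "nondegenerate A T \<longleftrightarrow> (\<forall>p. \<forall>v\<in>tangent_space A p.
     (\<forall>w\<in>tangent_space A p. T p v w = 0) \<longrightarrow> v = (\<lambda>_. 0))"

definition two_form ::
  "('a::topological_space, 'n::finite) chart set \<Rightarrow> 'a tensor2 \<Rightarrow> bool" where
  "two_form A \<omega> \<longleftrightarrow> tensor2_field A \<omega> \<and>
     (\<forall>p. \<forall>v\<in>tangent_space A p. \<forall>w\<in>tangent_space A p. \<omega> p v w = - \<omega> p w v)"

text \<open>Exterior derivatives of 1-forms and of 2-forms, without numerical prefactor:
  \<open>d\<alpha>(X, Y) = X(\<alpha>(Y)) - Y(\<alpha>(X)) - \<alpha>([X, Y])\<close>.\<close>

definition d1 ::
  "('a::topological_space, 'n::finite) chart set \<Rightarrow> 'a tensor1 \<Rightarrow> 'a tensor2" where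
  "d1 A \<alpha> p v w =
     (let X = local_ext A p v; Y = local_ext A p w in
        X p (\<lambda>q. \<alpha> q (Y q)) - Y p (\<lambda>q. \<alpha> q (X q)) - \<alpha> p (lie_bracket A X Y p))"

definition d2 ::
  "('a::topological_space, 'n::finite) chart set \<Rightarrow> 'a tensor2 \<Rightarrow>
   'a \<Rightarrow> 'a tangent \<Rightarrow> 'a tangent \<Rightarrow> 'a tangent \<Rightarrow> real" where
  "d2 A \<omega> p u v w =
     (let X = local_ext A p u; Y = local_ext A p v; Z = local_ext A p w in
        X p (\<lambda>q. \<omega> q (Y q) (Z q)) - Y p (\<lambda>q. \<omega> q (X q) (Z q)) + Z p (\<lambda>q. \<omega> q (X q) (Y q))
        - \<omega> p (lie_bracket A X Y p) (Z p) + \<omega> p (lie_bracket A X Z p) (Y p)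
        - \<omega> p (lie_bracket A Y Z p) (X p))"

text \<open>The Lie derivative of a covariant 2-tensor along \<open>V\<close>, i.e. the derivation extending
  \<open>L\<^sub>V h = V(h)\<close> and \<open>L\<^sub>V X = [V, X]\<close>.\<close>

definition lie_derivative2 ::
  "('a::topological_space, 'n::finite) chart set \<Rightarrow> 'a vfield \<Rightarrow> 'a tensor2 \<Rightarrow> 'a tensor2" where
  "lie_derivative2 A V T p v w =
     (let X = local_ext A p v; Y = local_ext A p w in
        V p (\<lambda>q. T q (X q) (Y q)) - T p (lie_bracket A V X p) (Y p) - T p (X p) (lie_bracket A V Y p))"

definition symplectic_form ::
  "('a::topological_space, 'n::finite) chart set \<Rightarrow> 'a tensor2 \<Rightarrow> bool" where
  "symplectic_form A \<omega> \<longleftrightarrow> two_form A \<omega> \<and> nondegenerate A \<omega> \<and>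
     (\<forall>p. \<forall>u\<in>tangent_space A p. \<forall>v\<in>tangent_space A p. \<forall>w\<in>tangent_space A p. d2 A \<omega> p u v w = 0)"

definition liouville_field ::
  "('a::topological_space, 'n::finite) chart set \<Rightarrow> 'a tensor2 \<Rightarrow> 'a vfield \<Rightarrow> bool" where
  "liouville_field A \<omega> V \<longleftrightarrow> vector_field_on A UNIV V \<and>
     (\<forall>p. \<forall>v\<in>tangent_space A p. \<forall>w\<in>tangent_space A p. lie_derivative2 A V \<omega> p v w = \<omega> p v w)"

definition lorentzian_metric ::
  "('a::topological_space, 'n::finite) chart set \<Rightarrow> 'a tensor2 \<Rightarrow> bool" where
  "lorentzian_metric A g \<longleftrightarrow> tensor2_field A g \<and>
     (\<forall>p. \<forall>v\<in>tangent_space A p. \<forall>w\<in>tangent_space A p. g p v w = g p w v) \<and>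
     nondegenerate A g \<and>
     (\<forall>p. \<exists>e i\<^sub>0. tangent_basis A p e \<and>
        (\<forall>i j. g p (e i) (e j) = (if i \<noteq> j then 0 else if i = i\<^sub>0 then -1 else 1)))"

definition null_field ::
  "('a::topological_space, 'n::finite) chart set \<Rightarrow> 'a tensor2 \<Rightarrow> 'a vfield \<Rightarrow> bool" where
  "null_field A g k \<longleftrightarrow> vector_field_on A UNIV k \<and> (\<forall>p. k p \<noteq> (\<lambda>_. 0) \<and> g p (k p) (k p) = 0)"

definition flat :: "'a tensor2 \<Rightarrow> 'a vfield \<Rightarrow> 'a tensor1" where
  "flat g X = (\<lambda>p v. g p (X p) v)"

text \<open>\<open>nabla p v Y\<close> is the covariant derivative at \<open>p\<close> of a vector field \<open>Y\<close> defined near \<open>p\<close>, in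
  the direction \<open>v \<in> T\<^sub>pM\<close>.\<close>

type_synonym 'a connection = "'a \<Rightarrow> 'a tangent \<Rightarrow> 'a vfield \<Rightarrow> 'a tangent"

definition cov :: "'a connection \<Rightarrow> 'a vfield \<Rightarrow> 'a vfield \<Rightarrow> 'a vfield" where
  "cov nabla X Y = (\<lambda>p. nabla p (X p) Y)"

definition affine_connection ::
  "('a::topological_space, 'n::finite) chart set \<Rightarrow> 'a connection \<Rightarrow> bool" where
  "affine_connection A nabla \<longleftrightarrow>
     (\<forall>U X Y. vector_field_on A U X \<and> vector_field_on A U Y \<longrightarrow> vector_field_on A U (cov nabla X Y)) \<and>
     (\<forall>p. \<forall>v\<in>tangent_space A p. \<forall>Y Z. vector_field_near A p Y \<and> (\<forall>\<^sub>F q in nhds p. Y q = Z q) \<longrightarrow>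
        nabla p v Y = nabla p v Z) \<and>
     (\<forall>p. \<forall>v\<in>tangent_space A p. \<forall>w\<in>tangent_space A p. \<forall>a b Y. vector_field_near A p Y \<longrightarrow>
        nabla p (\<lambda>f. a * v f + b * w f) Y = (\<lambda>f. a * nabla p v Y f + b * nabla p w Y f)) \<and>
     (\<forall>p. \<forall>v\<in>tangent_space A p. \<forall>Y Z. vector_field_near A p Y \<and> vector_field_near A p Z \<longrightarrow>
        nabla p v (\<lambda>q f. Y q f + Z q f) = (\<lambda>f. nabla p v Y f + nabla p v Z f)) \<and>
     (\<forall>p. \<forall>v\<in>tangent_space A p. \<forall>h Y. smooth_near A p h \<and> vector_field_near A p Y \<longrightarrow>
        nabla p v (\<lambda>q f. h q * Y q f) = (\<lambda>f. v h * Y p f + h p * nabla p v Y f))"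

definition levi_civita ::
  "('a::topological_space, 'n::finite) chart set \<Rightarrow> 'a tensor2 \<Rightarrow> 'a connection \<Rightarrow> bool" where
  "levi_civita A g nabla \<longleftrightarrow> affine_connection A nabla \<and>
     (\<forall>U X Y. vector_field_on A U X \<and> vector_field_on A U Y \<longrightarrow>
        (\<forall>p\<in>U. lie_bracket A X Y p = (\<lambda>f. cov nabla X Y p f - cov nabla Y X p f))) \<and>
     (\<forall>U X Y Z. vector_field_on A U X \<and> vector_field_on A U Y \<and> vector_field_on A U Z \<longrightarrow>
        (\<forall>p\<in>U. X p (\<lambda>q. g q (Y q) (Z q)) = g p (cov nabla X Y p) (Z p) + g p (Y p) (cov nabla X Z p)))"

text \<open>\<open>R(V, X)Y = \<nabla>\<^sub>V\<nabla>\<^sub>XY - \<nabla>\<^sub>X\<nabla>\<^sub>VY - \<nabla>\<^bsub>[V,X]\<^esub>Y\<close> and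
  \<open>Ric(X, Y) = tr (V \<mapsto> R(V, X)Y)\<close>.\<close>

definition curvature ::
  "('a::topological_space, 'n::finite) chart set \<Rightarrow> 'a connection \<Rightarrow>
   'a \<Rightarrow> 'a tangent \<Rightarrow> 'a tangent \<Rightarrow> 'a tangent \<Rightarrow> 'a tangent" where
  "curvature A nabla p v x y =
     (let V = local_ext A p v; X = local_ext A p x; Y = local_ext A p y in
        (\<lambda>f. cov nabla V (cov nabla X Y) p f - cov nabla X (cov nabla V Y) p f
              - cov nabla (lie_bracket A V X) Y p f))"

definition ricci ::
  "('a::topological_space, 'n::finite) chart set \<Rightarrow> 'a connection \<Rightarrow> 'a tensor2" where
  "ricci A nabla p x y = tangent_trace A p (\<lambda>v. curvature A nabla p v x y)"

end

theory Submission
  imports Defs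
begin

text \<open>
  Write \<open>\<alpha> = g(k, \<cdot>)\<close>, so that \<open>\<omega> = d(e\<^sup>f \<alpha>) = e\<^sup>f (df \<and> \<alpha> + d\<alpha>)\<close>. As \<open>k\<close> is null and geodesic,
  both \<open>\<alpha>\<close> and \<open>d\<alpha>\<close> vanish upon contraction with \<open>k\<close>. Hence \<open>V = k / k(f)\<close> satisfies
  \<open>\<iota>\<^sub>V \<omega> = e\<^sup>f \<alpha>\<close>, and Cartan's formula gives \<open>L\<^sub>V \<omega> = d(e\<^sup>f \<alpha>) = \<omega>\<close>. Closedness is \<open>d \<circ> d = 0\<close>
  (\<open>curl_closed\<close>). Nondegeneracy comes down to \<open>\<alpha> \<and> d\<alpha> \<noteq> 0\<close> everywhere: a vector \<open>v\<close> in the kernel of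
  \<open>\<omega>\<close> is also in the kernel of this 3-form, which in dimension four is the line spanned by \<open>k\<close>,
  and \<open>\<omega>(k, \<cdot>) = e\<^sup>f k(f) \<alpha> \<noteq> 0\<close> (\<open>parallel_to_k\<close>, \<open>curl_K_nondegenerate\<close>).

  The curvature and the completeness exclude zeros of \<open>\<alpha> \<and> d\<alpha>\<close> (\<open>not_twist_free\<close>). This form is
  invariant under the flow of \<open>k\<close>, since \<open>\<alpha>\<close> and \<open>d\<alpha>\<close> are, so a zero at one point gives zeros along
  a whole integral curve (\<open>twist_free_along\<close>). There the endomorphism \<open>\<nabla>k\<close> induces a symmetric map of
  the two-dimensional Euclidean space \<open>k\<^sup>\<bottom> / k\<close>, which implies \<open>(tr \<nabla>k)\<^sup>2 \<le> 2 tr (\<nabla>k)\<^sup>2\<close>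
  (\<open>twist_free_trace_inequality\<close>). The Raychaudhuri equation
  \<open>k(tr \<nabla>k) = - tr (\<nabla>k)\<^sup>2 - Ric(k, k)\<close> then makes \<open>\<theta> = tr \<nabla>k\<close> satisfy \<open>\<theta>' < - \<theta>\<^sup>2 / 2\<close> along the curve,
  and such a function cannot exist on the whole real line (\<open>riccati_blowup\<close>).

  Forms are handled through the connection: \<open>curl K\<close> below is \<open>d(g(K, \<cdot>))\<close>, written as the
  antisymmetric part of \<open>\<nabla>K\<close>, which makes its pointwise nature evident. Invariance under the flow
  becomes a homogeneous linear differential equation for the components in a coordinate frame, so
  that neither the flow nor parallel transport has to be constructed.
\<close>

section \<open>Functions of class \<open>C\<^sup>k\<close>\<close>

lemma frechet_derivative_cong_open:
  assumes "open S" "x \<in> S" "\<And>y. y \<in> S \<Longrightarrow> f y = g y"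
  shows "frechet_derivative f (at x) = frechet_derivative g (at x)"
    and "f differentiable (at x) \<longleftrightarrow> g differentiable (at x)"
proof -
  have "(f has_derivative D) (at x) \<longleftrightarrow> (g has_derivative D) (at x)" for D
    using has_derivative_transform_within_open[OF _ assms(1,2), of f D UNIV g]
      has_derivative_transform_within_open[OF _ assms(1,2), of g D UNIV f] assms(3)
    by auto
  then show "frechet_derivative f (at x) = frechet_derivative g (at x)"
    and "f differentiable (at x) \<longleftrightarrow> g differentiable (at x)"
    by (simp_all add: frechet_derivative_def differentiable_def)
qed

lemma Ck_on_cong:
  assumes "open S" "\<And>y. y \<in> S \<Longrightarrow> f y = g y" "Ck_on n S f"
  shows "Ck_on n S g"
  using assms(2,3)
proof (induction n arbitrary: f g)
  case 0
  then show ?case using continuous_on_cong[of S S f g] by simp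
next
  case (Suc n)
  have eq: "frechet_derivative f (at x) = frechet_derivative g (at x)"
    "f differentiable (at x) \<longleftrightarrow> g differentiable (at x)" if "x \<in> S" for x
    using frechet_derivative_cong_open[OF assms(1) that, of f g] Suc.prems(1) by blast+
  have "Ck_on n S (\<lambda>x. frechet_derivative g (at x) v)" for v
    by (rule Suc.IH[of "\<lambda>x. frechet_derivative f (at x) v"]) (use eq Suc.prems in auto)
  with Suc.prems(2) eq show ?case by simp
qed

lemma Ck_on_subset: "Ck_on n S f \<Longrightarrow> T \<subseteq> S \<Longrightarrow> Ck_on n T f"
  by (induction n arbitrary: f) (auto intro: continuous_on_subset)

lemma Ck_on_SucD: "Ck_on (Suc n) S f \<Longrightarrow> Ck_on n S f"
proof (induction n arbitrary: f)
  case 0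
  then show ?case
    by (auto intro!: differentiable_imp_continuous_on differentiable_at_imp_differentiable_on)
next
  case (Suc n)
  then show ?case by (metis Ck_on.simps(2))
qed

lemma Ck_on_const: "Ck_on n S (\<lambda>_. c)"
  by (induction n arbitrary: c) auto

lemma Ck_on_linear: "bounded_linear L \<Longrightarrow> Ck_on n S L"
proof (cases n)
  case 0
  assume "bounded_linear L"
  then show ?thesis using 0 by (simp add: linear_continuous_on)
next
  case (Suc m)
  assume L: "bounded_linear L"
  then have "(L has_derivative L) (at x)" for x
    by (simp add: bounded_linear_imp_has_derivative)
  then have "frechet_derivative L (at x) = L" "L differentiable (at x)" for x
    using frechet_derivative_at[of L L x] by (auto simp: differentiable_def)
  then show ?thesis using Suc by (simp add: Ck_on_const)
qed

lemma frechet_derivative_eq: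
  "(f has_derivative D) (at x) \<Longrightarrow> frechet_derivative f (at x) = D"
  using frechet_derivative_at by metis

lemma Ck_on_add:
  "open S \<Longrightarrow> Ck_on n S f \<Longrightarrow> Ck_on n S g \<Longrightarrow> Ck_on n S (\<lambda>x. f x + g x)"
proof (induction n arbitrary: f g)
  case 0
  then show ?case by (simp add: continuous_on_add)
next
  case (Suc n)
  have "Ck_on n S (\<lambda>x. frechet_derivative (\<lambda>x. f x + g x) (at x) v)" for v
    by (rule Ck_on_cong[OF Suc.prems(1) _
          Suc.IH[of "\<lambda>x. frechet_derivative f (at x) v" "\<lambda>x. frechet_derivative g (at x) v"]])
      (use Suc.prems in \<open>auto intro!: frechet_derivative_eq[THEN fun_cong, symmetric]
          has_derivative_add simp: frechet_derivative_works[symmetric]\<close>)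
  then show ?case using Suc.prems by simp
qed

lemma Ck_on_mult:
  fixes f g :: "'b::real_normed_vector \<Rightarrow> real"
  shows "open S \<Longrightarrow> Ck_on n S f \<Longrightarrow> Ck_on n S g \<Longrightarrow> Ck_on n S (\<lambda>x. f x * g x)"
proof (induction n arbitrary: f g)
  case 0
  then show ?case by (simp add: continuous_on_mult)
next
  case (Suc n)
  have "Ck_on n S (\<lambda>x. frechet_derivative (\<lambda>x. f x * g x) (at x) v)" for v
  proof (rule Ck_on_cong[OF Suc.prems(1)])
    show "Ck_on n S (\<lambda>x. f x * frechet_derivative g (at x) v + frechet_derivative f (at x) v * g x)"
      using Suc.prems by (intro Ck_on_add Suc.IH) (auto intro: Ck_on_SucD simp del: Ck_on.simps, auto)
    show "f x * frechet_derivative g (at x) v + frechet_derivative f (at x) v * g x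
        = frechet_derivative (\<lambda>x. f x * g x) (at x) v" if "x \<in> S" for x
      by (rule frechet_derivative_eq[THEN fun_cong, symmetric], rule has_derivative_mult)
        (use Suc.prems that in \<open>auto simp: frechet_derivative_works[symmetric]\<close>)
  qed
  then show ?case using Suc.prems by simp
qed

lemma Ck_on_sum:
  assumes "open S" "\<And>i. i \<in> I \<Longrightarrow> Ck_on n S (f i)"
  shows "Ck_on n S (\<lambda>x. \<Sum>i\<in>I. f i x)"
  using assms(2)
  by (induction I rule: infinite_finite_induct) (auto intro: Ck_on_const Ck_on_add assms(1))

lemma Ck_on_linear_compose:
  assumes "bounded_linear L" "open S"
  shows "Ck_on n S f \<Longrightarrow> Ck_on n S (\<lambda>x. L (f x))"
proof (induction n arbitrary: f)
  case 0
  then show ?case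
    using bounded_linear.continuous_on[OF assms(1)] by simp
next
  case (Suc n)
  have D: "((\<lambda>x. L (f x)) has_derivative (\<lambda>v. L (frechet_derivative f (at x) v))) (at x)"
    if "x \<in> S" for x
    using Suc.prems that
    by (intro bounded_linear.has_derivative[OF assms(1)]) (auto simp: frechet_derivative_works[symmetric])
  have "Ck_on n S (\<lambda>x. frechet_derivative (\<lambda>x. L (f x)) (at x) v)" for v
    by (rule Ck_on_cong[OF assms(2) _ Suc.IH[of "\<lambda>x. frechet_derivative f (at x) v"]])
      (use Suc.prems frechet_derivative_eq[OF D] in auto)
  then show ?case using D by (auto simp: differentiable_def)
qed

text \<open>By the chain rule, a directional derivative of \<open>f \<circ> g\<close> is a finite sum of products of
  partial derivatives of \<open>f\<close> along \<open>g\<close> with components of the derivative of \<open>g\<close>, all of which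
  lose only one order of differentiability.\<close>

lemma Ck_on_compose:
  fixes g :: "'b::real_normed_vector \<Rightarrow> 'c::euclidean_space" and f :: "'c \<Rightarrow> real"
  assumes "open S" "open T" "g ` S \<subseteq> T"
  shows "Ck_on n T f \<Longrightarrow> Ck_on n S g \<Longrightarrow> Ck_on n S (\<lambda>x. f (g x))"
proof (induction n arbitrary: f)
  case 0
  then show ?case using assms(3) by (auto intro: continuous_on_compose2)
next
  case (Suc n)
  have D: "((\<lambda>x. f (g x)) has_derivative
      (\<lambda>v. \<Sum>i\<in>Basis. frechet_derivative f (at (g x)) i * (frechet_derivative g (at x) v \<bullet> i))) (at x)"
    if "x \<in> S" for x
  proof -
    have g: "(g has_derivative frechet_derivative g (at x)) (at x)"
      using Suc.prems that by (simp add: frechet_derivative_works[symmetric])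
    have f: "(f has_derivative frechet_derivative f (at (g x))) (at (g x))"
      using Suc.prems that assms(3) by (auto simp: frechet_derivative_works[symmetric])
    interpret Df: linear "frechet_derivative f (at (g x))"
      using f has_derivative_linear by blast
    have "(\<lambda>w. frechet_derivative f (at (g x)) (frechet_derivative g (at x) w))
        = (\<lambda>v. \<Sum>i\<in>Basis. frechet_derivative f (at (g x)) i * (frechet_derivative g (at x) v \<bullet> i))"
    proof
      fix v
      show "frechet_derivative f (at (g x)) (frechet_derivative g (at x) v) = (\<Sum>i\<in>Basis.
          frechet_derivative f (at (g x)) i * (frechet_derivative g (at x) v \<bullet> i))"
        by (subst euclidean_representation[symmetric, of "frechet_derivative g (at x) v"],
            subst Df.sum) (simp add: Df.scale mult.commute)
    qed
    then show ?thesis using has_derivative_compose[OF g f] by metis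
  qed
  have "Ck_on n S (\<lambda>x. frechet_derivative (\<lambda>x. f (g x)) (at x) v)" for v
  proof (rule Ck_on_cong[OF assms(1)])
    show "Ck_on n S (\<lambda>x. \<Sum>i\<in>Basis.
        frechet_derivative f (at (g x)) i * (frechet_derivative g (at x) v \<bullet> i))"
    proof (intro Ck_on_sum Ck_on_mult assms)
      fix i :: 'c
      have "Ck_on n T (\<lambda>x. frechet_derivative f (at x) i)" "Ck_on n S g"
        "Ck_on n S (\<lambda>x. frechet_derivative g (at x) v)"
        using Suc.prems Ck_on_SucD[of n S g] by auto
      then show "Ck_on n S (\<lambda>x. frechet_derivative f (at (g x)) i)"
        and "Ck_on n S (\<lambda>x. frechet_derivative g (at x) v \<bullet> i)"
        using Suc.IH[of "\<lambda>x. frechet_derivative f (at x) i"]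
          Ck_on_linear_compose[OF bounded_linear_inner_left assms(1)] by blast+
    qed
  qed (use frechet_derivative_eq[OF D] in auto)
  then show ?case using D by (auto simp: differentiable_def)
qed

lemma Ck_on_exp: "Ck_on n UNIV (exp :: real \<Rightarrow> real)"
proof (induction n)
  case 0
  then show ?case by (simp add: continuous_on_exp)
next
  case (Suc n)
  have D: "(exp has_derivative (\<lambda>v. exp x * v)) (at x)" for x :: real
    by (auto intro!: derivative_eq_intros)
  show ?case
    using D by (auto simp: frechet_derivative_eq[OF D] differentiable_def
        intro!: Ck_on_mult Ck_on_const Suc)
qed

lemma Ck_on_inverse: "Ck_on n (- {0}) (inverse :: real \<Rightarrow> real)"
proof (induction n)
  case 0
  then show ?case by (auto intro!: continuous_on_inverse)
next
  case (Suc n)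
  have D: "(inverse has_derivative (\<lambda>v. (inverse x * inverse x) * (- v))) (at x)" if "x \<noteq> 0" for x :: real
    using that by (auto intro!: derivative_eq_intros simp: mult_ac)
  have "Ck_on n (- {0}) (\<lambda>x. frechet_derivative inverse (at x) v)" for v :: real
  proof (rule Ck_on_cong)
    show "Ck_on n (- {0}) (\<lambda>x. (inverse x * inverse x) * (- v))"
      by (intro Ck_on_mult Ck_on_const Suc) auto
  qed (auto simp: frechet_derivative_eq[OF D])
  then show ?case using D by (auto simp: differentiable_def)
qed

section \<open>Smooth functions on open subsets of Euclidean space\<close>

lemma smooth_onI: "open S \<Longrightarrow> (\<And>n. Ck_on n S f) \<Longrightarrow> smooth_on S f"
  by (simp add: smooth_on_def)

lemma smooth_on_cong: "smooth_on S f \<Longrightarrow> (\<And>y. y \<in> S \<Longrightarrow> f y = g y) \<Longrightarrow> smooth_on S g"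
  unfolding smooth_on_def using Ck_on_cong by blast

lemma smooth_on_subset: "smooth_on S f \<Longrightarrow> open T \<Longrightarrow> T \<subseteq> S \<Longrightarrow> smooth_on T f"
  unfolding smooth_on_def using Ck_on_subset by blast

lemma smooth_on_add: "smooth_on S f \<Longrightarrow> smooth_on S g \<Longrightarrow> smooth_on S (\<lambda>x. f x + g x)"
  by (simp add: smooth_on_def Ck_on_add)

lemma smooth_on_mult:
  fixes f g :: "'b::real_normed_vector \<Rightarrow> real"
  shows "smooth_on S f \<Longrightarrow> smooth_on S g \<Longrightarrow> smooth_on S (\<lambda>x. f x * g x)"
  by (simp add: smooth_on_def Ck_on_mult)

lemma smooth_on_compose:
  fixes g :: "'b::real_normed_vector \<Rightarrow> 'c::euclidean_space" and f :: "'c \<Rightarrow> real"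
  assumes "smooth_on T f" "smooth_on S g" "g ` S \<subseteq> T"
  shows "smooth_on S (\<lambda>x. f (g x))"
  using assms by (simp add: smooth_on_def Ck_on_compose[of S T])

lemma smooth_on_differentiable: "smooth_on S f \<Longrightarrow> x \<in> S \<Longrightarrow> f differentiable (at x)"
  unfolding smooth_on_def using Ck_on.simps(2) by blast

lemma smooth_on_directional:
  "smooth_on S f \<Longrightarrow> smooth_on S (\<lambda>x. frechet_derivative f (at x) v)"
  unfolding smooth_on_def using Ck_on.simps(2) by blast

section \<open>Smooth functions on a manifold\<close>

text \<open>On a manifold with a metric, \<open>ex_tangent_basis\<close> is part of the signature condition. It fixes the
  dimension of the tangent spaces, so that linear algebra alone, in place of Hadamard's lemma,
  identifies the coordinate derivations as a basis.\<close>

locale manifold =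
  fixes A :: "('a::{t2_space, second_countable_topology}, 'n::finite) chart set"
  assumes atlas: "smooth_atlas A"
    and ex_tangent_basis: "\<exists>e. tangent_basis A p e"
begin

lemma chart_open: "(U, \<phi>) \<in> A \<Longrightarrow> open U"
  and chart_homeomorphism: "(U, \<phi>) \<in> A \<Longrightarrow> homeomorphism U (\<phi> ` U) \<phi> (inv_into U \<phi>)"
  and chart_image_open: "(U, \<phi>) \<in> A \<Longrightarrow> open (\<phi> ` U)"
  and chart_transition: "(U, \<phi>) \<in> A \<Longrightarrow> (V, \<psi>) \<in> A \<Longrightarrow>
    smooth_on (\<phi> ` (U \<inter> V)) (\<psi> \<circ> inv_into U \<phi>)"
  using atlas unfolding smooth_atlas_def by fast+

lemma chart_at: obtains U \<phi> where "(U, \<phi>) \<in> A" "p \<in> U"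
  using atlas unfolding smooth_atlas_def by fast

lemma chart_inv [simp]: "(U, \<phi>) \<in> A \<Longrightarrow> q \<in> U \<Longrightarrow> inv_into U \<phi> (\<phi> q) = q"
  using chart_homeomorphism homeomorphism_apply1 by metis

lemma chart_open_image:
  assumes "(U, \<phi>) \<in> A" "open W"
  shows "open (\<phi> ` (U \<inter> W))"
proof -
  have "openin (top_of_set (\<phi> ` U)) (\<phi> ` (U \<inter> W))"
    by (rule homeomorphism_imp_open_map[OF chart_homeomorphism[OF assms(1)]])
      (use assms(2) in \<open>auto simp: openin_open\<close>)
  then show ?thesis
    using chart_image_open[OF assms(1)] openin_open_trans by blast
qed

lemma smooth_fun_on_open: "smooth_fun_on A W f \<Longrightarrow> open W"
  by (simp add: smooth_fun_on_def)

lemma smooth_fun_onD: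
  "smooth_fun_on A W f \<Longrightarrow> (U, \<phi>) \<in> A \<Longrightarrow> smooth_on (\<phi> ` (U \<inter> W)) (\<lambda>x. f (inv_into U \<phi> x))"
  by (auto simp: smooth_fun_on_def o_def)

lemma smooth_fun_onI:
  assumes "open W" "\<And>U \<phi>. (U, \<phi>) \<in> A \<Longrightarrow> smooth_on (\<phi> ` (U \<inter> W)) (\<lambda>x. f (inv_into U \<phi> x))"
  shows "smooth_fun_on A W f"
  using assms by (auto simp: smooth_fun_on_def o_def)

lemma smooth_fun_on_subset:
  assumes "smooth_fun_on A W f" "open W'" "W' \<subseteq> W"
  shows "smooth_fun_on A W' f"
  using assms(2)
proof (rule smooth_fun_onI)
  fix U \<phi> assume "(U, \<phi>) \<in> A"
  then show "smooth_on (\<phi> ` (U \<inter> W')) (\<lambda>x. f (inv_into U \<phi> x))"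
    using smooth_on_subset[OF smooth_fun_onD[OF assms(1)]] chart_open_image assms(2,3)
    by (meson Int_mono image_mono subset_refl)
qed

lemma smooth_fun_on_cong:
  assumes "smooth_fun_on A W f" "\<And>q. q \<in> W \<Longrightarrow> f q = h q"
  shows "smooth_fun_on A W h"
proof (rule smooth_fun_onI)
  fix U \<phi> assume U: "(U, \<phi>) \<in> A"
  show "smooth_on (\<phi> ` (U \<inter> W)) (\<lambda>x. h (inv_into U \<phi> x))"
    by (rule smooth_on_cong[OF smooth_fun_onD[OF assms(1) U]]) (auto simp: U assms(2))
qed (use assms smooth_fun_on_open in blast)

lemma smooth_fun_on_const: "open W \<Longrightarrow> smooth_fun_on A W (\<lambda>_. c)"
  by (intro smooth_fun_onI smooth_onI Ck_on_const chart_open_image)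

lemma smooth_fun_on_add:
  "smooth_fun_on A W f \<Longrightarrow> smooth_fun_on A W h \<Longrightarrow> smooth_fun_on A W (\<lambda>q. f q + h q)"
  by (rule smooth_fun_onI, erule smooth_fun_on_open, rule smooth_on_add)
    (erule (1) smooth_fun_onD)+

lemma smooth_fun_on_mult:
  "smooth_fun_on A W f \<Longrightarrow> smooth_fun_on A W h \<Longrightarrow> smooth_fun_on A W (\<lambda>q. f q * h q)"
  by (rule smooth_fun_onI, erule smooth_fun_on_open, rule smooth_on_mult)
    (erule (1) smooth_fun_onD)+

lemma smooth_fun_on_diff:
  assumes "smooth_fun_on A W f" "smooth_fun_on A W h"
  shows "smooth_fun_on A W (\<lambda>q. f q - h q)"
  using smooth_fun_on_add[OF assms(1) smooth_fun_on_mult[OF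
        smooth_fun_on_const[OF smooth_fun_on_open[OF assms(1)], of "-1"] assms(2)]]
  by simp

lemma smooth_fun_on_compose:
  assumes "smooth_fun_on A W f" "smooth_on T F" "f ` W \<subseteq> T"
  shows "smooth_fun_on A W (\<lambda>q. F (f q))"
  by (rule smooth_fun_onI[OF smooth_fun_on_open[OF assms(1)]],
      rule smooth_on_compose[OF assms(2)], erule smooth_fun_onD[OF assms(1)])
    (use assms(3) in auto)

lemma smooth_fun_on_exp: "smooth_fun_on A W f \<Longrightarrow> smooth_fun_on A W (\<lambda>q. exp (f q))"
  by (rule smooth_fun_on_compose[of _ _ UNIV]) (auto intro: smooth_onI Ck_on_exp)

lemma smooth_fun_on_inverse:
  "smooth_fun_on A W f \<Longrightarrow> (\<And>q. q \<in> W \<Longrightarrow> f q \<noteq> 0) \<Longrightarrow> smooth_fun_on A W (\<lambda>q. inverse (f q))"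
  by (rule smooth_fun_on_compose[of _ _ "- {0}"]) (auto intro: smooth_onI Ck_on_inverse)

text \<open>Smoothness in the one chart \<open>\<phi>\<close> suffices, since the transition maps to all the other charts are
  smooth.\<close>

lemma smooth_fun_on_chart:
  assumes "(U, \<phi>) \<in> A" "open W" "W \<subseteq> U" "smooth_on S F" "\<phi> ` W \<subseteq> S"
  shows "smooth_fun_on A W (\<lambda>q. F (\<phi> q))"
  using assms(2)
proof (rule smooth_fun_onI)
  fix V \<psi> assume V: "(V, \<psi>) \<in> A"
  show "smooth_on (\<psi> ` (V \<inter> W)) (\<lambda>x. F (\<phi> (inv_into V \<psi> x)))"
  proof (rule smooth_on_compose[OF assms(4)])
    show "smooth_on (\<psi> ` (V \<inter> W)) (\<lambda>x. \<phi> (inv_into V \<psi> x))"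
      by (rule smooth_on_subset[OF chart_transition[OF V assms(1), unfolded o_def]
            chart_open_image[OF V assms(2)]]) (use assms(3) in auto)
  qed (use assms(5) V in auto)
qed

lemma smooth_fun_on_coord: "(U, \<phi>) \<in> A \<Longrightarrow> smooth_fun_on A U (\<lambda>q. \<phi> q $ i)"
  by (rule smooth_fun_on_chart[of _ _ _ UNIV])
    (auto intro: chart_open smooth_onI Ck_on_linear bounded_linear_vec_nth)

lemma smooth_nearI: "smooth_fun_on A W f \<Longrightarrow> p \<in> W \<Longrightarrow> smooth_near A p f"
  by (auto simp: smooth_near_def)

lemma smooth_near2E:
  assumes "smooth_near A p f" "smooth_near A p h"
  obtains W where "p \<in> W" "smooth_fun_on A W f" "smooth_fun_on A W h"
proof -
  from assms obtain W1 W2 where W: "p \<in> W1" "smooth_fun_on A W1 f" "p \<in> W2" "smooth_fun_on A W2 h"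
    by (auto simp: smooth_near_def)
  then have "open (W1 \<inter> W2)" by (auto dest: smooth_fun_on_open)
  then show thesis
    using W by (intro that[of "W1 \<inter> W2"]) (auto intro: smooth_fun_on_subset)
qed

lemma smooth_near_const: "smooth_near A p (\<lambda>_. c)"
  using smooth_fun_on_const[of UNIV] smooth_nearI by blast

lemma smooth_near_add:
  "smooth_near A p f \<Longrightarrow> smooth_near A p h \<Longrightarrow> smooth_near A p (\<lambda>q. f q + h q)"
  by (erule (1) smooth_near2E) (blast intro: smooth_nearI smooth_fun_on_add)

lemma smooth_near_mult:
  "smooth_near A p f \<Longrightarrow> smooth_near A p h \<Longrightarrow> smooth_near A p (\<lambda>q. f q * h q)"
  by (erule (1) smooth_near2E) (blast intro: smooth_nearI smooth_fun_on_mult)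

lemma smooth_near_diff:
  "smooth_near A p f \<Longrightarrow> smooth_near A p h \<Longrightarrow> smooth_near A p (\<lambda>q. f q - h q)"
  by (erule (1) smooth_near2E) (blast intro: smooth_nearI smooth_fun_on_diff)

lemma smooth_near_sum:
  "(\<And>i. i \<in> I \<Longrightarrow> smooth_near A p (f i)) \<Longrightarrow> smooth_near A p (\<lambda>q. \<Sum>i\<in>I. f i q)"
  by (induction I rule: infinite_finite_induct) (auto intro: smooth_near_const smooth_near_add)

lemma smooth_near_cong:
  assumes "smooth_near A p f" "\<forall>\<^sub>F q in nhds p. f q = h q"
  shows "smooth_near A p h"
proof -
  obtain W where W: "p \<in> W" "smooth_fun_on A W f" using assms(1) by (auto simp: smooth_near_def)
  obtain N where N: "open N" "p \<in> N" "\<And>q. q \<in> N \<Longrightarrow> f q = h q"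
    using assms(2) unfolding eventually_nhds by blast
  have "smooth_fun_on A (W \<inter> N) h"
    by (rule smooth_fun_on_cong[OF smooth_fun_on_subset[OF W(2)]])
      (use N W smooth_fun_on_open in auto)
  with W N show ?thesis by (auto intro: smooth_nearI)
qed

lemma smooth_near_chart:
  assumes "(U, \<phi>) \<in> A" "q \<in> U" "smooth_near A q f"
  shows "(\<lambda>x. f (inv_into U \<phi> x)) differentiable (at (\<phi> q))"
proof -
  obtain W where W: "q \<in> W" "smooth_fun_on A W f" using assms(3) by (auto simp: smooth_near_def)
  show ?thesis
    by (rule smooth_on_differentiable[OF smooth_fun_onD[OF W(2) assms(1)]]) (use W assms in auto)
qed

section \<open>Tangent vectors and vector fields\<close>

lemma tangent_cong:
  "v \<in> tangent_space A p \<Longrightarrow> smooth_near A p f \<Longrightarrow> \<forall>\<^sub>F q in nhds p. f q = h q \<Longrightarrow> v f = v h"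
  and tangent_not_smooth: "v \<in> tangent_space A p \<Longrightarrow> \<not> smooth_near A p f \<Longrightarrow> v f = 0"
  and tangent_lin: "v \<in> tangent_space A p \<Longrightarrow> smooth_near A p f \<Longrightarrow> smooth_near A p h \<Longrightarrow>
    v (\<lambda>q. a * f q + b * h q) = a * v f + b * v h"
  and tangent_mult: "v \<in> tangent_space A p \<Longrightarrow> smooth_near A p f \<Longrightarrow> smooth_near A p h \<Longrightarrow>
    v (\<lambda>q. f q * h q) = v f * h p + f p * v h"
  unfolding tangent_space_def by blast+

lemma tangent_add: "v \<in> tangent_space A p \<Longrightarrow> smooth_near A p f \<Longrightarrow> smooth_near A p h \<Longrightarrow>
    v (\<lambda>q. f q + h q) = v f + v h"
  using tangent_lin[of v p f h 1 1] by simp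

lemma tangent_diff: "v \<in> tangent_space A p \<Longrightarrow> smooth_near A p f \<Longrightarrow> smooth_near A p h \<Longrightarrow>
    v (\<lambda>q. f q - h q) = v f - v h"
  using tangent_lin[of v p f h 1 "-1"] by simp

lemma tangent_const: "v \<in> tangent_space A p \<Longrightarrow> v (\<lambda>_. c) = 0"
  using tangent_mult[of v p "\<lambda>_. 1" "\<lambda>_. 1"]
    tangent_lin[of v p "\<lambda>_. 1" "\<lambda>_. 1" c 0] smooth_near_const by simp

lemma tangent_sum: "v \<in> tangent_space A p \<Longrightarrow> (\<And>i. i \<in> I \<Longrightarrow> smooth_near A p (f i)) \<Longrightarrow>
    v (\<lambda>q. \<Sum>i\<in>I. f i q) = (\<Sum>i\<in>I. v (f i))"
proof (induction I rule: infinite_finite_induct)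
  case (insert i I)
  then have "smooth_near A p (\<lambda>q. \<Sum>i\<in>I. f i q)" by (intro smooth_near_sum) auto
  from tangent_add[OF insert(4) _ this, of "f i"] insert show ?case by simp
qed (auto simp: tangent_const)

lemma tangent_lincomb:
  assumes "v \<in> tangent_space A p" "w \<in> tangent_space A p"
  shows "(\<lambda>f. a * v f + b * w f) \<in> tangent_space A p"
  unfolding tangent_space_def
proof (intro CollectI conjI allI impI; (elim conjE)?)
  fix f h assume "smooth_near A p f" "\<forall>\<^sub>F q in nhds p. f q = h q"
  then show "a * v f + b * w f = a * v h + b * w h"
    using tangent_cong assms by metis
qed (use assms in \<open>auto simp: tangent_not_smooth tangent_lin tangent_mult algebra_simps\<close>)

lemma tangent_zero: "(\<lambda>_. 0) \<in> tangent_space A p"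
  by (auto simp: tangent_space_def)

lemma tangent_scale: "v \<in> tangent_space A p \<Longrightarrow> (\<lambda>f. a * v f) \<in> tangent_space A p"
  using tangent_lincomb[of v p v a 0] by simp

lemma tangent_plus: "v \<in> tangent_space A p \<Longrightarrow> w \<in> tangent_space A p \<Longrightarrow>
    (\<lambda>f. v f + w f) \<in> tangent_space A p"
  using tangent_lincomb[of v p w 1 1] by simp

lemma tangent_sum_closed:
  "(\<And>i. i \<in> I \<Longrightarrow> v i \<in> tangent_space A p) \<Longrightarrow> (\<lambda>f. \<Sum>i\<in>I. c i * v i f) \<in> tangent_space A p"
proof (induction I rule: infinite_finite_induct)
  case (insert i I)
  then show ?case
    using tangent_plus[OF tangent_scale[of "v i" p "c i"], of "\<lambda>f. \<Sum>i\<in>I. c i * v i f"] by simp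
qed (auto simp: tangent_zero)

lemma vector_field_tangent: "vector_field_on A U X \<Longrightarrow> p \<in> U \<Longrightarrow> X p \<in> tangent_space A p"
  and vector_field_open: "vector_field_on A U X \<Longrightarrow> open U"
  and vector_field_smooth: "vector_field_on A U X \<Longrightarrow> W \<subseteq> U \<Longrightarrow> smooth_fun_on A W f \<Longrightarrow>
    smooth_fun_on A W (\<lambda>p. X p f)"
  by (auto simp: vector_field_on_def)

lemma vector_field_subset:
  "vector_field_on A U X \<Longrightarrow> open V \<Longrightarrow> V \<subseteq> U \<Longrightarrow> vector_field_on A V X"
  by (auto simp: vector_field_on_def)

lemma vector_field_cong:
  assumes "vector_field_on A U X" "\<And>q. q \<in> U \<Longrightarrow> X q = Y q"
  shows "vector_field_on A U Y"
  unfolding vector_field_on_def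
proof (intro conjI ballI allI impI)
  fix W f assume "W \<subseteq> U \<and> smooth_fun_on A W f"
  then show "smooth_fun_on A W (\<lambda>p. Y p f)"
    using smooth_fun_on_cong[OF vector_field_smooth[OF assms(1)]] assms(2) by (metis subsetD)
qed (use assms vector_field_tangent vector_field_open in force)+

lemma vector_field_zero: "open U \<Longrightarrow> vector_field_on A U (\<lambda>_ _. 0)"
  by (auto simp: vector_field_on_def tangent_zero intro: smooth_fun_on_const smooth_fun_on_open)

lemma vector_field_add:
  "vector_field_on A U X \<Longrightarrow> vector_field_on A U Y \<Longrightarrow> vector_field_on A U (\<lambda>p f. X p f + Y p f)"
  by (auto simp: vector_field_on_def tangent_plus intro: smooth_fun_on_add)

lemma vector_field_mult:
  assumes "vector_field_on A U X" "smooth_fun_on A U h"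
  shows "vector_field_on A U (\<lambda>p f. h p * X p f)"
  unfolding vector_field_on_def
proof (intro conjI ballI allI impI)
  fix W f assume "W \<subseteq> U \<and> smooth_fun_on A W f"
  then show "smooth_fun_on A W (\<lambda>p. h p * X p f)"
    using smooth_fun_on_mult[OF smooth_fun_on_subset[OF assms(2)] vector_field_smooth[OF assms(1)]]
    by (auto dest: smooth_fun_on_open)
qed (use assms vector_field_tangent vector_field_open tangent_scale in blast)+

lemma vector_field_diff:
  assumes "vector_field_on A U X" "vector_field_on A U Y"
  shows "vector_field_on A U (\<lambda>p f. X p f - Y p f)"
  using vector_field_add[OF assms(1) vector_field_mult[OF assms(2)
        smooth_fun_on_const[OF vector_field_open[OF assms(1)], of "-1"]]] by simp

lemma vector_field_sum:
  assumes "open U" "\<And>i. i \<in> I \<Longrightarrow> vector_field_on A U (X i)"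
  shows "vector_field_on A U (\<lambda>p f. \<Sum>i\<in>I. X i p f)"
  using assms(2)
  by (induction I rule: infinite_finite_induct)
    (auto intro: vector_field_zero vector_field_add assms(1))

lemma vector_field_nearI: "vector_field_on A U X \<Longrightarrow> p \<in> U \<Longrightarrow> vector_field_near A p X"
  by (auto simp: vector_field_near_def)

lemma vector_field_near_tangent: "vector_field_near A p X \<Longrightarrow> X p \<in> tangent_space A p"
  by (auto simp: vector_field_near_def vector_field_tangent)

lemma vector_field_near_smooth:
  assumes "vector_field_near A p X" "smooth_near A p f"
  shows "smooth_near A p (\<lambda>q. X q f)"
proof -
  from assms obtain U W where UW: "p \<in> U" "vector_field_on A U X" "p \<in> W" "smooth_fun_on A W f"
    by (auto simp: vector_field_near_def smooth_near_def)
  then have "open (U \<inter> W)" by (auto dest: smooth_fun_on_open vector_field_open)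
  with UW have "smooth_fun_on A (U \<inter> W) (\<lambda>q. X q f)"
    by (intro vector_field_smooth[OF UW(2)] smooth_fun_on_subset[OF UW(4)]) auto
  with UW show ?thesis by (auto intro: smooth_nearI)
qed

lemma vector_field_near2E:
  assumes "vector_field_near A p X" "vector_field_near A p Y" "open N" "p \<in> N"
  obtains U where "p \<in> U" "U \<subseteq> N" "vector_field_on A U X" "vector_field_on A U Y"
proof -
  from assms obtain U V where UV: "p \<in> U" "vector_field_on A U X" "p \<in> V" "vector_field_on A V Y"
    by (auto simp: vector_field_near_def)
  then have "open (U \<inter> V \<inter> N)" using assms by (auto dest: vector_field_open)
  with UV assms show thesis
    by (intro that[of "U \<inter> V \<inter> N"] vector_field_subset[OF UV(2)] vector_field_subset[OF UV(4)]) auto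
qed

lemma vector_field_near_cong:
  assumes "vector_field_near A p X" "\<forall>\<^sub>F q in nhds p. X q = Y q"
  shows "vector_field_near A p Y"
proof -
  obtain N where N: "open N" "p \<in> N" "\<And>q. q \<in> N \<Longrightarrow> X q = Y q"
    using assms(2) unfolding eventually_nhds by blast
  obtain U where U: "p \<in> U" "U \<subseteq> N" "vector_field_on A U X"
    using vector_field_near2E[OF assms(1,1) N(1,2)] by metis
  have "vector_field_on A U Y"
    by (rule vector_field_cong[OF U(3)]) (use U N in auto)
  with U show ?thesis by (intro vector_field_nearI)
qed

lemma vector_field_near_add:
  "vector_field_near A p X \<Longrightarrow> vector_field_near A p Y \<Longrightarrow>
   vector_field_near A p (\<lambda>q f. X q f + Y q f)"
  by (erule vector_field_near2E[OF _ _ open_UNIV UNIV_I])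
    (auto intro: vector_field_nearI vector_field_add)

lemma vector_field_near_mult:
  assumes "smooth_near A p h" "vector_field_near A p X"
  shows "vector_field_near A p (\<lambda>q f. h q * X q f)"
proof -
  from assms obtain U W where UW: "p \<in> U" "vector_field_on A U X" "p \<in> W" "smooth_fun_on A W h"
    by (auto simp: vector_field_near_def smooth_near_def)
  then have "open (U \<inter> W)" by (auto dest: smooth_fun_on_open vector_field_open)
  with UW have "vector_field_on A (U \<inter> W) (\<lambda>q f. h q * X q f)"
    by (intro vector_field_mult smooth_fun_on_subset[OF UW(4)] vector_field_subset[OF UW(2)]) auto
  with UW show ?thesis by (auto intro: vector_field_nearI)
qed

lemma vector_field_near_sum:
  "(\<And>i. i \<in> I \<Longrightarrow> vector_field_near A p (X i)) \<Longrightarrow> vector_field_near A p (\<lambda>q f. \<Sum>i\<in>I. X i q f)"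
  by (induction I rule: infinite_finite_induct)
    (auto intro: vector_field_near_add vector_field_nearI[OF vector_field_zero[OF open_UNIV]])

definition coord_field :: "'a set \<Rightarrow> ('a \<Rightarrow> real ^ 'n) \<Rightarrow> 'n \<Rightarrow> 'a vfield" where
  "coord_field U \<phi> i q f = (if smooth_near A q f
     then frechet_derivative (\<lambda>x. f (inv_into U \<phi> x)) (at (\<phi> q)) (axis i 1) else 0)"

lemma coord_field_tangent:
  assumes U: "(U, \<phi>) \<in> A" and q: "q \<in> U"
  shows "coord_field U \<phi> i q \<in> tangent_space A q"
  unfolding tangent_space_def
proof (intro CollectI conjI allI impI; (elim conjE)?)
  fix f assume "\<not> smooth_near A q f"
  then show "coord_field U \<phi> i q f = 0" by (simp add: coord_field_def)
next
  fix f h assume f: "smooth_near A q f" and eq: "\<forall>\<^sub>F r in nhds q. f r = h r"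
  obtain N where N: "open N" "q \<in> N" "\<And>r. r \<in> N \<Longrightarrow> f r = h r"
    using eq unfolding eventually_nhds by blast
  have "frechet_derivative (\<lambda>x. f (inv_into U \<phi> x)) (at (\<phi> q))
      = frechet_derivative (\<lambda>x. h (inv_into U \<phi> x)) (at (\<phi> q))"
    by (rule frechet_derivative_cong_open[OF chart_open_image[OF U N(1)]]) (use N U q in auto)
  with f smooth_near_cong[OF f eq] show "coord_field U \<phi> i q f = coord_field U \<phi> i q h"
    by (simp add: coord_field_def)
next
  fix f h a b assume fh: "smooth_near A q f" "smooth_near A q h"
  note d = smooth_near_chart[OF U q fh(1), unfolded frechet_derivative_works]
    smooth_near_chart[OF U q fh(2), unfolded frechet_derivative_works]
  have "smooth_near A q (\<lambda>q. a * f q + b * h q)"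
    using fh by (intro smooth_near_add smooth_near_mult smooth_near_const)
  then show "coord_field U \<phi> i q (\<lambda>q. a * f q + b * h q)
      = a * coord_field U \<phi> i q f + b * coord_field U \<phi> i q h"
    using fh frechet_derivative_eq[OF has_derivative_add[OF has_derivative_mult_right[OF d(1)]
          has_derivative_mult_right[OF d(2)]], of a b]
    by (simp add: coord_field_def)
next
  fix f h assume fh: "smooth_near A q f" "smooth_near A q h"
  note d = smooth_near_chart[OF U q fh(1), unfolded frechet_derivative_works]
    smooth_near_chart[OF U q fh(2), unfolded frechet_derivative_works]
  show "coord_field U \<phi> i q (\<lambda>q. f q * h q) = coord_field U \<phi> i q f * h q + f q * coord_field U \<phi> i q h"
    using fh smooth_near_mult[OF fh] frechet_derivative_eq[OF has_derivative_mult[OF d]] U q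
    by (simp add: coord_field_def)
qed

lemma coord_field_vector_field:
  assumes U: "(U, \<phi>) \<in> A"
  shows "vector_field_on A U (coord_field U \<phi> i)"
  unfolding vector_field_on_def
proof (intro conjI ballI allI impI; (elim conjE)?)
  fix W f assume W: "W \<subseteq> U" "smooth_fun_on A W f"
  have "smooth_fun_on A W (\<lambda>q. frechet_derivative (\<lambda>x. f (inv_into U \<phi> x)) (at (\<phi> q)) (axis i 1))"
    by (rule smooth_fun_on_chart[OF U smooth_fun_on_open[OF W(2)] W(1)
          smooth_on_directional[OF smooth_fun_onD[OF W(2) U]]]) (use W in auto)
  then show "smooth_fun_on A W (\<lambda>p. coord_field U \<phi> i p f)"
    by (rule smooth_fun_on_cong) (use W(2) in \<open>auto simp: coord_field_def intro: smooth_nearI\<close>)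
qed (use U chart_open coord_field_tangent in blast)+

lemma coord_field_coord:
  assumes U: "(U, \<phi>) \<in> A" and q: "q \<in> U"
  shows "coord_field U \<phi> i q (\<lambda>r. \<phi> r $ j) = (if i = j then 1 else 0)"
proof -
  have "frechet_derivative (\<lambda>x. \<phi> (inv_into U \<phi> x) $ j) (at (\<phi> q))
      = frechet_derivative (\<lambda>x. x $ j) (at (\<phi> q))"
    by (rule frechet_derivative_cong_open[OF chart_image_open[OF U]])
      (use q U in \<open>auto\<close>)
  also have "\<dots> = (\<lambda>x. x $ j)"
    by (rule frechet_derivative_eq) (simp add: bounded_linear_imp_has_derivative bounded_linear_vec_nth)
  finally show ?thesis
    using smooth_nearI[OF smooth_fun_on_coord[OF U] q] by (auto simp: coord_field_def axis_def)
qed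

text \<open>The coordinate fields are linearly independent, since they are dual to the coordinate
  functions, and their number is the dimension of the tangent space; hence they span it.\<close>

lemma tangent_coord_expansion:
  assumes U: "(U, \<phi>) \<in> A" and q: "q \<in> U" and v: "v \<in> tangent_space A q"
  shows "v = (\<lambda>f. \<Sum>i\<in>UNIV. v (\<lambda>r. \<phi> r $ i) * coord_field U \<phi> i q f)"
proof -
  obtain e where e: "tangent_basis A q e" using ex_tangent_basis by blast
  define X where "X v = (\<chi> j. v (\<lambda>r. \<phi> r $ j))" for v :: "'a tangent"
  define J where "J a = (\<lambda>f. \<Sum>i\<in>UNIV. a $ i * coord_field U \<phi> i q f)" for a :: "real ^ 'n"
  define C where "C c = (\<lambda>f. \<Sum>i\<in>UNIV. c $ i * e i f)" for c :: "real ^ 'n"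
  have XJ: "X (J a) = a" for a
    by (auto simp: X_def J_def vec_eq_iff coord_field_coord[OF U q] if_distrib[of "(*) _"] cong: if_cong)
  have rep: "\<exists>c. w = C c" if w: "w \<in> tangent_space A q" for w
  proof -
    have "\<exists>c. w = (\<lambda>f. \<Sum>i\<in>UNIV. c i * e i f)"
      using e w unfolding tangent_basis_def by blast
    then obtain c where "w = (\<lambda>f. \<Sum>i\<in>UNIV. c i * e i f)" by blast
    then have "w = C (\<chi> i. c i)" by (simp add: C_def)
    then show ?thesis by blast
  qed
  have J: "J a \<in> tangent_space A q" for a
    unfolding J_def by (intro tangent_sum_closed coord_field_tangent U q)
  \<comment> \<open>\<open>J\<close> is a right inverse of \<open>X\<close>. As the source and target of \<open>X \<circ> C\<close> have the same dimension,
    this surjection is injective, and so \<open>J\<close> is a left inverse too.\<close>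
  have "linear (\<lambda>c. X (C c))"
    by (intro linearI) (auto simp: X_def C_def vec_eq_iff algebra_simps sum.distrib sum_distrib_left)
  moreover have "surj (\<lambda>c. X (C c))"
    unfolding surj_def
  proof
    fix a
    obtain c where "J a = C c" using rep[OF J] by blast
    then show "\<exists>c. a = X (C c)" using XJ[of a] by (intro exI[of _ c]) simp
  qed
  ultimately have "inj (\<lambda>c. X (C c))"
    by (simp add: linear_surjective_imp_injective)
  moreover obtain c c' where "v = C c" "J (X v) = C c'"
    using rep v J by metis
  moreover from this have "X (C c) = X (C c')" using XJ[of "X v"] by simp
  ultimately have "v = J (X v)" by (metis injD)
  then show ?thesis by (simp add: J_def X_def)
qed

lemma coord_field_basis:
  assumes U: "(U, \<phi>) \<in> A" and q: "q \<in> U"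
  shows "tangent_basis A q (\<lambda>i. coord_field U \<phi> i q)"
  unfolding tangent_basis_def
proof (intro conjI allI ballI ex1I)
  fix v assume "v \<in> tangent_space A q"
  then show "v = (\<lambda>f. \<Sum>i\<in>UNIV. v (\<lambda>r. \<phi> r $ i) * coord_field U \<phi> i q f)"
    by (rule tangent_coord_expansion[OF U q])
next
  fix v c assume v: "v = (\<lambda>f. \<Sum>i\<in>UNIV. c i * coord_field U \<phi> i q f)"
  show "c = (\<lambda>i. v (\<lambda>r. \<phi> r $ i))"
    by (simp add: v coord_field_coord[OF U q] fun_eq_iff if_distrib[of "(*) _"] cong: if_cong)
qed (rule coord_field_tangent[OF U q])

text \<open>The combination of coordinate fields with constant coefficients is an extension, so the choice
  in \<open>local_ext\<close> is made from a nonempty set.\<close>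

lemma local_ext:
  assumes v: "v \<in> tangent_space A p"
  shows "vector_field_near A p (local_ext A p v)" "local_ext A p v p = v"
proof -
  obtain U \<phi> where U: "(U, \<phi>) \<in> A" "p \<in> U" by (rule chart_at)
  let ?X = "\<lambda>q f. \<Sum>i\<in>UNIV. v (\<lambda>r. \<phi> r $ i) * coord_field U \<phi> i q f"
  have "vector_field_on A U ?X"
    by (intro vector_field_sum vector_field_mult coord_field_vector_field smooth_fun_on_const
        chart_open[OF U(1)] U)
  then have "\<exists>X. vector_field_near A p X \<and> X p = v"
    using U v tangent_coord_expansion[OF U v] by (intro exI[of _ ?X]) (auto intro: vector_field_nearI)
  from someI_ex[OF this] show "vector_field_near A p (local_ext A p v)" "local_ext A p v p = v"
    by (auto simp: local_ext_def)
qed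

text \<open>The chain rule is read off in coordinates, where a tangent vector is a combination of partial
  derivatives.\<close>

lemma tangent_exp:
  assumes v: "v \<in> tangent_space A p" and f: "smooth_near A p f"
  shows "v (\<lambda>q. exp (f q)) = exp (f p) * v f"
proof -
  obtain U \<phi> where U: "(U, \<phi>) \<in> A" "p \<in> U" by (rule chart_at)
  have sm: "smooth_near A p (\<lambda>q. exp (f q))"
    using f smooth_fun_on_exp unfolding smooth_near_def by blast
  note d = smooth_near_chart[OF U f, unfolded frechet_derivative_works]
  have "coord_field U \<phi> i p (\<lambda>q. exp (f q)) = exp (f p) * coord_field U \<phi> i p f" for i
    using sm f frechet_derivative_eq[OF has_derivative_exp[OF d]] U
    by (simp add: coord_field_def mult.commute)
  then show ?thesis
    by (subst (1 2) tangent_coord_expansion[OF U v]) (simp add: sum_distrib_left mult_ac)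
qed

text \<open>Expanding a field in coordinates near \<open>p\<close> with smooth coefficients reduces it to its
  value at \<open>p\<close>.\<close>

lemma tensorial_pointwise:
  fixes \<Phi> :: "'a vfield \<Rightarrow> real"
  assumes cong: "\<And>Y Z. vector_field_near A p Y \<Longrightarrow> \<forall>\<^sub>F q in nhds p. Y q = Z q \<Longrightarrow> \<Phi> Y = \<Phi> Z"
    and add: "\<And>Y Z. vector_field_near A p Y \<Longrightarrow> vector_field_near A p Z \<Longrightarrow>
      \<Phi> (\<lambda>q f. Y q f + Z q f) = \<Phi> Y + \<Phi> Z"
    and mult: "\<And>h Y. smooth_near A p h \<Longrightarrow> vector_field_near A p Y \<Longrightarrow>
      \<Phi> (\<lambda>q f. h q * Y q f) = h p * \<Phi> Y"
    and YZ: "vector_field_near A p Y" "vector_field_near A p Z" "Y p = Z p"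
  shows "\<Phi> Y = \<Phi> Z"
proof -
  obtain U \<phi> where U: "(U, \<phi>) \<in> A" "p \<in> U" by (rule chart_at)
  let ?E = "coord_field U \<phi>" and ?x = "\<lambda>i r. \<phi> r $ i"
  have E: "vector_field_near A p (?E i)" for i
    using coord_field_vector_field[OF U(1)] U(2) by (rule vector_field_nearI)
  have zero: "\<Phi> (\<lambda>_ _. 0) = 0"
    using mult[OF smooth_near_const[of _ 0] E] by simp
  have sum: "\<Phi> (\<lambda>q f. \<Sum>i\<in>I. X i q f) = (\<Sum>i\<in>I. \<Phi> (X i))"
    if "\<And>i. vector_field_near A p (X i)" for I and X :: "'n \<Rightarrow> 'a vfield"
    by (induction I rule: infinite_finite_induct)
      (auto simp: zero add that vector_field_near_sum)
  have main: "\<Phi> X = (\<Sum>i\<in>UNIV. X p (?x i) * \<Phi> (?E i))" if X: "vector_field_near A p X" for X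
  proof -
    have x: "smooth_near A p (\<lambda>q. X q (?x i))" for i
      by (intro vector_field_near_smooth[OF X] smooth_nearI[OF smooth_fun_on_coord[OF U(1)] U(2)])
    obtain V where V: "p \<in> V" "V \<subseteq> U" "vector_field_on A V X"
      using vector_field_near2E[OF X X chart_open[OF U(1)] U(2)] by metis
    have "\<forall>\<^sub>F q in nhds p. X q = (\<lambda>f. \<Sum>i\<in>UNIV. X q (?x i) * ?E i q f)"
      unfolding eventually_nhds
    proof (intro exI[of _ V] conjI ballI)
      fix q assume "q \<in> V"
      then show "X q = (\<lambda>f. \<Sum>i\<in>UNIV. X q (?x i) * ?E i q f)"
        using V(2) by (intro tangent_coord_expansion[OF U(1) _ vector_field_tangent[OF V(3)]]) auto
    qed (rule vector_field_open[OF V(3)], rule V(1))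
    then have "\<Phi> X = \<Phi> (\<lambda>q f. \<Sum>i\<in>UNIV. X q (?x i) * ?E i q f)"
      by (rule cong[OF X])
    also have "\<dots> = (\<Sum>i\<in>UNIV. \<Phi> (\<lambda>q f. X q (?x i) * ?E i q f))"
      by (rule sum) (intro vector_field_near_mult x E)
    finally show ?thesis by (simp add: mult[OF x E])
  qed
  show ?thesis using main[OF YZ(1)] main[OF YZ(2)] YZ(3) by simp
qed

section \<open>Endomorphisms of a tangent space and their traces\<close>

definition tangent_endo :: "'a \<Rightarrow> ('a tangent \<Rightarrow> 'a tangent) \<Rightarrow> bool" where
  "tangent_endo p L \<longleftrightarrow> (\<forall>v\<in>tangent_space A p. L v \<in> tangent_space A p) \<and>
     (\<forall>v\<in>tangent_space A p. \<forall>w\<in>tangent_space A p. \<forall>a b.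
        L (\<lambda>f. a * v f + b * w f) = (\<lambda>f. a * L v f + b * L w f))"

lemma tangent_endo_sum:
  assumes L: "tangent_endo p L" and v: "\<And>i. v i \<in> tangent_space A p"
  shows "L (\<lambda>f. \<Sum>i\<in>I. c i * v i f) = (\<lambda>f. \<Sum>i\<in>I. c i * L (v i) f)"
proof -
  have lin: "L (\<lambda>f. a * v f + b * w f) = (\<lambda>f. a * L v f + b * L w f)"
    if "v \<in> tangent_space A p" "w \<in> tangent_space A p" for v w a b
    using L that unfolding tangent_endo_def by blast
  have zero: "L (\<lambda>_. 0) = (\<lambda>_. 0)"
    using lin[OF tangent_zero tangent_zero, of 0 0] by simp
  show ?thesis
  proof (induction I rule: infinite_finite_induct)
    case (insert i I)
    have "(\<lambda>f. \<Sum>i\<in>I. c i * v i f) \<in> tangent_space A p"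
      by (rule tangent_sum_closed) (rule v)
    from lin[OF v this, of "c i" i 1] insert show ?case by simp
  qed (auto simp: zero)
qed

lemma tangent_basis_matrix:
  assumes e: "tangent_basis A p e" and v: "\<And>j. v j \<in> tangent_space A p"
  shows "\<exists>m :: real ^ 'n ^ 'n. \<forall>j. v j = (\<lambda>f. \<Sum>i\<in>UNIV. m $ i $ j * e i f)"
proof -
  have "\<exists>c. v j = (\<lambda>f. \<Sum>i\<in>UNIV. c i * e i f)" for j
    using e v[of j] unfolding tangent_basis_def by blast
  then obtain c where "\<And>j. v j = (\<lambda>f. \<Sum>i\<in>UNIV. c j i * e i f)" by metis
  then show ?thesis by (intro exI[of _ "\<chi> i j. c j i"]) simp
qed

lemma tangent_basis_unique:
  assumes e: "tangent_basis A p e"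
    and eq: "(\<lambda>f. \<Sum>i\<in>UNIV. c i * e i f) = (\<lambda>f. \<Sum>i\<in>UNIV. d i * e i f)"
  shows "c = d"
proof -
  have "(\<lambda>f. \<Sum>i\<in>UNIV. c i * e i f) \<in> tangent_space A p"
    using e by (intro tangent_sum_closed) (auto simp: tangent_basis_def)
  with e have "\<exists>!d. (\<lambda>f. \<Sum>i\<in>UNIV. c i * e i f) = (\<lambda>f. \<Sum>i\<in>UNIV. d i * e i f)"
    unfolding tangent_basis_def by blast
  with eq show ?thesis by blast
qed

lemma tangent_basis_mem: "tangent_basis A p e \<Longrightarrow> e i \<in> tangent_space A p"
  by (simp add: tangent_basis_def)

text \<open>If \<open>s\<close> and \<open>s'\<close> are the transition matrices between the two bases, then \<open>m' = s' m s\<close> and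
  \<open>s s' = 1\<close>, so the traces agree.\<close>

lemma trace_basis_independent:
  assumes L: "tangent_endo p L" and e: "tangent_basis A p e" and e': "tangent_basis A p e'"
    and m: "\<And>j. L (e j) = (\<lambda>f. \<Sum>i\<in>UNIV. m $ i $ j * e i f)"
    and m': "\<And>j. L (e' j) = (\<lambda>f. \<Sum>i\<in>UNIV. m' $ i $ j * e' i f)"
  shows "trace m = trace (m' :: real ^ 'n ^ 'n)"
proof -
  have comb: "(\<lambda>f. \<Sum>j\<in>UNIV. c j * (\<Sum>i\<in>UNIV. s $ i $ j * e i f))
      = (\<lambda>f. \<Sum>i\<in>UNIV. (\<Sum>j\<in>UNIV. s $ i $ j * c j) * e i f)"
    for c and s :: "real ^ 'n ^ 'n"
  proof
    fix f
    have "(\<Sum>j\<in>UNIV. c j * (\<Sum>i\<in>UNIV. s $ i $ j * e i f))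
        = (\<Sum>j\<in>UNIV. \<Sum>i\<in>UNIV. s $ i $ j * c j * e i f)"
      by (simp add: sum_distrib_left mult_ac)
    also have "\<dots> = (\<Sum>i\<in>UNIV. \<Sum>j\<in>UNIV. s $ i $ j * c j * e i f)"
      by (rule sum.swap)
    finally show "(\<Sum>j\<in>UNIV. c j * (\<Sum>i\<in>UNIV. s $ i $ j * e i f))
        = (\<Sum>i\<in>UNIV. (\<Sum>j\<in>UNIV. s $ i $ j * c j) * e i f)"
      by (simp add: sum_distrib_right)
  qed
  obtain s where s: "\<forall>j. e' j = (\<lambda>f. \<Sum>i\<in>UNIV. s $ i $ j * e i f)"
    using tangent_basis_matrix[of p e e', OF e tangent_basis_mem[OF e']] by blast
  obtain s' where s': "\<forall>j. e j = (\<lambda>f. \<Sum>i\<in>UNIV. s' $ i $ j * e' i f)"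
    using tangent_basis_matrix[of p e' e, OF e' tangent_basis_mem[OF e]] by blast
  have ss': "s ** s' = mat 1"
  proof -
    have "(\<lambda>i. (s ** s') $ i $ l) = (\<lambda>i. mat 1 $ i $ l)" for l
    proof (rule tangent_basis_unique[OF e])
      have "(\<lambda>f. \<Sum>i\<in>UNIV. (s ** s') $ i $ l * e i f) = e l"
        by (subst s'[rule_format, of l], subst s[rule_format], subst comb) (simp add: matrix_matrix_mult_def)
      then show "(\<lambda>f. \<Sum>i\<in>UNIV. (s ** s') $ i $ l * e i f) = (\<lambda>f. \<Sum>i\<in>UNIV. mat 1 $ i $ l * e i f)"
        by (simp add: mat_def if_distrib[of "\<lambda>x. x * _"] cong: if_cong)
    qed
    then show ?thesis by (simp add: vec_eq_iff fun_eq_iff)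
  qed
  have "m ** s = s ** m'"
  proof -
    have "(\<lambda>i. (m ** s) $ i $ l) = (\<lambda>i. (s ** m') $ i $ l)" for l
    proof (rule tangent_basis_unique[OF e])
      have "(\<lambda>f. \<Sum>i\<in>UNIV. (m ** s) $ i $ l * e i f) = L (e' l)"
        by (subst s[rule_format, of l], subst tangent_endo_sum[OF L tangent_basis_mem[OF e]], subst m, subst comb)
          (simp add: matrix_matrix_mult_def)
      also have "\<dots> = (\<lambda>f. \<Sum>i\<in>UNIV. (s ** m') $ i $ l * e i f)"
        by (subst m', subst s[rule_format], subst comb) (simp add: matrix_matrix_mult_def)
      finally show "(\<lambda>f. \<Sum>i\<in>UNIV. (m ** s) $ i $ l * e i f)
        = (\<lambda>f. \<Sum>i\<in>UNIV. (s ** m') $ i $ l * e i f)" .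
    qed
    then show ?thesis by (simp add: vec_eq_iff fun_eq_iff)
  qed
  then have "m = s ** m' ** s'"
    by (metis matrix_mul_assoc matrix_mul_rid ss')
  then have "trace m = trace (s' ** s ** m')"
    by (metis matrix_mul_assoc trace_mul_sym)
  moreover have "s' ** s = mat 1" using ss' matrix_left_right_inverse by blast
  ultimately show ?thesis by (simp add: matrix_mul_lid)
qed

lemma tangent_trace_eq:
  assumes L: "tangent_endo p L" and e: "tangent_basis A p e"
    and m: "\<And>j. L (e j) = (\<lambda>f. \<Sum>i\<in>UNIV. m $ i $ j * e i f)"
  shows "tangent_trace A p L = trace m"
  unfolding tangent_trace_def
  by (rule the_equality) (use assms trace_basis_independent[OF L _ e _ m] in blast)+

end

section \<open>Lorentzian manifolds and the Levi-Civita connection\<close>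

locale lorentzian =
  fixes A :: "('a::{t2_space, second_countable_topology}, 'n::finite) chart set"
    and g :: "'a tensor2" and nabla :: "'a connection"
  assumes smooth_atlas: "smooth_atlas A"
    and metric: "lorentzian_metric A g"
    and levi_civita: "levi_civita A g nabla"

sublocale lorentzian \<subseteq> manifold A
  by unfold_locales (use smooth_atlas metric in \<open>auto simp: lorentzian_metric_def\<close>)

context lorentzian
begin

lemma g_sym: "v \<in> tangent_space A p \<Longrightarrow> w \<in> tangent_space A p \<Longrightarrow> g p v w = g p w v"
  using metric by (auto simp: lorentzian_metric_def)

lemma g_lin_left: "u \<in> tangent_space A p \<Longrightarrow> v \<in> tangent_space A p \<Longrightarrow> w \<in> tangent_space A p \<Longrightarrow>
    g p (\<lambda>f. a * u f + b * v f) w = a * g p u w + b * g p v w"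
  and g_lin_right: "u \<in> tangent_space A p \<Longrightarrow> v \<in> tangent_space A p \<Longrightarrow> w \<in> tangent_space A p \<Longrightarrow>
    g p w (\<lambda>f. a * u f + b * v f) = a * g p w u + b * g p w v"
  using metric unfolding lorentzian_metric_def tensor2_field_def by blast+

lemma g_scale_left: "u \<in> tangent_space A p \<Longrightarrow> w \<in> tangent_space A p \<Longrightarrow>
    g p (\<lambda>f. a * u f) w = a * g p u w"
  using g_lin_left[of u p u w a 0] by simp

lemma g_diff_right: "u \<in> tangent_space A p \<Longrightarrow> v \<in> tangent_space A p \<Longrightarrow> w \<in> tangent_space A p \<Longrightarrow>
    g p w (\<lambda>f. u f - v f) = g p w u - g p w v"
  using g_lin_right[of u p v w 1 "-1"] by simp

lemma g_zero_left: "w \<in> tangent_space A p \<Longrightarrow> g p (\<lambda>_. 0) w = 0"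
  using g_scale_left[OF tangent_zero, of w p 0] by simp

lemma g_sum_left:
  assumes "\<And>i. v i \<in> tangent_space A p" "w \<in> tangent_space A p"
  shows "g p (\<lambda>f. \<Sum>i\<in>I. c i * v i f) w = (\<Sum>i\<in>I. c i * g p (v i) w)"
proof (induction I rule: infinite_finite_induct)
  case (insert i I)
  have "(\<lambda>f. \<Sum>i\<in>I. c i * v i f) \<in> tangent_space A p"
    by (rule tangent_sum_closed) (rule assms)
  from g_lin_left[OF assms(1)[of i] this assms(2), of "c i" 1] insert show ?case by simp
qed (simp_all add: g_zero_left assms)

lemma g_sum_right:
  assumes "\<And>i. v i \<in> tangent_space A p" "w \<in> tangent_space A p"
  shows "g p w (\<lambda>f. \<Sum>i\<in>I. c i * v i f) = (\<Sum>i\<in>I. c i * g p w (v i))"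
proof -
  have "(\<lambda>f. \<Sum>i\<in>I. c i * v i f) \<in> tangent_space A p"
    by (rule tangent_sum_closed) (rule assms)
  then show ?thesis
    using g_sum_left[OF assms] g_sym[OF assms(2)] assms(1) by simp
qed

lemma g_smooth: "vector_field_on A U X \<Longrightarrow> vector_field_on A U Y \<Longrightarrow>
    smooth_fun_on A U (\<lambda>p. g p (X p) (Y p))"
  using metric by (auto simp: lorentzian_metric_def tensor2_field_def)

lemma g_smooth_near: "vector_field_near A p X \<Longrightarrow> vector_field_near A p Y \<Longrightarrow>
    smooth_near A p (\<lambda>p. g p (X p) (Y p))"
  by (erule (1) vector_field_near2E[OF _ _ open_UNIV UNIV_I]) (blast intro: smooth_nearI g_smooth)

lemma g_nondegenerate: "v \<in> tangent_space A p \<Longrightarrow>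
    (\<And>w. w \<in> tangent_space A p \<Longrightarrow> g p v w = 0) \<Longrightarrow> v = (\<lambda>_. 0)"
  using metric by (auto simp: lorentzian_metric_def nondegenerate_def)

lemma affine: "affine_connection A nabla"
  using levi_civita by (simp add: levi_civita_def)

lemmas affineD = affine[unfolded affine_connection_def]

lemma cov_field: "vector_field_on A U X \<Longrightarrow> vector_field_on A U Y \<Longrightarrow>
    vector_field_on A U (cov nabla X Y)"
  by (rule affineD[THEN conjunct1, rule_format, OF conjI])

lemma cov_field_near:
  assumes "vector_field_near A p X" "vector_field_near A p Y"
  shows "vector_field_near A p (cov nabla X Y)"
  by (rule vector_field_near2E[OF assms open_UNIV UNIV_I]) (blast intro: vector_field_nearI cov_field)

lemma nabla_tangent:
  assumes "v \<in> tangent_space A p" "vector_field_near A p Y"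
  shows "nabla p v Y \<in> tangent_space A p"
  using vector_field_near_tangent[OF cov_field_near[OF local_ext(1)[OF assms(1)] assms(2)]]
    local_ext(2)[OF assms(1)] by (simp add: cov_def)

lemma nabla_cong: "v \<in> tangent_space A p \<Longrightarrow> vector_field_near A p Y \<Longrightarrow>
    \<forall>\<^sub>F q in nhds p. Y q = Z q \<Longrightarrow> nabla p v Y = nabla p v Z"
  by (rule affineD[THEN conjunct2, THEN conjunct1, rule_format, OF _ conjI])

lemma nabla_lin: "v \<in> tangent_space A p \<Longrightarrow> w \<in> tangent_space A p \<Longrightarrow> vector_field_near A p Y \<Longrightarrow>
    nabla p (\<lambda>f. a * v f + b * w f) Y = (\<lambda>f. a * nabla p v Y f + b * nabla p w Y f)"
  by (rule affineD[THEN conjunct2, THEN conjunct2, THEN conjunct1, rule_format])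

lemma nabla_add: "v \<in> tangent_space A p \<Longrightarrow> vector_field_near A p Y \<Longrightarrow> vector_field_near A p Z \<Longrightarrow>
    nabla p v (\<lambda>q f. Y q f + Z q f) = (\<lambda>f. nabla p v Y f + nabla p v Z f)"
  by (rule affineD[THEN conjunct2, THEN conjunct2, THEN conjunct2, THEN conjunct1,
        rule_format, OF _ conjI])

lemma nabla_mult: "v \<in> tangent_space A p \<Longrightarrow> smooth_near A p h \<Longrightarrow> vector_field_near A p Y \<Longrightarrow>
    nabla p v (\<lambda>q f. h q * Y q f) = (\<lambda>f. v h * Y p f + h p * nabla p v Y f)"
  by (rule affineD[THEN conjunct2, THEN conjunct2, THEN conjunct2, THEN conjunct2,
        rule_format, OF _ conjI])

lemma nabla_plus: "v \<in> tangent_space A p \<Longrightarrow> w \<in> tangent_space A p \<Longrightarrow> vector_field_near A p Y \<Longrightarrow>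
    nabla p (\<lambda>f. v f + w f) Y = (\<lambda>f. nabla p v Y f + nabla p w Y f)"
  using nabla_lin[of v p w Y 1 1] by simp

lemma nabla_scale: "v \<in> tangent_space A p \<Longrightarrow> vector_field_near A p Y \<Longrightarrow>
    nabla p (\<lambda>f. a * v f) Y = (\<lambda>f. a * nabla p v Y f)"
  using nabla_lin[of v p v Y a 0] by simp

lemma vector_field_near_zero: "vector_field_near A p (\<lambda>_ _. 0)"
  using vector_field_zero[OF open_UNIV] by (rule vector_field_nearI) simp

lemma nabla_zero: "v \<in> tangent_space A p \<Longrightarrow> nabla p v (\<lambda>_ _. 0) = (\<lambda>_. 0)"
  using nabla_mult[OF _ smooth_near_const vector_field_near_zero, of v p 0]
  by (simp add: tangent_const)

lemma nabla_endo: "vector_field_near A p Y \<Longrightarrow> tangent_endo p (\<lambda>v. nabla p v Y)"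
  by (simp add: tangent_endo_def nabla_tangent nabla_lin)

lemma nabla_sum:
  assumes v: "v \<in> tangent_space A p"
    and hY: "\<And>i. smooth_near A p (h i)" "\<And>i. vector_field_near A p (Y i)"
  shows "nabla p v (\<lambda>q f. \<Sum>i\<in>I. h i q * Y i q f)
    = (\<lambda>f. \<Sum>i\<in>I. v (h i) * Y i p f + h i p * nabla p v (Y i) f)"
proof (induction I rule: infinite_finite_induct)
  case (insert i I)
  have 1: "vector_field_near A p (\<lambda>q f. h i q * Y i q f)" for i
    by (intro vector_field_near_mult hY)
  then have 2: "vector_field_near A p (\<lambda>q f. \<Sum>i\<in>I. h i q * Y i q f)"
    by (rule vector_field_near_sum)
  from nabla_add[OF v 1 2, of i] insert show ?case
    by (simp add: nabla_mult[OF v hY])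
qed (simp_all add: nabla_zero v)

lemma lie_bracket_eq:
  assumes "vector_field_near A p X" "vector_field_near A p Y"
  shows "lie_bracket A X Y p = (\<lambda>f. nabla p (X p) Y f - nabla p (Y p) X f)"
proof -
  obtain U where "p \<in> U" "vector_field_on A U X" "vector_field_on A U Y"
    using vector_field_near2E[OF assms open_UNIV UNIV_I] by metis
  then show ?thesis
    using levi_civita[unfolded levi_civita_def cov_def, THEN conjunct2, THEN conjunct1, rule_format, OF conjI]
    by blast
qed

text \<open>Torsion-freeness expresses the bracket by covariant derivatives, whose smoothness is part of the
  notion of a connection.\<close>

lemma lie_bracket_field:
  assumes "vector_field_on A U X" "vector_field_on A U Y"
  shows "vector_field_on A U (lie_bracket A X Y)"
proof (rule vector_field_cong)
  show "vector_field_on A U (\<lambda>q f. cov nabla X Y q f - cov nabla Y X q f)"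
    by (intro vector_field_diff cov_field assms)
  show "(\<lambda>f. cov nabla X Y q f - cov nabla Y X q f) = lie_bracket A X Y q" if "q \<in> U" for q
    using lie_bracket_eq[OF vector_field_nearI[OF assms(1) that] vector_field_nearI[OF assms(2) that]]
    by (simp add: cov_def)
qed

lemma lie_bracket_near:
  assumes "vector_field_near A p X" "vector_field_near A p Y"
  shows "vector_field_near A p (lie_bracket A X Y)"
  by (rule vector_field_near2E[OF assms open_UNIV UNIV_I]) (blast intro: vector_field_nearI lie_bracket_field)

lemma nabla_metric:
  assumes "v \<in> tangent_space A p" "vector_field_near A p Y" "vector_field_near A p Z"
  shows "v (\<lambda>q. g q (Y q) (Z q)) = g p (nabla p v Y) (Z p) + g p (Y p) (nabla p v Z)"
proof -
  note X = local_ext[OF assms(1)]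
  obtain U where U: "p \<in> U" "vector_field_on A U Y" "vector_field_on A U Z"
    using vector_field_near2E[OF assms(2,3) open_UNIV UNIV_I] by metis
  obtain V where V: "p \<in> V" "V \<subseteq> U" "vector_field_on A V (local_ext A p v)"
    using vector_field_near2E[OF X(1) X(1) vector_field_open[OF U(2)] U(1)] by metis
  have "vector_field_on A V Y" "vector_field_on A V Z"
    using U V vector_field_open[OF V(3)] by (blast intro: vector_field_subset)+
  with V(3) have "local_ext A p v p (\<lambda>q. g q (Y q) (Z q)) = g p (cov nabla (local_ext A p v) Y p) (Z p)
      + g p (Y p) (cov nabla (local_ext A p v) Z p)"
    by (intro levi_civita[unfolded levi_civita_def, THEN conjunct2, THEN conjunct2, rule_format, of V]
        conjI V(1))
  then show ?thesis by (simp add: X(2) cov_def)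
qed

lemma eventually_near:
  assumes "vector_field_near A p X"
  shows "\<forall>\<^sub>F q in nhds p. vector_field_near A q X"
proof -
  obtain U where "p \<in> U" "vector_field_on A U X"
    using assms by (auto simp: vector_field_near_def)
  then show ?thesis
    by (auto simp: eventually_nhds intro!: exI[of _ U] vector_field_nearI dest: vector_field_open)
qed

lemma eventually_smooth_near:
  assumes "smooth_near A p f"
  shows "\<forall>\<^sub>F q in nhds p. smooth_near A q f"
proof -
  obtain U where "p \<in> U" "smooth_fun_on A U f"
    using assms by (auto simp: smooth_near_def)
  then show ?thesis
    by (auto simp: eventually_nhds intro!: exI[of _ U] smooth_nearI dest: smooth_fun_on_open)
qed

lemma lie_bracket_jacobi:
  assumes X: "vector_field_near A p X" and Y: "vector_field_near A p Y" and Z: "vector_field_near A p Z"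
  shows "lie_bracket A (lie_bracket A X Y) Z p
    = (\<lambda>f. lie_bracket A (lie_bracket A X Z) Y p f - lie_bracket A (lie_bracket A Y Z) X p f)"
proof
  fix f
  have B: "lie_bracket A (lie_bracket A X Y) Z p f
      = X p (\<lambda>q. Y q (\<lambda>r. Z r f)) - Y p (\<lambda>q. X q (\<lambda>r. Z r f))
        - Z p (\<lambda>q. X q (\<lambda>r. Y r f)) + Z p (\<lambda>q. Y q (\<lambda>r. X r f))"
    if f: "smooth_near A p f" and X: "vector_field_near A p X" and Y: "vector_field_near A p Y"
      and Z: "vector_field_near A p Z" for X Y Z
  proof -
    note Xf = vector_field_near_smooth[OF X f] and Yf = vector_field_near_smooth[OF Y f]
      and Zf = vector_field_near_smooth[OF Z f]
    note XYf = vector_field_near_smooth[OF X Yf] and YXf = vector_field_near_smooth[OF Y Xf]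
    have "\<forall>\<^sub>F q in nhds p. X q (\<lambda>r. Y r f) - Y q (\<lambda>r. X r f) = lie_bracket A X Y q f"
      using eventually_smooth_near[OF f] by eventually_elim (simp add: lie_bracket_def)
    then have "Z p (\<lambda>q. lie_bracket A X Y q f) = Z p (\<lambda>q. X q (\<lambda>r. Y r f) - Y q (\<lambda>r. X r f))"
      using tangent_cong[OF vector_field_near_tangent[OF Z] smooth_near_diff[OF XYf YXf]] by simp
    also have "\<dots> = Z p (\<lambda>q. X q (\<lambda>r. Y r f)) - Z p (\<lambda>q. Y q (\<lambda>r. X r f))"
      by (rule tangent_diff[OF vector_field_near_tangent[OF Z] XYf YXf])
    finally show ?thesis
      using f Zf by (simp add: lie_bracket_def)
  qed
  show "lie_bracket A (lie_bracket A X Y) Z p f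
    = lie_bracket A (lie_bracket A X Z) Y p f - lie_bracket A (lie_bracket A Y Z) X p f"
  proof (cases "smooth_near A p f")
    case True
    show ?thesis using B[OF True X Y Z] B[OF True X Z Y] B[OF True Y Z X] by simp
  qed (simp add: lie_bracket_def)
qed

section \<open>The exterior derivative of the 1-form dual to a vector field\<close>

text \<open>With a torsion-free metric connection, the exterior derivative of the 1-form \<open>g(K, \<cdot>)\<close> is the
  antisymmetric part of \<open>\<nabla>K\<close>. In this form the value at \<open>p\<close> visibly depends only on the two tangent
  vectors, and bilinearity is inherited from the connection.\<close>

definition curl :: "'a vfield \<Rightarrow> 'a tensor2" where
  "curl K p v w = g p (nabla p v K) w - g p (nabla p w K) v"

text \<open>In \<open>X(g(K, Y)) - Y(g(K, X))\<close> the terms differentiating \<open>X\<close> and \<open>Y\<close> combine to \<open>g(K, [X, Y])\<close>.\<close>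

lemma curl_eq:
  assumes K: "vector_field_near A p K"
    and X: "vector_field_near A p X" and Y: "vector_field_near A p Y"
  shows "curl K p (X p) (Y p) = X p (\<lambda>q. g q (K q) (Y q)) - Y p (\<lambda>q. g q (K q) (X q))
    - g p (K p) (lie_bracket A X Y p)"
proof -
  note T = vector_field_near_tangent[OF X] vector_field_near_tangent[OF Y] vector_field_near_tangent[OF K]
  have "g p (K p) (lie_bracket A X Y p)
      = g p (K p) (nabla p (X p) Y) - g p (K p) (nabla p (Y p) X)"
    by (subst lie_bracket_eq[OF X Y], rule g_diff_right) (intro nabla_tangent T X Y)+
  then show ?thesis
    by (simp add: curl_def nabla_metric[OF T(1) K Y] nabla_metric[OF T(2) K X])
qed

lemma d1_flat:
  assumes K: "vector_field_near A p K" and v: "v \<in> tangent_space A p" and w: "w \<in> tangent_space A p"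
  shows "d1 A (flat g K) p v w = curl K p v w"
  using curl_eq[OF K local_ext(1)[OF v] local_ext(1)[OF w]] local_ext(2)[OF v] local_ext(2)[OF w]
  by (simp add: d1_def flat_def Let_def)

lemma curl_antisym: "curl K p v w = - curl K p w v"
  by (simp add: curl_def)

lemma curl_lin_left:
  assumes K: "vector_field_near A p K"
    and "u \<in> tangent_space A p" "v \<in> tangent_space A p" "w \<in> tangent_space A p"
  shows "curl K p (\<lambda>f. a * u f + b * v f) w = a * curl K p u w + b * curl K p v w"
  using assms
  by (simp add: curl_def nabla_lin g_lin_left g_lin_right nabla_tangent algebra_simps)

lemma curl_lin_right:
  assumes K: "vector_field_near A p K"
    and "u \<in> tangent_space A p" "v \<in> tangent_space A p" "w \<in> tangent_space A p"
  shows "curl K p w (\<lambda>f. a * u f + b * v f) = a * curl K p w u + b * curl K p w v"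
  using curl_lin_left[OF assms] curl_antisym by (metis (no_types, lifting) add.inverse_distrib_swap
      add.commute mult_minus_right)

lemma curl_smooth:
  assumes "vector_field_on A U K" "vector_field_on A U X" "vector_field_on A U Y"
  shows "smooth_fun_on A U (\<lambda>p. curl K p (X p) (Y p))"
  using smooth_fun_on_diff[OF g_smooth[OF cov_field[OF assms(2,1)] assms(3)]
      g_smooth[OF cov_field[OF assms(3,1)] assms(2)]]
  by (simp add: curl_def cov_def)

lemma curl_smooth_near:
  assumes "vector_field_near A p K" "vector_field_near A p X" "vector_field_near A p Y"
  shows "smooth_near A p (\<lambda>p. curl K p (X p) (Y p))"
  using smooth_near_diff[OF g_smooth_near[OF cov_field_near[OF assms(2,1)] assms(3)]
      g_smooth_near[OF cov_field_near[OF assms(3,1)] assms(2)]]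
  by (simp add: curl_def cov_def)

text \<open>This is \<open>d \<circ> d = 0\<close>: the second derivatives cancel in pairs, and what is left is the Jacobi
  identity.\<close>

lemma curl_closed:
  assumes K: "vector_field_near A p K" and X: "vector_field_near A p X"
    and Y: "vector_field_near A p Y" and Z: "vector_field_near A p Z"
  shows "X p (\<lambda>q. curl K q (Y q) (Z q)) - Y p (\<lambda>q. curl K q (X q) (Z q))
      + Z p (\<lambda>q. curl K q (X q) (Y q))
      - curl K p (lie_bracket A X Y p) (Z p) + curl K p (lie_bracket A X Z p) (Y p)
      - curl K p (lie_bracket A Y Z p) (X p) = 0"
proof -
  let ?al = "\<lambda>X q. g q (K q) (X q)"
  have D: "X p (\<lambda>q. curl K q (Y q) (Z q))
      = X p (\<lambda>q. Y q (?al Z)) - X p (\<lambda>q. Z q (?al Y)) - X p (?al (lie_bracket A Y Z))"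
    if X: "vector_field_near A p X" and Y: "vector_field_near A p Y" and Z: "vector_field_near A p Z"
    for X Y Z
  proof -
    note XT = vector_field_near_tangent[OF X]
    note s1 = vector_field_near_smooth[OF Y g_smooth_near[OF K Z]]
      and s2 = vector_field_near_smooth[OF Z g_smooth_near[OF K Y]]
      and s3 = g_smooth_near[OF K lie_bracket_near[OF Y Z]]
    have "\<forall>\<^sub>F q in nhds p. curl K q (Y q) (Z q)
        = Y q (?al Z) - Z q (?al Y) - ?al (lie_bracket A Y Z) q"
      using eventually_near[OF K] eventually_near[OF Y] eventually_near[OF Z]
      by eventually_elim (rule curl_eq)
    then have "X p (\<lambda>q. curl K q (Y q) (Z q))
        = X p (\<lambda>q. Y q (?al Z) - Z q (?al Y) - ?al (lie_bracket A Y Z) q)"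
      by (rule tangent_cong[OF XT curl_smooth_near[OF K Y Z]])
    then show ?thesis
      using tangent_diff[OF XT smooth_near_diff[OF s1 s2] s3] tangent_diff[OF XT s1 s2] by simp
  qed
  have C: "curl K p (lie_bracket A X Y p) (Z p) = X p (\<lambda>q. Y q (?al Z)) - Y p (\<lambda>q. X q (?al Z))
      - Z p (?al (lie_bracket A X Y)) - g p (K p) (lie_bracket A (lie_bracket A X Y) Z p)"
    if X: "vector_field_near A p X" and Y: "vector_field_near A p Y" and Z: "vector_field_near A p Z"
    for X Y Z
    using curl_eq[OF K lie_bracket_near[OF X Y] Z] g_smooth_near[OF K Z]
    by (simp add: lie_bracket_def[of A X Y])
  have "g p (K p) (lie_bracket A (lie_bracket A X Y) Z p)
      = g p (K p) (lie_bracket A (lie_bracket A X Z) Y p)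
        - g p (K p) (lie_bracket A (lie_bracket A Y Z) X p)"
    by (subst lie_bracket_jacobi[OF X Y Z], rule g_diff_right)
      (intro vector_field_near_tangent lie_bracket_near X Y Z K)+
  then show ?thesis
    using D[OF X Y Z] D[OF Y X Z] D[OF Z X Y] C[OF X Y Z] C[OF X Z Y] C[OF Y Z X] by simp
qed

section \<open>Curvature\<close>

text \<open>The curvature tensor on vector fields. \<open>curvature\<close> evaluates it on chosen extensions of three
  tangent vectors; that the choice is immaterial is the content of this section, and it is needed
  because Ricci curvature in the direction of \<open>k\<close> will be computed with the field \<open>k\<close> itself.\<close>

definition riemann :: "'a \<Rightarrow> 'a vfield \<Rightarrow> 'a vfield \<Rightarrow> 'a vfield \<Rightarrow> 'a tangent" where
  "riemann p V X Y = (\<lambda>f. nabla p (V p) (cov nabla X Y) f - nabla p (X p) (cov nabla V Y) f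
     - nabla p (lie_bracket A V X p) Y f)"

text \<open>The two bracketed terms are second covariant derivatives of \<open>Y\<close>. The first depends on \<open>V\<close> only
  through its value at \<open>p\<close>, and the second likewise on \<open>X\<close>.\<close>

lemma riemann_eq:
  assumes V: "vector_field_near A p V" and X: "vector_field_near A p X" and Y: "vector_field_near A p Y"
  shows "riemann p V X Y = (\<lambda>f. (nabla p (V p) (cov nabla X Y) f - nabla p (nabla p (V p) X) Y f)
      - (nabla p (X p) (cov nabla V Y) f - nabla p (nabla p (X p) V) Y f))"
proof -
  have "nabla p (lie_bracket A V X p) Y
      = (\<lambda>f. nabla p (nabla p (V p) X) Y f - nabla p (nabla p (X p) V) Y f)"
    using nabla_lin[of "nabla p (V p) X" p "nabla p (X p) V" Y 1 "-1"] assms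
    by (simp add: lie_bracket_eq nabla_tangent vector_field_near_tangent)
  then show ?thesis by (simp add: riemann_def fun_eq_iff)
qed

lemma riemann_antisym:
  assumes V: "vector_field_near A p V" and X: "vector_field_near A p X" and Y: "vector_field_near A p Y"
  shows "riemann p V X Y f = - riemann p X V Y f"
  by (simp add: riemann_eq[OF V X Y] riemann_eq[OF X V Y])

lemma riemann_add_left:
  assumes V: "vector_field_near A p V" and W: "vector_field_near A p W"
    and X: "vector_field_near A p X" and Y: "vector_field_near A p Y"
  shows "riemann p (\<lambda>q f. V q f + W q f) X Y f = riemann p V X Y f + riemann p W X Y f"
proof -
  note VT = vector_field_near_tangent[OF V] and WT = vector_field_near_tangent[OF W]
    and XT = vector_field_near_tangent[OF X] and XY = cov_field_near[OF X Y]
  have "\<forall>\<^sub>F q in nhds p. (\<lambda>f. cov nabla V Y q f + cov nabla W Y q f)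
      = cov nabla (\<lambda>q f. V q f + W q f) Y q"
    using eventually_near[OF V] eventually_near[OF W] eventually_near[OF Y]
    by eventually_elim (simp add: cov_def nabla_plus vector_field_near_tangent)
  from nabla_cong[OF XT vector_field_near_add[OF cov_field_near[OF V Y] cov_field_near[OF W Y]] this]
  have "nabla p (X p) (cov nabla (\<lambda>q f. V q f + W q f) Y)
      = (\<lambda>f. nabla p (X p) (cov nabla V Y) f + nabla p (X p) (cov nabla W Y) f)"
    using nabla_add[OF XT cov_field_near[OF V Y] cov_field_near[OF W Y]] by simp
  then show ?thesis
    by (simp add: riemann_eq assms vector_field_near_add nabla_plus[OF VT WT] XY
        nabla_plus[OF nabla_tangent[OF VT X] nabla_tangent[OF WT X] Y] nabla_add[OF XT V W]
        nabla_plus[OF nabla_tangent[OF XT V] nabla_tangent[OF XT W] Y])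
qed

lemma riemann_mult_left:
  assumes h: "smooth_near A p h" and V: "vector_field_near A p V"
    and X: "vector_field_near A p X" and Y: "vector_field_near A p Y"
  shows "riemann p (\<lambda>q f. h q * V q f) X Y f = h p * riemann p V X Y f"
proof -
  note VT = vector_field_near_tangent[OF V] and XT = vector_field_near_tangent[OF X]
    and XY = cov_field_near[OF X Y]
  have "\<forall>\<^sub>F q in nhds p. (\<lambda>f. h q * cov nabla V Y q f) = cov nabla (\<lambda>q f. h q * V q f) Y q"
    using eventually_near[OF V] eventually_near[OF Y]
    by eventually_elim (simp add: cov_def nabla_scale vector_field_near_tangent)
  from nabla_cong[OF XT vector_field_near_mult[OF h cov_field_near[OF V Y]] this]
  have "nabla p (X p) (cov nabla (\<lambda>q f. h q * V q f) Y)
      = (\<lambda>f. X p h * nabla p (V p) Y f + h p * nabla p (X p) (cov nabla V Y) f)"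
    using nabla_mult[OF XT h cov_field_near[OF V Y]] by (simp add: cov_def)
  moreover have "nabla p (nabla p (X p) (\<lambda>q f. h q * V q f)) Y
      = (\<lambda>f. X p h * nabla p (V p) Y f + h p * nabla p (nabla p (X p) V) Y f)"
    by (simp add: nabla_mult[OF XT h V] nabla_lin[OF VT nabla_tangent[OF XT V] Y])
  ultimately show ?thesis
    by (simp add: riemann_eq assms vector_field_near_mult nabla_scale[OF VT] XY
        nabla_scale[OF nabla_tangent[OF VT X] Y] algebra_simps)
qed

lemma riemann_add_field:
  assumes V: "vector_field_near A p V" and X: "vector_field_near A p X"
    and Y: "vector_field_near A p Y" and Z: "vector_field_near A p Z"
  shows "riemann p V X (\<lambda>q f. Y q f + Z q f) f = riemann p V X Y f + riemann p V X Z f"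
proof -
  note B = vector_field_near_tangent[OF lie_bracket_near[OF V X]]
  have D: "nabla p (V p) (cov nabla X (\<lambda>q f. Y q f + Z q f))
      = (\<lambda>f. nabla p (V p) (cov nabla X Y) f + nabla p (V p) (cov nabla X Z) f)"
    if V: "vector_field_near A p V" and X: "vector_field_near A p X" for V X
  proof -
    have "\<forall>\<^sub>F q in nhds p. (\<lambda>f. cov nabla X Y q f + cov nabla X Z q f)
        = cov nabla X (\<lambda>q f. Y q f + Z q f) q"
      using eventually_near[OF X] eventually_near[OF Y] eventually_near[OF Z]
      by eventually_elim (simp add: cov_def nabla_add vector_field_near_tangent)
    from nabla_cong[OF vector_field_near_tangent[OF V] vector_field_near_add this]
    show ?thesis
      using nabla_add[OF vector_field_near_tangent[OF V]] cov_field_near X Y Z by simp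
  qed
  show ?thesis
    by (simp add: riemann_def D[OF V X] D[OF X V] nabla_add[OF B Y Z])
qed

text \<open>The derivatives of \<open>h\<close> enter only through \<open>V(X(h)) - X(V(h)) - [V, X](h) = 0\<close>.\<close>

lemma riemann_mult_field:
  assumes V: "vector_field_near A p V" and X: "vector_field_near A p X"
    and h: "smooth_near A p h" and Y: "vector_field_near A p Y"
  shows "riemann p V X (\<lambda>q f. h q * Y q f) f = h p * riemann p V X Y f"
proof -
  note B = vector_field_near_tangent[OF lie_bracket_near[OF V X]]
  have D: "nabla p (V p) (cov nabla X (\<lambda>q f. h q * Y q f)) f
      = V p (\<lambda>q. X q h) * Y p f + X p h * nabla p (V p) Y f
        + V p h * nabla p (X p) Y f + h p * nabla p (V p) (cov nabla X Y) f"
    if V: "vector_field_near A p V" and X: "vector_field_near A p X" for V X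
  proof -
    note VT = vector_field_near_tangent[OF V]
    note n1 = vector_field_near_mult[OF vector_field_near_smooth[OF X h] Y]
      and n2 = vector_field_near_mult[OF h cov_field_near[OF X Y]]
    have "\<forall>\<^sub>F q in nhds p. (\<lambda>f. X q h * Y q f + h q * cov nabla X Y q f)
        = cov nabla X (\<lambda>q f. h q * Y q f) q"
      using eventually_near[OF X] eventually_near[OF Y] eventually_smooth_near[OF h]
      by eventually_elim (simp add: cov_def nabla_mult vector_field_near_tangent)
    from nabla_cong[OF VT vector_field_near_add[OF n1 n2] this]
    show ?thesis
      using nabla_add[OF VT n1 n2] nabla_mult[OF VT vector_field_near_smooth[OF X h] Y]
        nabla_mult[OF VT h cov_field_near[OF X Y]] by (simp add: cov_def)
  qed
  have H: "V p (\<lambda>q. X q h) = lie_bracket A V X p h + X p (\<lambda>q. V q h)"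
    using h by (simp add: lie_bracket_def)
  show ?thesis
    by (simp add: H riemann_def D[OF V X] D[OF X V] nabla_mult[OF B h Y] algebra_simps)
qed

lemma riemann_cong_left:
  assumes V: "vector_field_near A p V" and X: "vector_field_near A p X"
    and Y: "vector_field_near A p Y" and W: "\<forall>\<^sub>F q in nhds p. V q = W q"
  shows "riemann p V X Y = riemann p W X Y"
proof -
  note XT = vector_field_near_tangent[OF X]
  have "\<forall>\<^sub>F q in nhds p. cov nabla V Y q = cov nabla W Y q"
    using W by eventually_elim (simp add: cov_def)
  from nabla_cong[OF XT cov_field_near[OF V Y] this] nabla_cong[OF XT V W]
  show ?thesis
    using eventually_nhds_x_imp_x[OF W]
    by (simp add: riemann_eq[OF V X Y] riemann_eq[OF vector_field_near_cong[OF V W] X Y])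
qed

lemma riemann_cong_field:
  assumes V: "vector_field_near A p V" and X: "vector_field_near A p X"
    and Y: "vector_field_near A p Y" and Z: "\<forall>\<^sub>F q in nhds p. Y q = Z q"
  shows "riemann p V X Y = riemann p V X Z"
proof -
  have "nabla p (V p) (cov nabla X Y) = nabla p (V p) (cov nabla X Z)"
    if V: "vector_field_near A p V" and X: "vector_field_near A p X" for V X
  proof (rule nabla_cong[OF vector_field_near_tangent[OF V] cov_field_near[OF X Y]])
    have "\<forall>\<^sub>F q in nhds p. \<forall>\<^sub>F r in nhds q. Y r = Z r"
      using Z by (simp add: eventually_eventually)
    then show "\<forall>\<^sub>F q in nhds p. cov nabla X Y q = cov nabla X Z q"
      using eventually_near[OF X] eventually_near[OF Y]
      by eventually_elim (auto simp: cov_def intro: nabla_cong vector_field_near_tangent)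
  qed
  from this[OF V X] this[OF X V]
    nabla_cong[OF vector_field_near_tangent[OF lie_bracket_near[OF V X]] Y Z]
  show ?thesis by (simp add: riemann_def)
qed

text \<open>The three arguments are replaced one at a time, the middle one by antisymmetry.\<close>

lemma riemann_pointwise:
  assumes V: "vector_field_near A p V" "vector_field_near A p V'" "V p = V' p"
    and X: "vector_field_near A p X" "vector_field_near A p X'" "X p = X' p"
    and Y: "vector_field_near A p Y" "vector_field_near A p Y'" "Y p = Y' p"
  shows "riemann p V X Y = riemann p V' X' Y'"
proof
  fix f
  have left: "riemann p V X Y f = riemann p V' X Y f"
    if V: "vector_field_near A p V" "vector_field_near A p V'" "V p = V' p"
      and X: "vector_field_near A p X" for V V' X
  proof (rule tensorial_pointwise[where \<Phi> = "\<lambda>V. riemann p V X Y f", OF _ _ _ V])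
    fix V W assume "vector_field_near A p V" "\<forall>\<^sub>F q in nhds p. V q = W q"
    then show "riemann p V X Y f = riemann p W X Y f"
      by (simp add: riemann_cong_left[OF _ X Y(1)])
  qed (simp_all add: riemann_add_left riemann_mult_left X Y(1))
  have field: "riemann p V' X' Y f = riemann p V' X' Y' f"
  proof (rule tensorial_pointwise[where \<Phi> = "\<lambda>Y. riemann p V' X' Y f", OF _ _ _ Y])
    fix Y Z assume "vector_field_near A p Y" "\<forall>\<^sub>F q in nhds p. Y q = Z q"
    then show "riemann p V' X' Y f = riemann p V' X' Z f"
      by (simp add: riemann_cong_field[OF V(2) X(2)])
  qed (simp_all add: riemann_add_field riemann_mult_field V(2) X(2))
  show "riemann p V X Y f = riemann p V' X' Y' f"
    using left[OF V X(1)] left[OF X V(2)] field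
      riemann_antisym[OF V(2) X(1) Y(1), of f] riemann_antisym[OF V(2) X(2) Y(1), of f] by simp
qed

lemma curvature_eq:
  assumes V: "vector_field_near A p V" and X: "vector_field_near A p X" and Y: "vector_field_near A p Y"
  shows "curvature A nabla p (V p) (X p) (Y p) = riemann p V X Y"
proof -
  have "curvature A nabla p (V p) (X p) (Y p)
      = riemann p (local_ext A p (V p)) (local_ext A p (X p)) (local_ext A p (Y p))"
    by (simp add: curvature_def riemann_def Let_def cov_def)
  also have "\<dots> = riemann p V X Y"
    by (rule riemann_pointwise) (use assms local_ext vector_field_near_tangent in auto)
  finally show ?thesis .
qed

lemma curvature_endo:
  assumes X: "vector_field_near A p X" and Y: "vector_field_near A p Y"
  shows "tangent_endo p (\<lambda>v. curvature A nabla p v (X p) (Y p))"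
  unfolding tangent_endo_def
proof (intro conjI ballI allI)
  fix v assume v: "v \<in> tangent_space A p"
  note V = local_ext[OF v]
  have "(\<lambda>f. nabla p (V p) (cov nabla X Y) f + (- 1) * (nabla p (X p) (cov nabla V Y) f
      + nabla p (lie_bracket A V X p) Y f)) \<in> tangent_space A p" if "vector_field_near A p V" for V
    using that X Y
    by (intro tangent_plus tangent_scale nabla_tangent cov_field_near vector_field_near_tangent
        lie_bracket_near)
  from this[OF V(1)] show "curvature A nabla p v (X p) (Y p) \<in> tangent_space A p"
    using curvature_eq[OF V(1) X Y] V(2) by (simp add: riemann_def algebra_simps)
next
  fix v w a b assume v: "v \<in> tangent_space A p" and w: "w \<in> tangent_space A p"
  note V = local_ext[OF v] and W = local_ext[OF w]
  note aV = vector_field_near_mult[OF smooth_near_const[of _ a] V(1)]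
    and bW = vector_field_near_mult[OF smooth_near_const[of _ b] W(1)]
  show "curvature A nabla p (\<lambda>f. a * v f + b * w f) (X p) (Y p)
    = (\<lambda>f. a * curvature A nabla p v (X p) (Y p) f + b * curvature A nabla p w (X p) (Y p) f)"
    using curvature_eq[OF V(1) X Y] curvature_eq[OF W(1) X Y] V(2) W(2)
      curvature_eq[OF vector_field_near_add[OF aV bW] X Y]
    by (simp add: riemann_add_left[OF aV bW X Y] riemann_mult_left[OF smooth_near_const V(1) X Y]
        riemann_mult_left[OF smooth_near_const W(1) X Y] fun_eq_iff)
qed

end

section \<open>Two comparison lemmas for ordinary differential equations\<close>

text \<open>Gronwall's argument: \<open>S = \<Sum>\<^sub>i u\<^sub>i\<^sup>2\<close> satisfies \<open>\<bar>S'\<bar> \<le> K S\<close>, so \<open>e\<^bsup>-Kt\<^esup> S\<close> is nonincreasing and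
  \<open>e\<^bsup>Kt\<^esup> S\<close> is nondecreasing.\<close>

lemma linear_ode_zero:
  fixes u u' :: "'i::finite \<Rightarrow> real \<Rightarrow> real"
  assumes deriv: "\<And>i t. t \<in> {a<..<b} \<Longrightarrow> (u i has_real_derivative u' i t) (at t)"
    and bound: "\<And>i t. t \<in> {a<..<b} \<Longrightarrow> \<bar>u' i t\<bar> \<le> C * (\<Sum>j\<in>UNIV. \<bar>u j t\<bar>)"
    and s: "s \<in> {a<..<b}" "\<And>i. u i s = 0" and t: "t \<in> {a<..<b}"
  shows "u i t = 0"
proof -
  define S where "S t = (\<Sum>i\<in>UNIV. (u i t)\<^sup>2)" for t
  define S' where "S' t = (\<Sum>i\<in>UNIV. 2 * (u' i t * u i t))" for t
  define K where "K = 2 * \<bar>C\<bar> * real CARD('i)"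
  have S': "(S has_real_derivative S' t) (at t)" if "t \<in> {a<..<b}" for t
    unfolding S_def[abs_def] S'_def
    by (auto intro!: derivative_eq_intros deriv[OF that])
  have S'_bound: "\<bar>S' t\<bar> \<le> K * S t" if t: "t \<in> {a<..<b}" for t
  proof -
    have "\<bar>S' t\<bar> \<le> (\<Sum>i\<in>UNIV. 2 * \<bar>u i t\<bar> * \<bar>u' i t\<bar>)"
      unfolding S'_def by (rule order_trans[OF sum_abs]) (simp add: abs_mult mult_ac)
    also have "\<dots> \<le> (\<Sum>i\<in>UNIV. 2 * \<bar>u i t\<bar> * (\<bar>C\<bar> * (\<Sum>j\<in>UNIV. \<bar>u j t\<bar>)))"
    proof (intro sum_mono mult_left_mono)
      fix i
      have "C * (\<Sum>j\<in>UNIV. \<bar>u j t\<bar>) \<le> \<bar>C\<bar> * (\<Sum>j\<in>UNIV. \<bar>u j t\<bar>)"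
        by (intro mult_right_mono sum_nonneg) auto
      with bound[OF t, of i] show "\<bar>u' i t\<bar> \<le> \<bar>C\<bar> * (\<Sum>j\<in>UNIV. \<bar>u j t\<bar>)" by linarith
    qed auto
    also have "\<dots> = 2 * \<bar>C\<bar> * (\<Sum>j\<in>UNIV. \<bar>u j t\<bar>)\<^sup>2"
      by (simp add: power2_eq_square sum_distrib_left sum_distrib_right mult_ac)
    also have "\<dots> \<le> 2 * \<bar>C\<bar> * (real CARD('i) * S t)"
      using sum_squared_le_sum_of_squares[of "\<lambda>j. \<bar>u j t\<bar>" UNIV]
      by (intro mult_left_mono) (auto simp: S_def mult.commute)
    finally show ?thesis by (simp add: K_def mult_ac)
  qed
  have S0: "S s = 0" using s by (simp add: S_def)
  have "S t \<le> 0"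
  proof (cases "s \<le> t")
    case True
    have "exp (- K * t) * S t \<le> exp (- K * s) * S s"
    proof (rule DERIV_nonpos_imp_nonincreasing[OF True])
      fix r assume "s \<le> r" "r \<le> t"
      then have r: "r \<in> {a<..<b}" using s t by auto
      have "((\<lambda>r. exp (- K * r) * S r) has_real_derivative exp (- K * r) * (S' r - K * S r)) (at r)"
        by (auto intro!: derivative_eq_intros S'[OF r] simp: algebra_simps)
      moreover have "exp (- K * r) * (S' r - K * S r) \<le> 0"
        using S'_bound[OF r] by (intro mult_nonneg_nonpos) auto
      ultimately show "\<exists>y. ((\<lambda>r. exp (- K * r) * S r) has_real_derivative y) (at r) \<and> y \<le> 0" by blast
    qed
    then show ?thesis by (simp add: S0 mult_le_0_iff)
  next
    case False
    have "exp (K * t) * S t \<le> exp (K * s) * S s"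
    proof (rule DERIV_nonneg_imp_nondecreasing[of t s "\<lambda>r. exp (K * r) * S r"])
      fix r assume "t \<le> r" "r \<le> s"
      then have r: "r \<in> {a<..<b}" using s t by auto
      have "((\<lambda>r. exp (K * r) * S r) has_real_derivative exp (K * r) * (S' r + K * S r)) (at r)"
        by (auto intro!: derivative_eq_intros S'[OF r] simp: algebra_simps)
      moreover have "0 \<le> exp (K * r) * (S' r + K * S r)"
        using S'_bound[OF r] by (intro mult_nonneg_nonneg) auto
      ultimately show "\<exists>y. ((\<lambda>r. exp (K * r) * S r) has_real_derivative y) (at r) \<and> 0 \<le> y" by blast
    qed (use False in auto)
    then show ?thesis by (simp add: S0 mult_le_0_iff)
  qed
  moreover have "(u i t)\<^sup>2 \<le> S t" unfolding S_def by (rule member_le_sum) auto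
  ultimately have "(u i t)\<^sup>2 \<le> 0" by linarith
  then show ?thesis by simp
qed

text \<open>If \<open>\<theta> s < 0\<close> then \<open>\<theta>\<close> stays negative and \<open>1 / \<theta>\<close> grows at least at the rate \<open>1 / 2\<close>, so this
  negative quantity would have to reach \<open>0\<close> by the time \<open>s - 2 / \<theta> s\<close>.\<close>

lemma riccati_neg:
  fixes \<theta> \<theta>' :: "real \<Rightarrow> real"
  assumes deriv: "\<And>t. (\<theta> has_real_derivative \<theta>' t) (at t)"
    and riccati: "\<And>t. \<theta>' t < - (\<theta> t)\<^sup>2 / 2"
  shows "\<theta> s \<ge> 0"
proof (rule ccontr)
  assume "\<not> \<theta> s \<ge> 0"
  then have neg: "\<theta> s < 0" by simp
  have "\<theta>' t < 0" for t using riccati[of t] by (rule order_less_le_trans) simp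
  then have dec: "\<theta> t \<le> \<theta> s" if "s \<le> t" for t
    using that deriv by (intro DERIV_nonpos_imp_nonincreasing[of s t \<theta>]) (auto intro: less_imp_le)
  define t where "t = s - 2 / \<theta> s"
  have st: "s \<le> t" using neg by (simp add: t_def divide_nonpos_neg)
  have "inverse (\<theta> s) - s / 2 \<le> inverse (\<theta> t) - t / 2"
  proof (rule DERIV_nonneg_imp_nondecreasing[OF st])
    fix r assume "s \<le> r" "r \<le> t"
    then have r: "\<theta> r < 0" using dec[of r] neg by simp
    have "((\<lambda>r. inverse (\<theta> r) - r / 2) has_real_derivative - \<theta>' r / (\<theta> r)\<^sup>2 - 1 / 2) (at r)"
      using r by (auto intro!: derivative_eq_intros deriv simp: power2_eq_square field_simps)
    moreover have "0 \<le> - \<theta>' r / (\<theta> r)\<^sup>2 - 1 / 2"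
      using r riccati[of r] by (simp add: field_simps)
    ultimately show "\<exists>y. ((\<lambda>r. inverse (\<theta> r) - r / 2) has_real_derivative y) (at r) \<and> 0 \<le> y" by blast
  qed
  moreover have "inverse (\<theta> s) - s / 2 + t / 2 = 0" by (simp add: t_def field_simps)
  moreover have "inverse (\<theta> t) < 0" using dec[OF st] neg by simp
  ultimately show False by linarith
qed

text \<open>Reversing time, \<open>t \<mapsto> - \<theta> (- t)\<close> satisfies the same inequality, so \<open>\<theta>\<close> is identically zero,
  which the strict inequality forbids.\<close>

lemma riccati_blowup:
  fixes \<theta> \<theta>' :: "real \<Rightarrow> real"
  assumes deriv: "\<And>t. (\<theta> has_real_derivative \<theta>' t) (at t)"
    and riccati: "\<And>t. \<theta>' t < - (\<theta> t)\<^sup>2 / 2"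
  shows False
proof -
  have "- \<theta> (- t) \<ge> 0" for t
  proof (rule riccati_neg[of "\<lambda>t. - \<theta> (- t)" "\<lambda>t. \<theta>' (- t)" t])
    show "((\<lambda>t. - \<theta> (- t)) has_real_derivative \<theta>' (- t)) (at t)" for t
      using DERIV_minus[OF DERIV_mirror[THEN iffD1, OF deriv[of "- t"]]] by simp
    show "\<theta>' (- t) < - (- \<theta> (- t))\<^sup>2 / 2" for t using riccati[of "- t"] by simp
  qed
  moreover have "\<theta> t \<ge> 0" for t using deriv riccati by (rule riccati_neg)
  ultimately have zero: "\<theta> t = 0" for t by (metis add.inverse_inverse neg_0_le_iff_le order_antisym)
  then have "\<theta> = (\<lambda>_. 0)" by auto
  then have "\<theta>' 0 = 0" using deriv[of 0] DERIV_unique DERIV_const by metis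
  with riccati[of 0] zero show False by simp
qed

section \<open>Bilinear forms on the screen space of a null vector\<close>

text \<open>In a basis orthonormal for a Lorentzian form with signs \<open>\<epsilon>\<close>, let \<open>\<kappa>\<close> be the components of a null
  vector \<open>k\<close> and \<open>\<beta> i j = g (e\<^sub>i) (B e\<^sub>j)\<close> for an endomorphism \<open>B\<close> that kills \<open>k\<close> and maps into
  \<open>k\<^sup>\<bottom>\<close>. The traces of \<open>B\<close> and \<open>B\<^sup>2\<close> are then those of the map induced on the screen space
  \<open>k\<^sup>\<bottom> / k\<close>, which is a Euclidean plane. The hypothesis \<open>twist\<close> makes the induced map symmetric,
  and a symmetric map \<open>Q\<close> of a plane satisfies \<open>(tr Q)\<^sup>2 \<le> 2 tr Q\<^sup>2\<close>.

  Up to a factor, \<open>k\<close> is \<open>e + n\<close>, where \<open>e\<close> is the timelike basis vector and \<open>n\<close> a spatial unit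
  vector. The screen space is realized as the orthogonal complement of \<open>e\<close> and \<open>n\<close>, with
  orthogonal projection \<open>P\<close>, and the induced map as \<open>Q = P \<beta> P\<close>.\<close>

lemma screen_trace_inequality:
  fixes \<beta> :: "'n::finite \<Rightarrow> 'n \<Rightarrow> real" and \<kappa> \<epsilon> :: "'n \<Rightarrow> real"
  assumes card: "CARD('n) = 4"
    and eps: "\<And>i. \<epsilon> i = (if i = o\<^sub>0 then -1 else 1)"
    and null: "(\<Sum>i\<in>UNIV. \<epsilon> i * (\<kappa> i)\<^sup>2) = 0" and nonzero: "\<kappa> l \<noteq> 0"
    and left: "\<And>j. (\<Sum>i\<in>UNIV. \<kappa> i * \<beta> i j) = 0"
    and right: "\<And>i. (\<Sum>j\<in>UNIV. \<beta> i j * \<kappa> j) = 0"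
    and twist: "\<And>i j l. \<epsilon> i * \<kappa> i * (\<beta> l j - \<beta> j l) + \<epsilon> j * \<kappa> j * (\<beta> i l - \<beta> l i)
      + \<epsilon> l * \<kappa> l * (\<beta> j i - \<beta> i j) = 0"
  shows "(\<Sum>i\<in>UNIV. \<epsilon> i * \<beta> i i)\<^sup>2 \<le> 2 * (\<Sum>i\<in>UNIV. \<Sum>j\<in>UNIV. \<epsilon> i * \<epsilon> j * (\<beta> i j * \<beta> j i))"
proof -
  define e where "e i = (if i = o\<^sub>0 then 1 else 0 :: real)" for i
  have eps': "\<epsilon> i = 1 - 2 * e i" for i by (simp add: eps e_def)
  have e_sum: "(\<Sum>i\<in>UNIV. e i * x i) = x o\<^sub>0" "(\<Sum>i\<in>UNIV. x i * e i) = x o\<^sub>0" for x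
    by (simp_all add: e_def if_distrib[of "\<lambda>y. y * _"] if_distrib[of "(*) _"] cong: if_cong)
  have e_sq: "e i * e i = e i" for i by (simp add: e_def)
  have norm: "(\<Sum>i\<in>UNIV. (\<kappa> i)\<^sup>2) = 2 * (\<kappa> o\<^sub>0)\<^sup>2"
    using null by (simp add: eps' algebra_simps sum_subtractf e_sum sum_distrib_left[symmetric])
  have k0: "\<kappa> o\<^sub>0 \<noteq> 0"
  proof
    assume "\<kappa> o\<^sub>0 = 0"
    then have "(\<Sum>i\<in>UNIV. (\<kappa> i)\<^sup>2) = 0" using norm by simp
    then have "(\<kappa> l)\<^sup>2 = 0" by (subst (asm) sum_nonneg_eq_0_iff) auto
    with nonzero show False by simp
  qed
  \<comment> \<open>The vector \<open>e - n\<close>, as \<open>\<kappa> = \<kappa> o\<^sub>0 (e + n)\<close>; since \<open>\<beta>\<close> kills \<open>e + n\<close>, it sends \<open>m\<close> to \<open>2 \<beta> e\<close>.\<close>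
  define m where "m i = 2 * e i - \<kappa> i / \<kappa> o\<^sub>0" for i
  define w where "w i = \<beta> i o\<^sub>0" for i
  define r where "r j = \<beta> o\<^sub>0 j" for j
  define s where "s = \<beta> o\<^sub>0 o\<^sub>0"
  have m0: "m o\<^sub>0 = 1" using k0 by (simp add: m_def e_def)
  have wr0: "w o\<^sub>0 = s" "r o\<^sub>0 = s" by (simp_all add: w_def r_def s_def)
  have mm: "(\<Sum>i\<in>UNIV. m i * m i) = 2"
  proof -
    have "(\<Sum>i\<in>UNIV. m i * m i) = (\<Sum>i\<in>UNIV. 4 * e i - 4 * (e i * (\<kappa> i / \<kappa> o\<^sub>0)) + (\<kappa> i)\<^sup>2 / (\<kappa> o\<^sub>0)\<^sup>2)"
      by (intro sum.cong) (auto simp: m_def e_def power2_eq_square algebra_simps)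
    also have "\<dots> = 4 - 4 + 2"
      using k0 e_sum(1)[of "\<lambda>_. 1"]
      by (simp add: sum.distrib sum_subtractf sum_distrib_left[symmetric] e_sum norm
          sum_divide_distrib[symmetric])
    finally show ?thesis by simp
  qed
  have \<beta>m: "(\<Sum>j\<in>UNIV. \<beta> i j * m j) = 2 * w i" for i
  proof -
    have "(\<Sum>j\<in>UNIV. \<beta> i j * m j) = 2 * (\<Sum>j\<in>UNIV. \<beta> i j * e j) - (\<Sum>j\<in>UNIV. \<beta> i j * \<kappa> j) / \<kappa> o\<^sub>0"
      by (simp add: m_def algebra_simps sum_subtractf sum_distrib_left sum_divide_distrib)
    then show ?thesis by (simp add: right e_sum w_def)
  qed
  have m\<beta>: "(\<Sum>i\<in>UNIV. m i * \<beta> i j) = 2 * r j" for j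
  proof -
    have "(\<Sum>i\<in>UNIV. m i * \<beta> i j) = 2 * (\<Sum>i\<in>UNIV. e i * \<beta> i j) - (\<Sum>i\<in>UNIV. \<kappa> i * \<beta> i j) / \<kappa> o\<^sub>0"
      by (simp add: m_def algebra_simps sum_subtractf sum_distrib_left sum_divide_distrib)
    then show ?thesis by (simp add: left e_sum r_def)
  qed
  have mw: "(\<Sum>i\<in>UNIV. m i * w i) = 2 * s" and rm: "(\<Sum>j\<in>UNIV. r j * m j) = 2 * s"
    using m\<beta>[of o\<^sub>0] \<beta>m[of o\<^sub>0] by (simp_all add: w_def r_def s_def)
  \<comment> \<open>\<open>P \<beta> P\<close> written out, with \<open>\<beta> n\<close> and \<open>n\<^sup>T \<beta>\<close> eliminated in favour of row and column \<open>o\<^sub>0\<close>.\<close>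
  define Q where "Q i j = \<beta> i j - w i * m j - m i * r j + s * m i * m j" for i j
  have Qm: "(\<Sum>j\<in>UNIV. Q i j * m j) = 0" for i
  proof -
    have "(\<Sum>j\<in>UNIV. Q i j * m j) = (\<Sum>j\<in>UNIV. \<beta> i j * m j) - w i * (\<Sum>j\<in>UNIV. m j * m j)
        - m i * (\<Sum>j\<in>UNIV. r j * m j) + s * m i * (\<Sum>j\<in>UNIV. m j * m j)"
      by (simp add: Q_def algebra_simps sum_subtractf sum.distrib sum_distrib_left)
    then show ?thesis by (simp add: \<beta>m mm rm)
  qed
  have mQ: "(\<Sum>i\<in>UNIV. m i * Q i j) = 0" for j
  proof -
    have "(\<Sum>i\<in>UNIV. m i * Q i j) = (\<Sum>i\<in>UNIV. m i * \<beta> i j) - m j * (\<Sum>i\<in>UNIV. m i * w i)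
        - r j * (\<Sum>i\<in>UNIV. m i * m i) + s * m j * (\<Sum>i\<in>UNIV. m i * m i)"
      by (simp add: Q_def algebra_simps sum_subtractf sum.distrib sum_distrib_left)
    then show ?thesis by (simp add: m\<beta> mm mw)
  qed
  have Q0: "Q i o\<^sub>0 = 0" for i by (simp add: Q_def m0 wr0 w_def[symmetric])
  have trQ: "(\<Sum>i\<in>UNIV. Q i i) = (\<Sum>i\<in>UNIV. \<epsilon> i * \<beta> i i)"
  proof -
    have "(\<Sum>i\<in>UNIV. Q i i) = (\<Sum>i\<in>UNIV. \<beta> i i) - (\<Sum>i\<in>UNIV. m i * w i) - (\<Sum>i\<in>UNIV. r i * m i)
        + s * (\<Sum>i\<in>UNIV. m i * m i)"
      by (simp add: Q_def algebra_simps sum_subtractf sum.distrib sum_distrib_left)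
    moreover have "(\<Sum>i\<in>UNIV. \<epsilon> i * \<beta> i i) = (\<Sum>i\<in>UNIV. \<beta> i i) - 2 * (\<Sum>i\<in>UNIV. e i * \<beta> i i)"
      by (simp add: eps' algebra_simps sum_subtractf sum_distrib_left)
    ultimately show ?thesis by (simp add: mm mw rm e_sum s_def)
  qed
  have sym: "Q i j = Q j i" for i j
  proof -
    have a: "\<epsilon> i * \<kappa> i = - \<kappa> o\<^sub>0 * m i" for i
      using k0 by (cases "i = o\<^sub>0") (simp_all add: eps' m_def e_def)
    have "- \<kappa> o\<^sub>0 * (m i * (r j - w j) + m j * (w i - r i) + m o\<^sub>0 * (\<beta> j i - \<beta> i j)) = 0"
      using twist[of i o\<^sub>0 j] unfolding a by (simp add: w_def r_def algebra_simps)
    then have "m i * (r j - w j) + m j * (w i - r i) + (\<beta> j i - \<beta> i j) = 0"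
      using k0 m0 by simp
    then show ?thesis by (simp add: Q_def algebra_simps)
  qed
  have QQ: "(\<Sum>i\<in>UNIV. \<Sum>j\<in>UNIV. Q i j * Q j i)
      = (\<Sum>i\<in>UNIV. \<Sum>j\<in>UNIV. \<epsilon> i * \<epsilon> j * (\<beta> i j * \<beta> j i))"
  proof -
    have "(\<Sum>i\<in>UNIV. \<Sum>j\<in>UNIV. Q i j * Q j i) = (\<Sum>i\<in>UNIV. \<Sum>j\<in>UNIV. Q i j * \<beta> j i)
        - (\<Sum>i\<in>UNIV. \<Sum>j\<in>UNIV. m i * Q i j * w j) - (\<Sum>i\<in>UNIV. r i * (\<Sum>j\<in>UNIV. Q i j * m j))
        + (\<Sum>i\<in>UNIV. s * m i * (\<Sum>j\<in>UNIV. Q i j * m j))"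
      by (subst (2) Q_def) (simp add: algebra_simps sum_subtractf sum.distrib sum_distrib_left)
    also have "(\<Sum>i\<in>UNIV. \<Sum>j\<in>UNIV. m i * Q i j * w j) = (\<Sum>j\<in>UNIV. (\<Sum>i\<in>UNIV. m i * Q i j) * w j)"
      by (subst sum.swap) (simp add: sum_distrib_right)
    finally have 1: "(\<Sum>i\<in>UNIV. \<Sum>j\<in>UNIV. Q i j * Q j i) = (\<Sum>i\<in>UNIV. \<Sum>j\<in>UNIV. Q i j * \<beta> j i)"
      by (simp add: Qm mQ)
    have wr: "(\<Sum>i\<in>UNIV. w i * (2 * r i)) = 2 * (\<Sum>i\<in>UNIV. r i * w i)"
      "(\<Sum>i\<in>UNIV. r i * (2 * w i)) = 2 * (\<Sum>i\<in>UNIV. r i * w i)"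
      by (simp_all add: sum_distrib_left mult_ac)
    have "(\<Sum>i\<in>UNIV. \<Sum>j\<in>UNIV. Q i j * \<beta> j i) = (\<Sum>i\<in>UNIV. \<Sum>j\<in>UNIV. \<beta> i j * \<beta> j i)
        - (\<Sum>i\<in>UNIV. w i * (\<Sum>j\<in>UNIV. m j * \<beta> j i)) - (\<Sum>i\<in>UNIV. \<Sum>j\<in>UNIV. r j * (\<beta> j i * m i))
        + (\<Sum>i\<in>UNIV. s * m i * (\<Sum>j\<in>UNIV. m j * \<beta> j i))"
      by (simp add: Q_def algebra_simps sum_subtractf sum.distrib sum_distrib_left)
    also have "(\<Sum>i\<in>UNIV. \<Sum>j\<in>UNIV. r j * (\<beta> j i * m i)) = (\<Sum>j\<in>UNIV. r j * (\<Sum>i\<in>UNIV. \<beta> j i * m i))"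
      by (subst sum.swap) (simp add: sum_distrib_left)
    also have "(\<Sum>i\<in>UNIV. s * m i * (\<Sum>j\<in>UNIV. m j * \<beta> j i)) = 2 * s * (\<Sum>i\<in>UNIV. r i * m i)"
      by (simp add: m\<beta> sum_distrib_left mult_ac)
    finally have 2: "(\<Sum>i\<in>UNIV. \<Sum>j\<in>UNIV. Q i j * \<beta> j i)
        = (\<Sum>i\<in>UNIV. \<Sum>j\<in>UNIV. \<beta> i j * \<beta> j i) - 4 * (\<Sum>i\<in>UNIV. r i * w i) + 4 * s * s"
      by (simp only: m\<beta> \<beta>m rm wr)
    have "(\<Sum>i\<in>UNIV. \<Sum>j\<in>UNIV. \<epsilon> i * \<epsilon> j * (\<beta> i j * \<beta> j i))
        = (\<Sum>i\<in>UNIV. \<epsilon> i * (\<Sum>j\<in>UNIV. \<beta> i j * \<beta> j i - 2 * (e j * (\<beta> i j * \<beta> j i))))"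
      by (simp add: eps' sum_distrib_left algebra_simps)
    also have "\<dots> = (\<Sum>i\<in>UNIV. (\<Sum>j\<in>UNIV. \<beta> i j * \<beta> j i) - 2 * (w i * r i)
        - 2 * (e i * ((\<Sum>j\<in>UNIV. \<beta> i j * \<beta> j i) - 2 * (w i * r i))))"
      by (simp add: sum_subtractf sum_distrib_left[symmetric] e_sum eps' w_def r_def algebra_simps)
    also have "\<dots> = (\<Sum>i\<in>UNIV. \<Sum>j\<in>UNIV. \<beta> i j * \<beta> j i) - 4 * (\<Sum>i\<in>UNIV. r i * w i) + 4 * s * s"
      by (simp add: sum_subtractf sum_distrib_left[symmetric] e_sum wr0)
        (simp add: w_def r_def mult_ac)
    finally show ?thesis using 1 2 by simp
  qed
  define n where "n i = e i - m i" for i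
  define P where "P i j = (if i = j then 1 else 0) - e i * e j - n i * n j" for i j
  have nn: "(\<Sum>i\<in>UNIV. n i * n i) = 1" and en: "(\<Sum>i\<in>UNIV. e i * n i) = 0"
  proof -
    show en: "(\<Sum>i\<in>UNIV. e i * n i) = 0" by (simp add: e_sum n_def m0) (simp add: e_def)
    have "(\<Sum>i\<in>UNIV. n i * n i) = (\<Sum>i\<in>UNIV. m i * m i) - 2 * (\<Sum>i\<in>UNIV. e i * m i) + (\<Sum>i\<in>UNIV. e i * e i)"
      by (simp add: n_def algebra_simps sum_subtractf sum.distrib sum_distrib_left)
    then show "(\<Sum>i\<in>UNIV. n i * n i) = 1" by (simp add: mm e_sum m0) (simp add: e_def)
  qed
  have QP: "(\<Sum>i\<in>UNIV. \<Sum>j\<in>UNIV. Q i j * P i j) = (\<Sum>i\<in>UNIV. Q i i)"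
  proof (rule sum.cong)
    fix i
    have "(\<Sum>j\<in>UNIV. Q i j * P i j) = (\<Sum>j\<in>UNIV. Q i j * (if i = j then 1 else 0))
        - e i * (\<Sum>j\<in>UNIV. Q i j * e j) - n i * ((\<Sum>j\<in>UNIV. Q i j * e j) - (\<Sum>j\<in>UNIV. Q i j * m j))"
      by (simp add: P_def n_def[of "_ :: 'n"] algebra_simps sum_subtractf sum.distrib sum_distrib_left)
    then show "(\<Sum>j\<in>UNIV. Q i j * P i j) = Q i i"
      by (simp add: e_sum Q0 Qm if_distrib[of "(*) _"] cong: if_cong)
  qed simp
  have PP: "(\<Sum>i\<in>UNIV. \<Sum>j\<in>UNIV. P i j * P i j) = 2"
  proof -
    have Px: "(\<Sum>j\<in>UNIV. x j * P i j)
        = x i - e i * (\<Sum>j\<in>UNIV. x j * e j) - n i * (\<Sum>j\<in>UNIV. x j * n j)" for x i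
      by (simp add: P_def algebra_simps sum_subtractf sum.distrib sum_distrib_left
          if_distrib[of "(*) _"] cong: if_cong)
    have "n o\<^sub>0 = 0" "e o\<^sub>0 = 1" by (simp_all add: n_def m0 e_def)
    then have "(\<Sum>j\<in>UNIV. P i j * e j) = 0" "(\<Sum>j\<in>UNIV. P i j * n j) = 0" for i
      using Px[of e i] Px[of n i] by (simp_all add: nn e_sum mult.commute[of "P _ _"])
    then have "(\<Sum>j\<in>UNIV. P i j * P i j) = 1 - e i * e i - n i * n i" for i
      by (simp add: Px) (simp add: P_def)
    then show ?thesis
      using card by (simp add: sum_subtractf nn e_sum) (simp add: e_def)
  qed
  \<comment> \<open>The trace-free part of \<open>Q\<close> on the screen is \<open>Q - (t / 2) P\<close>; its squared norm is
    \<open>\<bar>Q\<bar>\<^sup>2 - t\<^sup>2 / 2\<close> because \<open>P\<close> has squared norm \<open>2\<close>.\<close>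
  define t where "t = (\<Sum>i\<in>UNIV. Q i i)"
  have "0 \<le> (\<Sum>i\<in>UNIV. \<Sum>j\<in>UNIV. (Q i j - t / 2 * P i j)\<^sup>2)"
    by (intro sum_nonneg) auto
  also have "\<dots> = (\<Sum>i\<in>UNIV. \<Sum>j\<in>UNIV. Q i j * Q i j) - t * (\<Sum>i\<in>UNIV. \<Sum>j\<in>UNIV. Q i j * P i j)
      + t\<^sup>2 / 4 * (\<Sum>i\<in>UNIV. \<Sum>j\<in>UNIV. P i j * P i j)"
    by (simp add: power2_eq_square algebra_simps sum_subtractf sum.distrib sum_distrib_left)
  also have "\<dots> = (\<Sum>i\<in>UNIV. \<Sum>j\<in>UNIV. Q i j * Q i j) - t\<^sup>2 / 2"
    by (simp add: QP PP t_def[symmetric] power2_eq_square)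
  finally have "t\<^sup>2 \<le> 2 * (\<Sum>i\<in>UNIV. \<Sum>j\<in>UNIV. Q i j * Q j i)"
    by (simp add: sym[of _ _])
  then show ?thesis by (simp add: QQ trQ t_def)
qed

section \<open>Null geodesic fields and their twist\<close>

locale null_geodesic = lorentzian A g nabla
  for A :: "('a::{t2_space, second_countable_topology}, 'n::finite) chart set" and g nabla +
  fixes k :: "'a vfield"
  assumes null: "null_field A g k" and geodesic: "cov nabla k k p = (\<lambda>_. 0)"
begin

lemma k_field: "vector_field_on A UNIV k"
  and k_nonzero: "k p \<noteq> (\<lambda>_. 0)" and k_null: "g p (k p) (k p) = 0"
  using null by (auto simp: null_field_def)

lemma k_near: "vector_field_near A p k"
  using k_field by (rule vector_field_nearI) simp

lemma k_tangent: "k p \<in> tangent_space A p"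
  using k_near by (rule vector_field_near_tangent)

lemma nabla_k_k: "nabla p (k p) k = (\<lambda>_. 0)"
  using geodesic by (simp add: cov_def)

lemma nabla_k_tangent: "v \<in> tangent_space A p \<Longrightarrow> nabla p v k \<in> tangent_space A p"
  by (rule nabla_tangent[OF _ k_near])

lemma nabla_k_orthogonal:
  assumes v: "v \<in> tangent_space A p"
  shows "g p (nabla p v k) (k p) = 0"
  using nabla_metric[OF v k_near k_near] g_sym[OF nabla_k_tangent[OF v] k_tangent]
  by (simp add: k_null tangent_const[OF v])

lemma curl_k: "v \<in> tangent_space A p \<Longrightarrow> curl k p (k p) v = 0"
  by (simp add: curl_def nabla_k_k g_zero_left nabla_k_orthogonal)

text \<open>In terms of the Lie derivative this says \<open>L\<^sub>k (g(k, \<cdot>)) = 0\<close>, and the next lemma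
  \<open>L\<^sub>k (d(g(k, \<cdot>))) = 0\<close>: both forms vanish upon contraction with \<open>k\<close>, the first as \<open>k\<close> is null
  and the second as \<open>k\<close> is moreover geodesic.\<close>

lemma lie_derivative_flat:
  assumes X: "vector_field_near A p X"
  shows "k p (\<lambda>q. g q (k q) (X q)) = g p (k p) (lie_bracket A k X p)"
proof -
  note T = k_tangent[of p] vector_field_near_tangent[OF X]
  have "g p (k p) (lie_bracket A k X p) = g p (k p) (nabla p (k p) X) - g p (k p) (nabla p (X p) k)"
    by (subst lie_bracket_eq[OF k_near X], rule g_diff_right) (intro nabla_tangent T X k_near)+
  then show ?thesis
    using nabla_k_orthogonal[OF T(2)] g_sym[OF nabla_k_tangent[OF T(2)] T(1)]
    by (simp add: nabla_metric[OF T(1) k_near X] nabla_k_k g_zero_left T(2))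
qed

lemma lie_derivative_curl:
  assumes X: "vector_field_near A p X" and Y: "vector_field_near A p Y"
  shows "k p (\<lambda>q. curl k q (X q) (Y q))
    = curl k p (lie_bracket A k X p) (Y p) + curl k p (X p) (lie_bracket A k Y p)"
proof -
  have zero: "v (\<lambda>q. curl k q (k q) (X q)) = 0"
    if v: "v \<in> tangent_space A p" and X: "vector_field_near A p X" for v X
  proof -
    have "\<forall>\<^sub>F q in nhds p. curl k q (k q) (X q) = 0"
      using eventually_near[OF X] by eventually_elim (simp add: curl_k vector_field_near_tangent)
    then show ?thesis
      using tangent_cong[OF v curl_smooth_near[OF k_near k_near X], of "\<lambda>_. 0"] tangent_const[OF v]
      by simp
  qed
  note T = vector_field_near_tangent[OF X] vector_field_near_tangent[OF Y]
    vector_field_near_tangent[OF lie_bracket_near[OF X Y]]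
  show ?thesis
    using curl_closed[OF k_near k_near X Y] zero[OF T(1) Y] zero[OF T(2) X] curl_k[OF T(3)]
      curl_antisym[of k p "lie_bracket A X Y p"] curl_antisym[of k p "X p" "lie_bracket A k Y p"]
    by simp
qed

text \<open>For \<open>\<alpha> = g(k, \<cdot>)\<close> this is the 3-form \<open>\<alpha> \<and> d\<alpha>\<close>. It vanishes at \<open>p\<close> iff \<open>d\<alpha>\<close> vanishes on
  \<open>k\<^sup>\<bottom>\<close>, which is to say that \<open>\<nabla>k\<close> induces a symmetric map of the screen space.\<close>

definition twist :: "'a \<Rightarrow> 'a tangent \<Rightarrow> 'a tangent \<Rightarrow> 'a tangent \<Rightarrow> real" where
  "twist p x y z = g p (k p) x * curl k p y z + g p (k p) y * curl k p z x + g p (k p) z * curl k p x y"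

definition twist_free :: "'a \<Rightarrow> bool" where
  "twist_free p \<longleftrightarrow> (\<forall>x\<in>tangent_space A p. \<forall>y\<in>tangent_space A p. \<forall>z\<in>tangent_space A p.
     twist p x y z = 0)"

lemma twist_cyclic: "twist p x y z = twist p y z x"
  by (simp add: twist_def)

lemma twist_repeat: "twist p x x z = 0"
  using curl_antisym[of k p x x] curl_antisym[of k p x z] by (simp add: twist_def algebra_simps)

lemma twist_lin:
  assumes "u \<in> tangent_space A p" "v \<in> tangent_space A p" "y \<in> tangent_space A p" "z \<in> tangent_space A p"
  shows "twist p (\<lambda>f. a * u f + b * v f) y z = a * twist p u y z + b * twist p v y z"
  using assms
  by (simp add: twist_def g_lin_right k_tangent curl_lin_left[OF k_near] curl_lin_right[OF k_near] algebra_simps)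

lemma twist_zero:
  "y \<in> tangent_space A p \<Longrightarrow> z \<in> tangent_space A p \<Longrightarrow> twist p (\<lambda>_. 0) y z = 0"
  using twist_lin[OF tangent_zero tangent_zero, of y p z 0 0] by simp

lemma twist_sum:
  assumes v: "\<And>i. v i \<in> tangent_space A p" and yz: "y \<in> tangent_space A p" "z \<in> tangent_space A p"
  shows "twist p (\<lambda>f. \<Sum>i\<in>I. c i * v i f) y z = (\<Sum>i\<in>I. c i * twist p (v i) y z)"
proof (induction I rule: infinite_finite_induct)
  case (insert i I)
  have "(\<lambda>f. \<Sum>i\<in>I. c i * v i f) \<in> tangent_space A p"
    by (rule tangent_sum_closed) (rule v)
  from twist_lin[OF v[of i] this yz, of "c i" 1] insert show ?case by simp
qed (simp_all add: twist_zero yz)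

lemma twist_smooth_near:
  assumes "vector_field_near A p X" "vector_field_near A p Y" "vector_field_near A p Z"
  shows "smooth_near A p (\<lambda>q. twist q (X q) (Y q) (Z q))"
  unfolding twist_def
  by (intro smooth_near_add smooth_near_mult g_smooth_near curl_smooth_near k_near assms)

lemma lie_derivative_twist:
  assumes X: "vector_field_near A p X" and Y: "vector_field_near A p Y" and Z: "vector_field_near A p Z"
  shows "k p (\<lambda>q. twist q (X q) (Y q) (Z q))
    = twist p (lie_bracket A k X p) (Y p) (Z p) + twist p (X p) (lie_bracket A k Y p) (Z p)
      + twist p (X p) (Y p) (lie_bracket A k Z p)"
proof -
  have D: "k p (\<lambda>q. g q (k q) (X q) * curl k q (Y q) (Z q))
      = g p (k p) (lie_bracket A k X p) * curl k p (Y p) (Z p)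
      + g p (k p) (X p) * (curl k p (lie_bracket A k Y p) (Z p) + curl k p (Y p) (lie_bracket A k Z p))"
    if "vector_field_near A p X" "vector_field_near A p Y" "vector_field_near A p Z" for X Y Z
    using tangent_mult[OF k_tangent g_smooth_near[OF k_near that(1)] curl_smooth_near[OF k_near that(2,3)]]
    by (simp add: lie_derivative_flat that lie_derivative_curl)
  note s = smooth_near_mult[OF g_smooth_near[OF k_near X] curl_smooth_near[OF k_near Y Z]]
    smooth_near_mult[OF g_smooth_near[OF k_near Y] curl_smooth_near[OF k_near Z X]]
    smooth_near_mult[OF g_smooth_near[OF k_near Z] curl_smooth_near[OF k_near X Y]]
  show ?thesis
    unfolding twist_def tangent_add[OF k_tangent smooth_near_add[OF s(1,2)] s(3)]
      tangent_add[OF k_tangent s(1,2)] D[OF X Y Z] D[OF Y Z X] D[OF Z X Y]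
    by (simp add: algebra_simps)
qed

lemma twist_free_coord:
  assumes U: "(U, \<phi>) \<in> A" "q \<in> U"
    and zero: "\<And>i j l. twist q (coord_field U \<phi> i q) (coord_field U \<phi> j q) (coord_field U \<phi> l q) = 0"
  shows "twist_free q"
  unfolding twist_free_def
proof (intro ballI)
  fix x y z assume x: "x \<in> tangent_space A q" and y: "y \<in> tangent_space A q" and z: "z \<in> tangent_space A q"
  note E = coord_field_tangent[OF U]
  have ex: "twist q x y z = 0"
    if x: "x \<in> tangent_space A q" and yz: "y \<in> tangent_space A q" "z \<in> tangent_space A q"
      and 0: "\<And>i. twist q (coord_field U \<phi> i q) y z = 0" for x y z
    by (subst tangent_coord_expansion[OF U x], subst twist_sum[OF E yz]) (simp add: 0)
  have "twist q (coord_field U \<phi> i q) (coord_field U \<phi> j q) z = 0" for i j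
    using ex[OF z E E, of i j] zero twist_cyclic by metis
  then have "twist q (coord_field U \<phi> i q) y z = 0" for i
    using ex[OF y z E, of i] twist_cyclic by metis
  then show "twist q x y z = 0" by (rule ex[OF x y z])
qed

text \<open>The 1-form dual to \<open>k\<close> and its exterior derivative are invariant under the flow of \<open>k\<close>, hence
  so is the 3-form \<open>twist\<close>. In a coordinate frame this says that its components along an integral
  curve solve a homogeneous linear system.\<close>

lemma twist_free_local:
  assumes \<gamma>: "integral_curve A k \<gamma>"
  shows "\<forall>\<^sub>F t in at s. twist_free (\<gamma> s) = twist_free (\<gamma> t)"
proof -
  obtain U \<phi> where U: "(U, \<phi>) \<in> A" "\<gamma> s \<in> U" by (rule chart_at)
  define E where "E = coord_field U \<phi>"
  define x where "x i = (\<lambda>r. \<phi> r $ i)" for i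
  define L where "L m i q = lie_bracket A k (E i) q (x m)" for m i q
  have E_field: "vector_field_on A U (E i)" for i
    unfolding E_def by (rule coord_field_vector_field[OF U(1)])
  have E_near: "q \<in> U \<Longrightarrow> vector_field_near A q (E i)" for i q
    by (rule vector_field_nearI[OF E_field])
  have E_tangent: "q \<in> U \<Longrightarrow> E i q \<in> tangent_space A q" for i q
    by (rule vector_field_tangent[OF E_field])
  have bracket: "lie_bracket A k (E i) q = (\<lambda>f. \<Sum>m\<in>UNIV. L m i q * E m q f)" if q: "q \<in> U" for i q
    unfolding L_def E_def x_def
    by (rule tangent_coord_expansion[OF U(1) q])
      (intro vector_field_near_tangent lie_bracket_near k_near E_near[unfolded E_def] q)
  have cont: "isCont \<gamma> t" for t
    using \<gamma> by (simp add: integral_curve_def continuous_on_eq_continuous_at)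
  have L_near: "smooth_near A q (L m i)" if q: "q \<in> U" for m i q
    unfolding L_def[abs_def] x_def
    by (rule vector_field_near_smooth[OF lie_bracket_near[OF k_near E_near[OF q]]
          smooth_nearI[OF smooth_fun_on_coord[OF U(1)] q]])
  have deriv: "((\<lambda>t. h (\<gamma> t)) has_real_derivative k (\<gamma> t) h) (at t)" if "smooth_near A (\<gamma> t) h" for t h
    using \<gamma> that by (simp add: integral_curve_def)
  have "\<forall>\<^sub>F t in nhds s. \<gamma> t \<in> U \<and> (\<forall>m i. \<bar>L m i (\<gamma> t)\<bar> < \<bar>L m i (\<gamma> s)\<bar> + 1)"
  proof (intro eventually_conj eventually_all_finite)
    have "(\<gamma> \<longlongrightarrow> \<gamma> s) (nhds s)" using cont[of s] by (simp add: continuous_at tendsto_at_iff_tendsto_nhds)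
    then show "\<forall>\<^sub>F t in nhds s. \<gamma> t \<in> U"
      using topological_tendstoD[of \<gamma> "\<gamma> s" "nhds s" U] chart_open[OF U(1)] U(2) by blast
    fix m i
    have "isCont (\<lambda>t. \<bar>L m i (\<gamma> t)\<bar>) s"
      using DERIV_isCont[OF deriv[OF L_near[OF U(2)]]] by (intro continuous_rabs)
    then have "((\<lambda>t. \<bar>L m i (\<gamma> t)\<bar>) \<longlongrightarrow> \<bar>L m i (\<gamma> s)\<bar>) (nhds s)"
      unfolding isCont_def
      by (rule tendsto_at_iff_tendsto_nhds[of "\<lambda>t. \<bar>L m i (\<gamma> t)\<bar>", THEN iffD1])
    then show "\<forall>\<^sub>F t in nhds s. \<bar>L m i (\<gamma> t)\<bar> < \<bar>L m i (\<gamma> s)\<bar> + 1"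
      by (rule order_tendstoD) simp
  qed
  then obtain e where e: "e > 0" and near: "\<And>t. dist t s < e \<Longrightarrow> \<gamma> t \<in> U"
      "\<And>t m i. dist t s < e \<Longrightarrow> \<bar>L m i (\<gamma> t)\<bar> < \<bar>L m i (\<gamma> s)\<bar> + 1"
    unfolding eventually_nhds_metric by blast
  \<comment> \<open>A bound, near \<open>s\<close>, for all the coefficients of the system.\<close>
  define C where "C = (\<Sum>m\<in>UNIV. \<Sum>i\<in>UNIV. \<bar>L m i (\<gamma> s)\<bar> + 1)"
  have L_bound: "\<bar>L m i (\<gamma> t)\<bar> \<le> C" if "dist t s < e" for m i t
  proof -
    have "\<bar>L m i (\<gamma> s)\<bar> + 1 \<le> (\<Sum>i\<in>UNIV. \<bar>L m i (\<gamma> s)\<bar> + 1)"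
      by (rule member_le_sum) auto
    also have "\<dots> \<le> C"
      unfolding C_def by (rule member_le_sum[of m UNIV "\<lambda>m. \<Sum>i\<in>UNIV. \<bar>L m i (\<gamma> s)\<bar> + 1"]) (auto intro: sum_nonneg)
    finally show ?thesis using near(2)[OF that, of m i] by linarith
  qed
  define u where "u = (\<lambda>(i, j, l) t. twist (\<gamma> t) (E i (\<gamma> t)) (E j (\<gamma> t)) (E l (\<gamma> t)))"
  define u' where "u' = (\<lambda>(i, j, l) t.
      (\<Sum>m\<in>UNIV. L m i (\<gamma> t) * u (m, j, l) t) + (\<Sum>m\<in>UNIV. L m j (\<gamma> t) * u (i, m, l) t)
      + (\<Sum>m\<in>UNIV. L m l (\<gamma> t) * u (i, j, m) t))"
  have dist: "dist t s < e" if "t \<in> {s - e<..<s + e}" for t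
    using that by (auto simp: dist_real_def)
  have u_deriv: "(u I has_real_derivative u' I t) (at t)" if t: "t \<in> {s - e<..<s + e}" for I t
  proof -
    obtain i j l where I: "I = (i, j, l)" by (cases I)
    have q: "\<gamma> t \<in> U" by (rule near(1)[OF dist[OF t]])
    have "k (\<gamma> t) (\<lambda>q. twist q (E i q) (E j q) (E l q)) = u' I t"
      unfolding lie_derivative_twist[OF E_near[OF q] E_near[OF q] E_near[OF q]] I u'_def u_def prod.case
    proof (intro arg_cong2[of _ _ _ _ "(+)"])
      show "twist (\<gamma> t) (lie_bracket A k (E i) (\<gamma> t)) (E j (\<gamma> t)) (E l (\<gamma> t))
        = (\<Sum>m\<in>UNIV. L m i (\<gamma> t) * twist (\<gamma> t) (E m (\<gamma> t)) (E j (\<gamma> t)) (E l (\<gamma> t)))"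
        unfolding bracket[OF q] by (intro twist_sum E_tangent q)
      show "twist (\<gamma> t) (E i (\<gamma> t)) (lie_bracket A k (E j) (\<gamma> t)) (E l (\<gamma> t))
        = (\<Sum>m\<in>UNIV. L m j (\<gamma> t) * twist (\<gamma> t) (E i (\<gamma> t)) (E m (\<gamma> t)) (E l (\<gamma> t)))"
        unfolding bracket[OF q] twist_cyclic[of _ "E i (\<gamma> t)"] by (intro twist_sum E_tangent q)
      show "twist (\<gamma> t) (E i (\<gamma> t)) (E j (\<gamma> t)) (lie_bracket A k (E l) (\<gamma> t))
        = (\<Sum>m\<in>UNIV. L m l (\<gamma> t) * twist (\<gamma> t) (E i (\<gamma> t)) (E j (\<gamma> t)) (E m (\<gamma> t)))"
        unfolding bracket[OF q] twist_cyclic[of _ _ _ "\<lambda>f. \<Sum>m\<in>UNIV. _ m f"]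
          twist_cyclic[of _ "E i (\<gamma> t)" "E j (\<gamma> t)"] twist_cyclic[of _ "E j (\<gamma> t)" _ "E i (\<gamma> t)"]
        by (intro twist_sum E_tangent q)
    qed
    then show ?thesis
      using deriv[OF twist_smooth_near[OF E_near[OF q] E_near[OF q] E_near[OF q]], of i j l]
      by (simp add: I u_def)
  qed
  have u_bound: "\<bar>u' I t\<bar> \<le> 3 * C * (\<Sum>J\<in>UNIV. \<bar>u J t\<bar>)" if t: "t \<in> {s - e<..<s + e}" for I t
  proof -
    obtain i j l where I: "I = (i, j, l)" by (cases I)
    have C: "C \<ge> 0" unfolding C_def by (intro sum_nonneg) auto
    have part: "\<bar>\<Sum>m\<in>UNIV. L m i (\<gamma> t) * u (F m) t\<bar> \<le> C * (\<Sum>J\<in>UNIV. \<bar>u J t\<bar>)"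
      if F: "inj F" for F :: "'n \<Rightarrow> 'n \<times> 'n \<times> 'n" and i
    proof -
      have "\<bar>\<Sum>m\<in>UNIV. L m i (\<gamma> t) * u (F m) t\<bar> \<le> (\<Sum>m\<in>UNIV. C * \<bar>u (F m) t\<bar>)"
        by (rule order_trans[OF sum_abs])
          (auto simp: abs_mult intro!: sum_mono mult_right_mono L_bound dist[OF t])
      also have "\<dots> = C * (\<Sum>J\<in>range F. \<bar>u J t\<bar>)"
        using F by (simp add: sum.reindex sum_distrib_left)
      also have "\<dots> \<le> C * (\<Sum>J\<in>UNIV. \<bar>u J t\<bar>)"
        by (intro mult_left_mono sum_mono2 C) auto
      finally show ?thesis .
    qed
    have "inj (\<lambda>m. (m, j, l))" "inj (\<lambda>m. (i, m, l))" "inj (\<lambda>m. (i, j, m))"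
      by (auto intro: injI)
    from part[OF this(1), of i] part[OF this(2), of j] part[OF this(3), of l]
    show ?thesis unfolding I u'_def by simp
  qed
  have u_iff: "twist_free (\<gamma> t) \<longleftrightarrow> (\<forall>I. u I t = 0)" if t: "t \<in> {s - e<..<s + e}" for t
  proof
    assume "twist_free (\<gamma> t)"
    then show "\<forall>I. u I t = 0"
      using E_tangent[OF near(1)[OF dist[OF t]]] by (auto simp: twist_free_def u_def)
  next
    assume "\<forall>I. u I t = 0"
    then show "twist_free (\<gamma> t)"
      by (intro twist_free_coord[OF U(1) near(1)[OF dist[OF t]]]) (auto simp: u_def E_def)
  qed
  have s: "s \<in> {s - e<..<s + e}" using e by simp
  have "twist_free (\<gamma> s) = twist_free (\<gamma> t)" if t: "t \<in> {s - e<..<s + e}" for t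
    using linear_ode_zero[OF u_deriv u_bound s _ t] linear_ode_zero[OF u_deriv u_bound t _ s]
    unfolding u_iff[OF s] u_iff[OF t] by blast
  moreover have "t \<in> {s - e<..<s + e}" if "dist t s < e" for t
    using that by (auto simp: dist_real_def abs_less_iff)
  ultimately show ?thesis
    unfolding eventually_at using e by blast
qed

text \<open>A locally constant truth value is constant on the line.\<close>

lemma twist_free_along:
  assumes \<gamma>: "integral_curve A k \<gamma>" and "twist_free (\<gamma> s)"
  shows "twist_free (\<gamma> t)"
proof -
  have "twist_free (\<gamma> s) = twist_free (\<gamma> t)"
    by (rule connected_local_const[of UNIV s t "\<lambda>t. twist_free (\<gamma> t)"])
      (auto intro: twist_free_local[OF \<gamma>])
  with assms(2) show ?thesis by simp
qed

section \<open>The Raychaudhuri equation\<close>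

definition expansion :: "'a \<Rightarrow> real" where
  "expansion p = tangent_trace A p (\<lambda>v. nabla p v k)"

definition nabla_k_square_trace :: "'a \<Rightarrow> real" where
  "nabla_k_square_trace p = tangent_trace A p (\<lambda>v. nabla p (nabla p v k) k)"

lemma nabla_k_endo: "tangent_endo p (\<lambda>v. nabla p v k)"
  by (rule nabla_endo[OF k_near])

lemma nabla_k_square_endo: "tangent_endo p (\<lambda>v. nabla p (nabla p v k) k)"
  using nabla_k_endo unfolding tangent_endo_def by simp

lemma nabla_k_matrix:
  assumes e: "tangent_basis A p e" and b: "\<And>j. nabla p (e j) k = (\<lambda>f. \<Sum>i\<in>UNIV. b i j * e i f)"
  shows "expansion p = (\<Sum>i\<in>UNIV. b i i)"
    and "nabla_k_square_trace p = (\<Sum>l\<in>UNIV. \<Sum>i\<in>UNIV. b l i * b i l)"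
proof -
  have "expansion p = trace (\<chi> i j. b i j)"
    unfolding expansion_def by (rule tangent_trace_eq[OF nabla_k_endo e]) (simp add: b)
  then show "expansion p = (\<Sum>i\<in>UNIV. b i i)" by (simp add: trace_def)
  have "nabla p (nabla p (e j) k) k = (\<lambda>f. \<Sum>l\<in>UNIV. (\<Sum>i\<in>UNIV. b l i * b i j) * e l f)" for j
  proof
    fix f
    have "nabla p (nabla p (e j) k) k f = (\<Sum>i\<in>UNIV. \<Sum>l\<in>UNIV. b l i * b i j * e l f)"
      unfolding b[of j] tangent_endo_sum[OF nabla_k_endo tangent_basis_mem[OF e]] b
      by (simp add: sum_distrib_left mult_ac)
    also have "\<dots> = (\<Sum>l\<in>UNIV. \<Sum>i\<in>UNIV. b l i * b i j * e l f)" by (rule sum.swap)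
    finally show "nabla p (nabla p (e j) k) k f = (\<Sum>l\<in>UNIV. (\<Sum>i\<in>UNIV. b l i * b i j) * e l f)"
      by (simp add: sum_distrib_right)
  qed
  then have "nabla_k_square_trace p = trace (\<chi> l j. \<Sum>i\<in>UNIV. b l i * b i j)"
    unfolding nabla_k_square_trace_def by (intro tangent_trace_eq[OF nabla_k_square_endo e]) simp
  then show "nabla_k_square_trace p = (\<Sum>l\<in>UNIV. \<Sum>i\<in>UNIV. b l i * b i l)" by (simp add: trace_def)
qed

text \<open>With \<open>B = \<nabla>k\<close>, commuting derivatives in \<open>\<nabla>\<^sub>k \<nabla>k\<close> and using \<open>\<nabla>\<^sub>k k = 0\<close> gives
  \<open>\<nabla>\<^sub>k B = - B\<^sup>2 - R(\<cdot>, k)k\<close>; the equation is the trace of this. In a coordinate frame \<open>E\<close>, the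
  connection coefficients \<open>c\<close> of \<open>\<nabla>\<^sub>k\<close> enter through the commutator of \<open>b\<close> and \<open>c\<close>, whose trace
  is zero.\<close>

lemma raychaudhuri:
  "smooth_near A p expansion"
  "k p expansion = - nabla_k_square_trace p - ricci A nabla p (k p) (k p)"
proof -
  obtain U \<phi> where U: "(U, \<phi>) \<in> A" "p \<in> U" by (rule chart_at)
  define E where "E = coord_field U \<phi>"
  define x where "x i = (\<lambda>r. \<phi> r $ i)" for i
  define b where "b i j q = nabla q (E j q) k (x i)" for i j q
  define c where "c i j = nabla p (k p) (E j) (x i)" for i j
  have E_field: "vector_field_on A U (E i)" for i
    unfolding E_def by (rule coord_field_vector_field[OF U(1)])
  note E_near = vector_field_nearI[OF E_field U(2)]
  have E_tangent: "q \<in> U \<Longrightarrow> E i q \<in> tangent_space A q" for i q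
    by (rule vector_field_tangent[OF E_field])
  have x_near: "smooth_near A p (x i)" for i
    unfolding x_def by (rule smooth_nearI[OF smooth_fun_on_coord[OF U(1)] U(2)])
  have basis: "q \<in> U \<Longrightarrow> tangent_basis A q (\<lambda>i. E i q)" for q
    unfolding E_def by (rule coord_field_basis[OF U(1)])
  have Ex: "E i p (x j) = (if i = j then 1 else 0)" for i j
    unfolding E_def x_def by (rule coord_field_coord[OF U])
  have b: "nabla q (E j q) k = (\<lambda>f. \<Sum>i\<in>UNIV. b i j q * E i q f)" if q: "q \<in> U" for j q
    unfolding b_def E_def x_def
    by (rule tangent_coord_expansion[OF U(1) q nabla_k_tangent[OF coord_field_tangent[OF U(1) q]]])
  have c: "nabla p (k p) (E j) = (\<lambda>f. \<Sum>i\<in>UNIV. c i j * E i p f)" for j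
    unfolding c_def E_def x_def
    by (rule tangent_coord_expansion[OF U nabla_tangent[OF k_tangent E_near[unfolded E_def]]])
  have b_near: "smooth_near A p (b i j)" for i j
    using vector_field_near_smooth[OF cov_field_near[OF E_near k_near] x_near]
    unfolding b_def[abs_def] cov_def .
  have ev: "\<forall>\<^sub>F q in nhds p. q \<in> U"
    using chart_open[OF U(1)] U(2) by (rule eventually_nhds_in_open)
  have b_sum: "smooth_near A p (\<lambda>q. \<Sum>i\<in>UNIV. b i i q)"
    by (rule smooth_near_sum) (rule b_near)
  have eq: "\<forall>\<^sub>F q in nhds p. (\<Sum>i\<in>UNIV. b i i q) = expansion q"
    using ev by eventually_elim (simp add: nabla_k_matrix(1)[OF basis b])
  from smooth_near_cong[OF b_sum eq] show "smooth_near A p expansion" .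
  have k_exp: "k p expansion = (\<Sum>i\<in>UNIV. k p (b i i))"
    using tangent_cong[OF k_tangent b_sum eq] tangent_sum[OF k_tangent, of UNIV p "\<lambda>i. b i i"] b_near
    by simp
  have cov_E: "nabla p (k p) (cov nabla (E j) k) (x l)
      = k p (b l j) + (\<Sum>i\<in>UNIV. b i j p * c l i)" for l j
  proof -
    have "\<forall>\<^sub>F q in nhds p. cov nabla (E j) k q = (\<lambda>f. \<Sum>i\<in>UNIV. b i j q * E i q f)"
      using ev by eventually_elim (simp add: cov_def b)
    from nabla_cong[OF k_tangent cov_field_near[OF E_near k_near] this]
    have "nabla p (k p) (cov nabla (E j) k) (x l)
        = (\<Sum>i\<in>UNIV. k p (b i j) * E i p (x l) + b i j p * nabla p (k p) (E i) (x l))"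
      by (simp add: nabla_sum[OF k_tangent b_near E_near])
    then show ?thesis
      by (simp add: Ex sum.distrib c_def[symmetric] if_distrib[of "(*) _"] cong: if_cong)
  qed
  have bracket: "nabla p (lie_bracket A (E j) k p) k (x l)
      = (\<Sum>i\<in>UNIV. (b i j p - c i j) * b l i p)" for l j
  proof -
    have "lie_bracket A (E j) k p = (\<lambda>f. \<Sum>i\<in>UNIV. (b i j p - c i j) * E i p f)"
      by (simp add: lie_bracket_eq[OF E_near k_near] b[OF U(2)] c sum_subtractf left_diff_distrib)
    then show ?thesis
      by (simp add: tangent_endo_sum[OF nabla_k_endo E_tangent[OF U(2)]] b_def)
  qed
  have r: "riemann p (E j) k k (x l) = - k p (b l j) - (\<Sum>i\<in>UNIV. b i j p * c l i)
      - (\<Sum>i\<in>UNIV. (b i j p - c i j) * b l i p)" for j l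
  proof -
    have "cov nabla k k = (\<lambda>_ _. 0)" using geodesic by auto
    then show ?thesis
      using nabla_zero[OF E_tangent[OF U(2)], of j] by (simp add: riemann_def cov_E bracket)
  qed
  have "curvature A nabla p (E j p) (k p) (k p) = (\<lambda>f. \<Sum>l\<in>UNIV. riemann p (E j) k k (x l) * E l p f)" for j
  proof -
    have "curvature A nabla p (E j p) (k p) (k p) \<in> tangent_space A p"
      using curvature_endo[OF k_near k_near] E_tangent[OF U(2)] by (auto simp: tangent_endo_def)
    from tangent_coord_expansion[OF U this, folded E_def x_def] show ?thesis
      unfolding curvature_eq[OF E_near k_near k_near] .
  qed
  then have "ricci A nabla p (k p) (k p) = trace (\<chi> l j. riemann p (E j) k k (x l))"
    unfolding ricci_def by (intro tangent_trace_eq[OF curvature_endo[OF k_near k_near] basis[OF U(2)]]) simp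
  also have "\<dots> = - (\<Sum>l\<in>UNIV. k p (b l l)) - (\<Sum>l\<in>UNIV. \<Sum>i\<in>UNIV. b l i p * b i l p)
      + ((\<Sum>l\<in>UNIV. \<Sum>i\<in>UNIV. c i l * b l i p) - (\<Sum>l\<in>UNIV. \<Sum>i\<in>UNIV. c l i * b i l p))"
    by (simp add: trace_def r sum_subtractf sum_negf sum.distrib algebra_simps)
  also have "(\<Sum>l\<in>UNIV. \<Sum>i\<in>UNIV. c i l * b l i p) = (\<Sum>l\<in>UNIV. \<Sum>i\<in>UNIV. c l i * b i l p)"
    by (rule sum.swap)
  finally show "k p expansion = - nabla_k_square_trace p - ricci A nabla p (k p) (k p)"
    by (simp add: k_exp nabla_k_matrix(2)[OF basis[OF U(2)] b[OF U(2)]])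
qed

text \<open>This is \<open>screen_trace_inequality\<close> for \<open>B = \<nabla>k\<close>: it kills \<open>k\<close> because \<open>k\<close> is geodesic, and it
  maps into \<open>k\<^sup>\<bottom>\<close> because \<open>g(k, k)\<close> is constant.\<close>

lemma twist_free_trace_inequality:
  assumes card: "CARD('n) = 4" and free: "twist_free p"
  shows "(expansion p)\<^sup>2 \<le> 2 * nabla_k_square_trace p"
proof -
  obtain e o\<^sub>0 where e: "tangent_basis A p e"
    and ortho: "\<And>i j. g p (e i) (e j) = (if i \<noteq> j then 0 else if i = o\<^sub>0 then -1 else 1)"
    using metric unfolding lorentzian_metric_def by metis
  define \<epsilon> :: "'n \<Rightarrow> real" where "\<epsilon> i = (if i = o\<^sub>0 then -1 else 1)" for i
  have \<epsilon>\<epsilon>: "\<epsilon> i * \<epsilon> i = 1" for i by (simp add: \<epsilon>_def)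
  have ortho': "g p (e i) (e j) = (if i = j then \<epsilon> i else 0)" for i j
    by (simp add: ortho \<epsilon>_def)
  note eT = tangent_basis_mem[OF e]
  have gsum: "g p (e i) (\<lambda>f. \<Sum>j\<in>UNIV. c j * e j f) = \<epsilon> i * c i" for c i
    by (simp add: g_sum_right[OF eT eT] ortho' if_distrib[of "(*) _"] cong: if_cong)
  obtain b where b: "\<forall>j. nabla p (e j) k = (\<lambda>f. \<Sum>i\<in>UNIV. b $ i $ j * e i f)"
    using tangent_basis_matrix[OF e, of "\<lambda>j. nabla p (e j) k"] nabla_k_tangent[OF eT] by blast
  obtain \<kappa> where \<kappa>: "k p = (\<lambda>f. \<Sum>i\<in>UNIV. \<kappa> i * e i f)"
    using e k_tangent[of p] unfolding tangent_basis_def by blast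
  define \<beta> where "\<beta> i j = g p (e i) (nabla p (e j) k)" for i j
  have b\<beta>: "b $ i $ j = \<epsilon> i * \<beta> i j" for i j
    unfolding \<beta>_def b[rule_format, of j] gsum using \<epsilon>\<epsilon>[of i] by (simp add: mult.assoc[symmetric])
  have ke: "g p (k p) (e i) = \<epsilon> i * \<kappa> i" for i
    using g_sym[OF k_tangent eT[of i]] by (simp add: \<kappa> gsum)
  have curl_e: "curl k p (e i) (e j) = \<beta> j i - \<beta> i j" for i j
    using g_sym[OF nabla_k_tangent[OF eT] eT] by (simp add: curl_def \<beta>_def)
  have "(\<Sum>i\<in>UNIV. \<epsilon> i * \<beta> i i)\<^sup>2 \<le> 2 * (\<Sum>i\<in>UNIV. \<Sum>j\<in>UNIV. \<epsilon> i * \<epsilon> j * (\<beta> i j * \<beta> j i))"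
  proof (rule screen_trace_inequality[OF card, where \<kappa> = \<kappa> and o\<^sub>0 = o\<^sub>0])
    show "\<epsilon> i = (if i = o\<^sub>0 then -1 else 1)" for i by (rule \<epsilon>_def)
    have "0 = (\<Sum>i\<in>UNIV. \<kappa> i * g p (e i) (k p))"
      using k_null[of p] g_sum_left[OF eT k_tangent, where I = UNIV and c = \<kappa>] \<kappa> by simp
    also have "\<dots> = (\<Sum>i\<in>UNIV. \<epsilon> i * (\<kappa> i)\<^sup>2)"
      by (simp add: g_sym[OF eT k_tangent] ke power2_eq_square mult_ac)
    finally show "(\<Sum>i\<in>UNIV. \<epsilon> i * (\<kappa> i)\<^sup>2) = 0" by simp
    have "\<exists>l. \<kappa> l \<noteq> 0"
    proof (rule ccontr)
      assume "\<not> (\<exists>l. \<kappa> l \<noteq> 0)"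
      then have "k p = (\<lambda>_. 0)" using \<kappa> by simp
      with k_nonzero show False by blast
    qed
    then show "\<kappa> (SOME l. \<kappa> l \<noteq> 0) \<noteq> 0" by (rule someI_ex)
    show "(\<Sum>i\<in>UNIV. \<kappa> i * \<beta> i j) = 0" for j
      using nabla_k_orthogonal[OF eT[of j]] g_sym[OF nabla_k_tangent[OF eT[of j]] k_tangent]
        g_sum_left[OF eT nabla_k_tangent[OF eT[of j]], where I = UNIV and c = \<kappa>] \<kappa> by (simp add: \<beta>_def)
    show "(\<Sum>j\<in>UNIV. \<beta> i j * \<kappa> j) = 0" for i
    proof -
      have "(\<lambda>_. 0) = (\<lambda>f. \<Sum>j\<in>UNIV. \<kappa> j * nabla p (e j) k f)"
        using nabla_k_k[of p] tangent_endo_sum[OF nabla_k_endo eT, where I = UNIV and c = \<kappa>] \<kappa> by simp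
      then have "g p (e i) (\<lambda>_. 0) = (\<Sum>j\<in>UNIV. \<kappa> j * \<beta> i j)"
        unfolding \<beta>_def using g_sum_right[OF nabla_k_tangent[OF eT] eT[of i], where I = UNIV and c = \<kappa>] by simp
      then show ?thesis
        using g_sym[OF eT[of i] tangent_zero] by (simp add: g_zero_left[OF eT] mult.commute)
    qed
    show "\<epsilon> i * \<kappa> i * (\<beta> l j - \<beta> j l) + \<epsilon> j * \<kappa> j * (\<beta> i l - \<beta> l i)
      + \<epsilon> l * \<kappa> l * (\<beta> j i - \<beta> i j) = 0" for i j l
      using free eT unfolding twist_free_def twist_def ke curl_e[symmetric]
      by (simp add: ke[symmetric])
  qed
  then show ?thesis
    using nabla_k_matrix[OF e b[rule_format]] by (simp add: b\<beta> mult_ac)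
qed

text \<open>Without twist at one point, there is none along the whole integral curve, and the Raychaudhuri
  equation becomes a Riccati inequality for the expansion on all of the real line.\<close>

lemma not_twist_free:
  assumes card: "CARD('n) = 4" and complete: "complete_field A k"
    and ricci: "\<And>p. ricci A nabla p (k p) (k p) > 0"
  shows "\<not> twist_free p"
proof
  assume free: "twist_free p"
  obtain \<gamma> where \<gamma>: "\<gamma> 0 = p" "integral_curve A k \<gamma>"
    using complete unfolding complete_field_def by blast
  show False
  proof (rule riccati_blowup)
    show "((\<lambda>t. expansion (\<gamma> t)) has_real_derivative k (\<gamma> t) expansion) (at t)" for t
      using \<gamma>(2) raychaudhuri(1) unfolding integral_curve_def by blast
    show "k (\<gamma> t) expansion < - (expansion (\<gamma> t))\<^sup>2 / 2" for t
      using twist_free_trace_inequality[OF card twist_free_along[OF \<gamma>(2), of 0 t]] free \<gamma>(1)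
        ricci[of "\<gamma> t"] raychaudhuri(2)[of "\<gamma> t"] by simp
  qed
qed

end

section \<open>The symplectic form and its Liouville field\<close>

context null_geodesic
begin

text \<open>Such a \<open>v\<close>, like \<open>k\<close>, is annihilated by the 3-form \<open>twist\<close>. On a four-dimensional space the
  kernel of a nonzero 3-form is a line.\<close>

lemma parallel_to_k:
  assumes card: "CARD('n) = 4" and free: "\<not> twist_free p" and v: "v \<in> tangent_space A p"
    and orth: "g p (k p) v = 0"
    and curl: "\<And>w. w \<in> tangent_space A p \<Longrightarrow> curl k p v w = a * g p (k p) w"
  obtains c where "v = (\<lambda>h. c * k p h)"
proof -
  obtain x y z where T: "x \<in> tangent_space A p" "y \<in> tangent_space A p" "z \<in> tangent_space A p"
    and nz: "twist p x y z \<noteq> 0"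
    using free unfolding twist_free_def by blast
  have twist_k: "twist p (k p) y z = 0" if "y \<in> tangent_space A p" "z \<in> tangent_space A p" for y z
    using that curl_antisym[of k p z "k p"] by (simp add: twist_def k_null curl_k)
  have twist_v: "twist p v y z = 0" if "y \<in> tangent_space A p" "z \<in> tangent_space A p" for y z
    using that curl_antisym[of k p z v] by (simp add: twist_def orth curl)
  obtain U \<phi> where U: "(U, \<phi>) \<in> A" "p \<in> U" by (rule chart_at)
  define X where "X u = (\<chi> i. u (\<lambda>r. \<phi> r $ i))" for u :: "'a tangent"
  define comb where "comb = (\<lambda>(b, c, d\<^sub>1, d\<^sub>2, d\<^sub>3) h. b * k p h + 1 * (c * v h
    + 1 * (d\<^sub>1 * x h + 1 * (d\<^sub>2 * y h + d\<^sub>3 * z h))))"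
  let ?L = "\<lambda>t. X (comb t) :: real ^ 'n"
  have comb_tangent: "comb t \<in> tangent_space A p" for t
    by (cases t) (auto simp only: comb_def prod.case intro!: tangent_lincomb k_tangent v T)
  have "linear ?L"
    by (intro linearI) (auto simp: X_def comb_def vec_eq_iff algebra_simps)
  \<comment> \<open>Five vectors in a four-dimensional space are dependent.\<close>
  moreover have "\<not> inj ?L"
  proof
    assume "inj ?L"
    then have "dim (range ?L) = dim (UNIV :: (real \<times> real \<times> real \<times> real \<times> real) set)"
      by (intro dim_image_eq \<open>linear ?L\<close>) (auto intro: inj_on_subset)
    moreover have "dim (range ?L) \<le> DIM(real ^ 'n)" by (rule dim_subset_UNIV)
    ultimately show False using card by simp
  qed
  ultimately obtain \<tau> where \<tau>: "\<tau> \<noteq> 0" "?L \<tau> = 0"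
    unfolding linear_injective_0[OF \<open>linear ?L\<close>] by blast
  obtain b c d\<^sub>1 d\<^sub>2 d\<^sub>3 where "\<tau> = (b, c, d\<^sub>1, d\<^sub>2, d\<^sub>3)"
    by (rule prod_cases5)
  with \<tau> have t: "(b, c, d\<^sub>1, d\<^sub>2, d\<^sub>3) \<noteq> (0, 0, 0, 0, 0)"
    and "?L (b, c, d\<^sub>1, d\<^sub>2, d\<^sub>3) = 0"
    by (simp_all only: zero_prod_def) auto
  then have "comb (b, c, d\<^sub>1, d\<^sub>2, d\<^sub>3) = (\<lambda>_. 0)"
    by (subst tangent_coord_expansion[OF U comb_tangent]) (simp add: X_def vec_eq_iff)
  then have zero: "(\<lambda>h. b * k p h + 1 * (c * v h + 1 * (d\<^sub>1 * x h + 1 * (d\<^sub>2 * y h + d\<^sub>3 * z h)))) = (\<lambda>_. 0)"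
    by (simp add: comb_def)
  have expand: "0 = d\<^sub>1 * twist p x u w + d\<^sub>2 * twist p y u w + d\<^sub>3 * twist p z u w"
    if uw: "u \<in> tangent_space A p" "w \<in> tangent_space A p" for u w
  proof -
    have "twist p (\<lambda>h. b * k p h + 1 * (c * v h + 1 * (d\<^sub>1 * x h + 1 * (d\<^sub>2 * y h + d\<^sub>3 * z h)))) u w = 0"
      unfolding zero by (rule twist_zero[OF uw])
    then show ?thesis
      by (simp only: twist_lin tangent_lincomb k_tangent v T uw twist_k twist_v) simp
  qed
  have "d\<^sub>1 = 0"
    using expand[OF T(2,3)] nz twist_repeat[of p y z] twist_repeat[of p z y] twist_cyclic[of p z y z]
      twist_cyclic[of p y z z] by simp
  moreover have "d\<^sub>2 = 0"
    using expand[OF T(3,1)] nz twist_repeat[of p z x] twist_repeat[of p x z] twist_cyclic[of p x y z]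
      twist_cyclic[of p x z x] twist_cyclic[of p z x x] by simp
  moreover have "d\<^sub>3 = 0"
    using expand[OF T(1,2)] nz twist_repeat[of p x y] twist_repeat[of p y x] twist_cyclic[of p z x y]
      twist_cyclic[of p y x y] twist_cyclic[of p x y y] by simp
  ultimately have bc: "b * k p h + c * v h = 0" for h
    using zero by (simp add: fun_eq_iff)
  have "c \<noteq> 0"
  proof
    assume "c = 0"
    then have "b = 0" using bc k_nonzero[of p] by (auto simp: fun_eq_iff)
    with t \<open>c = 0\<close> \<open>d\<^sub>1 = 0\<close> \<open>d\<^sub>2 = 0\<close> \<open>d\<^sub>3 = 0\<close> show False by simp
  qed
  then have "v h = - b / c * k p h" for h
    using bc[of h] by (simp add: field_simps)
  then show thesis by (intro that[of "- b / c"]) auto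
qed

end

locale scaled_null_geodesic = null_geodesic A g nabla k
  for A :: "('a::{t2_space, second_countable_topology}, 'n::finite) chart set" and g nabla k +
  fixes f :: "'a \<Rightarrow> real"
  assumes f_smooth: "smooth_fun_on A UNIV f" and k_f: "k p f \<noteq> 0"
begin

definition K :: "'a vfield" where
  "K = (\<lambda>p h. exp (f p) * k p h)"

definition V :: "'a vfield" where
  "V = (\<lambda>p h. k p h / k p f)"

definition \<omega> :: "'a tensor2" where
  "\<omega> = d1 A (flat g K)"

lemma f_near: "smooth_near A p f"
  using f_smooth by (rule smooth_nearI) simp

lemma K_field: "vector_field_on A UNIV K"
  unfolding K_def by (intro vector_field_mult k_field smooth_fun_on_exp f_smooth)

lemma K_near: "vector_field_near A p K"
  using K_field by (rule vector_field_nearI) simp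

lemma V_field: "vector_field_on A UNIV V"
proof -
  have "smooth_fun_on A UNIV (\<lambda>p. inverse (k p f))"
    using vector_field_smooth[OF k_field _ f_smooth] k_f by (intro smooth_fun_on_inverse) auto
  then have "vector_field_on A UNIV (\<lambda>p h. inverse (k p f) * k p h)"
    by (rule vector_field_mult[OF k_field])
  then show ?thesis by (simp add: V_def divide_inverse mult.commute)
qed

lemma V_near: "vector_field_near A p V"
  using V_field by (rule vector_field_nearI) simp

text \<open>This is \<open>d(e\<^sup>f \<alpha>) = e\<^sup>f (df \<and> \<alpha> + d\<alpha>)\<close> for \<open>\<alpha> = g(k, \<cdot>)\<close>.\<close>

lemma curl_K:
  assumes v: "v \<in> tangent_space A p" and w: "w \<in> tangent_space A p"
  shows "curl K p v w = exp (f p) * (v f * g p (k p) w - w f * g p (k p) v + curl k p v w)"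
proof -
  have "smooth_near A p (\<lambda>p. exp (f p))"
    using smooth_fun_on_exp[OF f_smooth] by (rule smooth_nearI) simp
  then have nK: "nabla p v K = (\<lambda>h. (exp (f p) * v f) * k p h + exp (f p) * nabla p v k h)"
    if v: "v \<in> tangent_space A p" for v
    unfolding K_def by (simp add: nabla_mult[OF v _ k_near] tangent_exp[OF v f_near])
  show ?thesis
    unfolding curl_def nK[OF v] nK[OF w] g_lin_left[OF k_tangent nabla_k_tangent[OF v] w]
      g_lin_left[OF k_tangent nabla_k_tangent[OF w] v]
    by (simp add: algebra_simps)
qed

lemma curl_K_k:
  assumes w: "w \<in> tangent_space A p"
  shows "curl K p (k p) w = exp (f p) * k p f * g p (k p) w"
  by (simp add: curl_K[OF k_tangent w] k_null curl_k[OF w])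

lemma curl_K_V:
  assumes w: "w \<in> tangent_space A p"
  shows "curl K p (V p) w = g p (K p) w"
proof -
  have V: "V p = (\<lambda>h. inverse (k p f) * k p h + 0 * k p h)"
    by (simp add: V_def divide_inverse mult.commute)
  have K: "K p = (\<lambda>h. exp (f p) * k p h)" by (simp add: K_def)
  show ?thesis
    unfolding V K curl_lin_left[OF K_near k_tangent k_tangent w] g_scale_left[OF k_tangent w]
      curl_K_k[OF w]
    using k_f[of p] by simp
qed

text \<open>Pairing a vector \<open>v\<close> in the kernel with \<open>k\<close> gives \<open>g(k, v) = 0\<close>; then \<open>d(g(k, \<cdot>))\<close> contracted
  with \<open>v\<close> is a multiple of \<open>g(k, \<cdot>)\<close>, so that \<open>v = c k\<close>, and pairing once more shows that
  \<open>c = 0\<close>.\<close>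

lemma curl_K_nondegenerate:
  assumes card: "CARD('n) = 4" and free: "\<not> twist_free p" and v: "v \<in> tangent_space A p"
    and zero: "\<And>w. w \<in> tangent_space A p \<Longrightarrow> curl K p v w = 0"
  shows "v = (\<lambda>_. 0)"
proof -
  have "curl K p (k p) v = 0"
    using zero[OF k_tangent] curl_antisym[of K p v] by simp
  then have orth: "g p (k p) v = 0"
    using curl_K_k[OF v] k_f[of p] by simp
  have "curl k p v w = - v f * g p (k p) w" if w: "w \<in> tangent_space A p" for w
    using zero[OF w] by (simp add: curl_K[OF v w] orth)
  then obtain c where c: "v = (\<lambda>h. c * k p h)"
    using parallel_to_k[OF card free v orth] by blast
  have "c * g p (k p) w = 0" if w: "w \<in> tangent_space A p" for w
    using zero[OF w] k_f[of p] curl_lin_left[OF K_near k_tangent k_tangent w, of c 0]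
    by (simp add: c curl_K_k[OF w])
  then have "c = 0"
    using g_nondegenerate[OF k_tangent[of p]] k_nonzero[of p] by fastforce
  then show ?thesis by (simp add: c)
qed

lemma \<omega>_eq: "v \<in> tangent_space A p \<Longrightarrow> w \<in> tangent_space A p \<Longrightarrow> \<omega> p v w = curl K p v w"
  unfolding \<omega>_def by (rule d1_flat[OF K_near])

lemma \<omega>_fields:
  assumes v: "v \<in> tangent_space A p" and X: "vector_field_near A p X" and Y: "vector_field_near A p Y"
  shows "v (\<lambda>q. \<omega> q (X q) (Y q)) = v (\<lambda>q. curl K q (X q) (Y q))"
proof (rule tangent_cong[OF v, symmetric])
  show "\<forall>\<^sub>F q in nhds p. curl K q (X q) (Y q) = \<omega> q (X q) (Y q)"
    using eventually_near[OF X] eventually_near[OF Y]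
    by eventually_elim (simp add: \<omega>_eq vector_field_near_tangent)
qed (rule curl_smooth_near[OF K_near X Y])

lemma \<omega>_two_form: "two_form A \<omega>"
  unfolding two_form_def tensor2_field_def
proof (intro conjI allI ballI impI)
  fix p u v w a b assume "u \<in> tangent_space A p" "v \<in> tangent_space A p" "w \<in> tangent_space A p"
  then show "\<omega> p (\<lambda>f. a * u f + b * v f) w = a * \<omega> p u w + b * \<omega> p v w"
    and "\<omega> p w (\<lambda>f. a * u f + b * v f) = a * \<omega> p w u + b * \<omega> p w v"
    by (simp_all add: \<omega>_eq tangent_lincomb curl_lin_left[OF K_near] curl_lin_right[OF K_near])
next
  fix p v w assume "v \<in> tangent_space A p" "w \<in> tangent_space A p"
  then show "\<omega> p v w = - \<omega> p w v" using curl_antisym[of K p v w] by (simp add: \<omega>_eq)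
next
  fix U X Y assume XY: "vector_field_on A U X \<and> vector_field_on A U Y"
  then have "vector_field_on A U K"
    using vector_field_subset[OF K_field] vector_field_open by blast
  then have "smooth_fun_on A U (\<lambda>p. curl K p (X p) (Y p))"
    using XY by (intro curl_smooth) auto
  then show "smooth_fun_on A U (\<lambda>p. \<omega> p (X p) (Y p))"
  proof (rule smooth_fun_on_cong)
    fix p assume "p \<in> U"
    then show "curl K p (X p) (Y p) = \<omega> p (X p) (Y p)"
      using XY vector_field_tangent \<omega>_eq by metis
  qed
qed

lemma \<omega>_closed:
  assumes "u \<in> tangent_space A p" "v \<in> tangent_space A p" "w \<in> tangent_space A p"
  shows "d2 A \<omega> p u v w = 0"
proof -
  note X = local_ext[OF assms(1)] and Y = local_ext[OF assms(2)] and Z = local_ext[OF assms(3)]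
  show ?thesis
    using curl_closed[OF K_near X(1) Y(1) Z(1)] assms X Y Z
    by (simp add: d2_def Let_def \<omega>_fields \<omega>_eq lie_bracket_near[THEN vector_field_near_tangent])
qed

lemma \<omega>_symplectic:
  assumes "CARD('n) = 4" "\<And>p. \<not> twist_free p"
  shows "symplectic_form A \<omega>"
  unfolding symplectic_form_def nondegenerate_def
  using \<omega>_two_form \<omega>_closed curl_K_nondegenerate[OF assms] by (auto simp: \<omega>_eq)

text \<open>Cartan's formula: \<open>L\<^sub>V \<omega> = d(\<iota>\<^sub>V \<omega>)\<close> as \<open>\<omega>\<close> is closed, and \<open>\<iota>\<^sub>V \<omega>\<close> is the
  1-form whose exterior derivative is \<open>\<omega>\<close>.\<close>

lemma \<omega>_liouville: "liouville_field A \<omega> V"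
  unfolding liouville_field_def
proof (intro conjI allI ballI)
  fix p v w assume v: "v \<in> tangent_space A p" and w: "w \<in> tangent_space A p"
  define X where "X = local_ext A p v"
  define Y where "Y = local_ext A p w"
  have X: "vector_field_near A p X" "X p = v" and Y: "vector_field_near A p Y" "Y p = w"
    using local_ext[OF v] local_ext[OF w] by (simp_all add: X_def Y_def)
  have contract: "u (\<lambda>q. curl K q (V q) (Z q)) = u (\<lambda>q. g q (K q) (Z q))"
    if u: "u \<in> tangent_space A p" and Z: "vector_field_near A p Z" for u Z
  proof (rule tangent_cong[OF u curl_smooth_near[OF K_near V_near Z]])
    show "\<forall>\<^sub>F q in nhds p. curl K q (V q) (Z q) = g q (K q) (Z q)"
      using eventually_near[OF Z] by eventually_elim (simp add: curl_K_V vector_field_near_tangent)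
  qed
  note VT = vector_field_near_tangent[OF V_near[of p]]
  have B: "lie_bracket A V X p \<in> tangent_space A p" "lie_bracket A V Y p \<in> tangent_space A p"
    "lie_bracket A X Y p \<in> tangent_space A p"
    by (intro lie_bracket_near[THEN vector_field_near_tangent] V_near X Y)+
  have "lie_derivative2 A V \<omega> p v w = V p (\<lambda>q. curl K q (X q) (Y q))
      - curl K p (lie_bracket A V X p) w - curl K p v (lie_bracket A V Y p)"
    unfolding lie_derivative2_def Let_def X_def[symmetric] Y_def[symmetric]
    using VT B v w X Y by (simp add: \<omega>_fields \<omega>_eq)
  also have "\<dots> = v (\<lambda>q. curl K q (V q) (Y q)) - w (\<lambda>q. curl K q (V q) (X q))
      + curl K p (lie_bracket A X Y p) (V p)"
    using curl_closed[OF K_near V_near X(1) Y(1)] X Y curl_antisym[of K p v "lie_bracket A V Y p"]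
    by simp
  also have "\<dots> = v (\<lambda>q. g q (K q) (Y q)) - w (\<lambda>q. g q (K q) (X q))
      - g p (K p) (lie_bracket A X Y p)"
    using contract[OF v Y(1)] contract[OF w X(1)] curl_K_V[OF B(3)]
      curl_antisym[of K p "lie_bracket A X Y p"] by simp
  also have "\<dots> = curl K p v w" using curl_eq[OF K_near X(1) Y(1)] X Y by simp
  finally show "lie_derivative2 A V \<omega> p v w = \<omega> p v w" using \<omega>_eq[OF v w] by simp
qed (rule V_field)

end

theorem theorem1:
  fixes A :: "('a::{t2_space, second_countable_topology}, 4) chart set"
    and g :: "'a tensor2"
    and nabla :: "'a connection"
    and k :: "'a vfield"
    and f :: "'a \<Rightarrow> real"
  assumes "smooth_atlas A"
    and "lorentzian_metric A g"
    and "levi_civita A g nabla"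
    and "null_field A g k"
    and "complete_field A k"
    and "\<And>p. cov nabla k k p = (\<lambda>_. 0)"
    and "\<And>p. ricci A nabla p (k p) (k p) > 0"
    and "smooth_fun_on A UNIV f"
    and "\<And>p. k p f \<noteq> 0"
  defines "\<omega> \<equiv> d1 A (flat g (\<lambda>p h. exp (f p) * k p h))"
  shows "symplectic_form A \<omega> \<and> liouville_field A \<omega> (\<lambda>p h. k p h / k p f)"
proof -
  interpret S: scaled_null_geodesic A g nabla k f
    using assms by unfold_locales
  have \<omega>: "\<omega> = S.\<omega>" by (simp add: \<omega>_def S.\<omega>_def S.K_def)
  have "\<not> S.twist_free p" for p
    by (rule S.not_twist_free) (simp_all add: assms)
  then show ?thesis
    using S.\<omega>_symplectic S.\<omega>_liouville by (simp add: \<omega> S.V_def)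
qed

end
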